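(* Let $f:[\frac12,\frac34]\to\mathbb{R}$ be given by $f(\rho)=\frac32(\rho-\frac12)$ for $\rho\in[\frac12,\frac{11}{18}]$, $f(\rho)=\rho-\frac49$ for $\rho\in[\frac{11}{18},\frac23]$, $f(\rho)=\frac29+2(\rho-\frac23)$ for $\rho\in[\frac23,\frac{13}{18}]$, and $f(\rho)=\frac38-\frac32(\frac34-\rho)$ for $\rho\in[\frac{13}{18},\frac34]$. Then \[\tau(\rho)\ge\begin{cases} f(\rho)-0.0010705 & \rho\in[\frac12,\frac{29}{54}],\\ f(\rho)-0.0044863 & \rho\in[\frac{29}{54},\frac{31}{54}],\\ f(\rho)-0.0106917 & \rho\in[\frac{31}{54},\frac{11}{18}],\\ f(\rho)-0.0106917 & \rho\in[\frac{11}{18},\frac{17}{27}],\\ f(\rho)-0.0058198 & \rho\in[\frac{17}{27},\frac{35}{54}],\\ f(\rho)-0.0002057 & \rho\in[\frac{35}{54},\frac23],\\ f(\rho)-0.00123143 & \rho\in[\frac23,\frac{25}{36}],\\ f(\rho)-0.00534603 & \rho\in[\frac{25}{36},\frac{13}{18}],\\ f(\rho)-0.00534583 & \rho\in[\frac{13}{18},\frac{53}{72}],\\ f(\rho)-0.00189005 & \rho\in[\frac{53}{72},\frac34]. \end{cases}\]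
   Context: For a graph $G$ on $n$ vertices, $\rho(G)=e(G)/\binom{n}{2}$; the triangle-degree of a vertex is the number of triangles containing it, and $t_{\max}(G)$ is the maximum triangle-degree over all vertices. For $\rho\in[0,1]$, $\tau(\rho)=\liminf_{n\to\infty}\min\{t_{\max}(G)/\binom{n-1}{2}: v(G)=n,\ \rho(G)\ge\rho\}$. *)

theory Defs
  imports "HOL-Analysis.Analysis" "HOL-Library.Ramsey"
begin

text \<open>Finite simple graphs are pairs of a finite vertex set and a set of 2-element subsets of it;
  \<open>[V]\<^bsup>k\<^esup>\<close> is the set of \<open>k\<close>-element subsets of \<open>V\<close>.\<close>

type_synonym 'a graph = "'a set \<times> 'a set set"

definition verts :: "'a graph \<Rightarrow> 'a set" where
  "verts G = fst G"

definition edges :: "'a graph \<Rightarrow> 'a set set" where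
  "edges G = snd G"

definition simple_graph :: "'a graph \<Rightarrow> bool" where
  "simple_graph G \<longleftrightarrow> finite (verts G) \<and> edges G \<subseteq> [verts G]\<^bsup>2\<^esup>"

definition edge_density :: "'a graph \<Rightarrow> real" where
  "edge_density G = real (card (edges G)) / real (card (verts G) choose 2)"

definition triangles :: "'a graph \<Rightarrow> 'a set set" where
  "triangles G = {T \<in> [verts G]\<^bsup>3\<^esup>. [T]\<^bsup>2\<^esup> \<subseteq> edges G}"

definition triangle_degree :: "'a graph \<Rightarrow> 'a \<Rightarrow> nat" where
  "triangle_degree G v = card {T \<in> triangles G. v \<in> T}"

definition t_max :: "'a graph \<Rightarrow> nat" where
  "t_max G = Max (triangle_degree G ` verts G)"

text \<open>Every finite graph is isomorphic to one whose vertices are natural numbers, so \<open>nat\<close> vertices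
  lose no generality. The set is finite, and it is nonempty for \<open>n \<ge> 2\<close> and \<open>\<rho> \<le> 1\<close> (see below),
  so that its \<open>Min\<close> is meaningful for all \<open>n\<close> that matter for the limit inferior.\<close>

definition t_max_values :: "real \<Rightarrow> nat \<Rightarrow> real set" where
  "t_max_values \<rho> n =
     {real (t_max G) / real ((n - 1) choose 2) | G :: nat graph.
        simple_graph G \<and> card (verts G) = n \<and> edge_density G \<ge> \<rho>}"

definition tau :: "real \<Rightarrow> ereal" where
  "tau \<rho> = liminf (\<lambda>n. ereal (Min (t_max_values \<rho> n)))"

text \<open>Only the values on \<open>[1/2, 3/4]\<close> matter; adjacent formulas agree at the common endpoints.\<close>

definition tau_target :: "real \<Rightarrow> real" where
  "tau_target \<rho> =
    (if \<rho> \<le> 11/18 then 3/2 * (\<rho> - 1/2)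
     else if \<rho> \<le> 2/3 then \<rho> - 4/9
     else if \<rho> \<le> 13/18 then 2/9 + 2 * (\<rho> - 2/3)
     else 3/8 - 3/2 * (3/4 - \<rho>))"

lemma tau_target_piecewise:
  "\<rho> \<in> {1/2..11/18} \<Longrightarrow> tau_target \<rho> = 3/2 * (\<rho> - 1/2)"
  "\<rho> \<in> {11/18..2/3} \<Longrightarrow> tau_target \<rho> = \<rho> - 4/9"
  "\<rho> \<in> {2/3..13/18} \<Longrightarrow> tau_target \<rho> = 2/9 + 2 * (\<rho> - 2/3)"
  "\<rho> \<in> {13/18..3/4} \<Longrightarrow> tau_target \<rho> = 3/8 - 3/2 * (3/4 - \<rho>)"
  unfolding tau_target_def atLeastAtMost_iff by argo+

lemma t_max_le:
  assumes "simple_graph G" "verts G \<noteq> {}"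
  shows "t_max G \<le> 2 ^ card (verts G)"
proof -
  have fin: "finite (verts G)" using assms(1) by (simp add: simple_graph_def)
  have "triangle_degree G v \<le> 2 ^ card (verts G)" for v
  proof -
    have "{T \<in> triangles G. v \<in> T} \<subseteq> Pow (verts G)"
      by (auto simp: triangles_def nsets_def)
    then have "card {T \<in> triangles G. v \<in> T} \<le> card (Pow (verts G))"
      using fin by (intro card_mono) auto
    then show ?thesis using fin by (simp add: triangle_degree_def card_Pow)
  qed
  then show ?thesis using fin assms(2) by (simp add: t_max_def)
qed

lemma finite_t_max_values: "finite (t_max_values \<rho> n)"
proof (rule finite_subset)
  let ?h = "\<lambda>k. real k / real ((n - 1) choose 2)"
  show "finite (?h ` insert (Max {}) {..2 ^ n})" by simp
  show "t_max_values \<rho> n \<subseteq> ?h ` insert (Max {}) {..2 ^ n}"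
  proof
    fix x assume "x \<in> t_max_values \<rho> n"
    then obtain G :: "nat graph" where G: "simple_graph G" "card (verts G) = n" "x = ?h (t_max G)"
      by (auto simp: t_max_values_def)
    have "t_max G \<in> insert (Max {}) {..2 ^ n}"
    proof (cases "verts G = {}")
      case True then show ?thesis by (simp add: t_max_def)
    next
      case False then show ?thesis using t_max_le[OF G(1)] G(2) by simp
    qed
    then show "x \<in> ?h ` insert (Max {}) {..2 ^ n}" using G(3) by blast
  qed
qed

lemma t_max_values_nonempty:
  assumes "n \<ge> 2" "\<rho> \<le> 1"
  shows "t_max_values \<rho> n \<noteq> {}"
proof -
  let ?G = "({..<n}, [{..<n}]\<^bsup>2\<^esup>) :: nat graph"
  have "n choose 2 > 0" using assms(1) by simp
  then have "simple_graph ?G" "card (verts ?G) = n" "edge_density ?G \<ge> \<rho>"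
    using assms(2) by (auto simp: simple_graph_def verts_def edges_def edge_density_def)
  then show ?thesis unfolding t_max_values_def by blast
qed

end

theory Submission
  imports Defs "HOL-Real_Asymp.Real_Asymp"
begin

text \<open>
  Suppose \<open>t(v) \<le> l(e)\<close> for all vertices \<open>v\<close>, where \<open>t(v)\<close> is the normalised triangle-degree,
  \<open>e\<close> the edge density and \<open>l\<close> the affine function that is to be refuted. Multiplying by a nonnegative
  weight that depends on three further vertices and averaging yields linear inequalities between
  the densities of the graphs on six vertices; these are combined with sums of squares of
  densities of graphs rooted at four vertices or at an edge, and with multiples of \<open>e \<ge> lo\<close> and
  \<open>e \<le> hi\<close>. For suitable multipliers every coefficient of the resulting inequality has the wrong
  sign. All densities count tuples with repetition, so the inequalities are exact for every
  finite graph and the empty graph on six vertices has positive density.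

  The multipliers are solutions of semidefinite programs, rounded to sums of squares of integer
  vectors. An excess of edges is removed first, so that \<open>e\<close> lies in the range of the certificate.
\<close>

section \<open>Labelled graphs on six vertices\<close>

text \<open>Averaging \<open>t(v) <= l(e)\<close> over \<open>v\<close> alone would retain only the
  total number of triangles. Weighting by the graph that \<open>v\<close> forms with three further
  vertices records how triangles are distributed; two more vertices, which express
  \<open>t(v)\<close> and \<open>e\<close>, make six. Each \<open>l\<close> has the slope of the
  matching piece of \<open>tau_target\<close>, so its loss is constant on the range. Deleting edges
  never increases a triangle-degree, which makes it harmless to trim the graph into that range. The
  obstacle is size. There are 2^15 labelled patterns, and the signs are tested after isomorphic
  patterns have been merged. Canonical forms are therefore supplied as words in transpositions
  instead of being searched for: a bad word can make a check fail but cannot make it unsound. All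
  data are integers and coefficients live in a trie, so that a whole certificate is evaluated by
  rewriting. Counting tuples with repetition has one price: a graph trimmed to density
  \<open>rho\<close> shows up with \<open>e\<close> about \<open>rho * (1 - 1/n)\<close>, so the
  lower end of each certified range lies strictly below the interval that it serves.\<close>

datatype transp = S12 | S13 | S14 | S15 | S16 | S23 | S24 | S25 | S26 | S34 | S35 | S36 | S45 | S46 | S56

text \<open>The adjacencies are listed as 12, 13, 14, 23, 24, 34 (the type), 15, 25, 35, 45, then
  16, 26, 36, 46 (the attachments of the vertices 5 and 6), and 56.\<close>

datatype pattern = Pat bool bool bool bool bool bool bool bool bool bool bool bool bool bool bool

text \<open>Transpositions generate all relabellings, so a word in them reaches any isomorphic
  pattern while invariance has to be proved for single swaps only. Explicit equations let one
  rewrite step move all fifteen entries.\<close>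

fun swap_pat :: "transp \<Rightarrow> pattern \<Rightarrow> pattern" where
  "swap_pat S12 (Pat e12 e13 e14 e23 e24 e34 e15 e25 e35 e45 e16 e26 e36 e46 e56)
    = Pat e12 e23 e24 e13 e14 e34 e25 e15 e35 e45 e26 e16 e36 e46 e56"
| "swap_pat S13 (Pat e12 e13 e14 e23 e24 e34 e15 e25 e35 e45 e16 e26 e36 e46 e56)
    = Pat e23 e13 e34 e12 e24 e14 e35 e25 e15 e45 e36 e26 e16 e46 e56"
| "swap_pat S14 (Pat e12 e13 e14 e23 e24 e34 e15 e25 e35 e45 e16 e26 e36 e46 e56)
    = Pat e24 e34 e14 e23 e12 e13 e45 e25 e35 e15 e46 e26 e36 e16 e56"
| "swap_pat S15 (Pat e12 e13 e14 e23 e24 e34 e15 e25 e35 e45 e16 e26 e36 e46 e56)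
    = Pat e25 e35 e45 e23 e24 e34 e15 e12 e13 e14 e56 e26 e36 e46 e16"
| "swap_pat S16 (Pat e12 e13 e14 e23 e24 e34 e15 e25 e35 e45 e16 e26 e36 e46 e56)
    = Pat e26 e36 e46 e23 e24 e34 e56 e25 e35 e45 e16 e12 e13 e14 e15"
| "swap_pat S23 (Pat e12 e13 e14 e23 e24 e34 e15 e25 e35 e45 e16 e26 e36 e46 e56)
    = Pat e13 e12 e14 e23 e34 e24 e15 e35 e25 e45 e16 e36 e26 e46 e56"
| "swap_pat S24 (Pat e12 e13 e14 e23 e24 e34 e15 e25 e35 e45 e16 e26 e36 e46 e56)
    = Pat e14 e13 e12 e34 e24 e23 e15 e45 e35 e25 e16 e46 e36 e26 e56"
| "swap_pat S25 (Pat e12 e13 e14 e23 e24 e34 e15 e25 e35 e45 e16 e26 e36 e46 e56)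
    = Pat e15 e13 e14 e35 e45 e34 e12 e25 e23 e24 e16 e56 e36 e46 e26"
| "swap_pat S26 (Pat e12 e13 e14 e23 e24 e34 e15 e25 e35 e45 e16 e26 e36 e46 e56)
    = Pat e16 e13 e14 e36 e46 e34 e15 e56 e35 e45 e12 e26 e23 e24 e25"
| "swap_pat S34 (Pat e12 e13 e14 e23 e24 e34 e15 e25 e35 e45 e16 e26 e36 e46 e56)
    = Pat e12 e14 e13 e24 e23 e34 e15 e25 e45 e35 e16 e26 e46 e36 e56"
| "swap_pat S35 (Pat e12 e13 e14 e23 e24 e34 e15 e25 e35 e45 e16 e26 e36 e46 e56)
    = Pat e12 e15 e14 e25 e24 e45 e13 e23 e35 e34 e16 e26 e56 e46 e36"
| "swap_pat S36 (Pat e12 e13 e14 e23 e24 e34 e15 e25 e35 e45 e16 e26 e36 e46 e56)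
    = Pat e12 e16 e14 e26 e24 e46 e15 e25 e56 e45 e13 e23 e36 e34 e35"
| "swap_pat S45 (Pat e12 e13 e14 e23 e24 e34 e15 e25 e35 e45 e16 e26 e36 e46 e56)
    = Pat e12 e13 e15 e23 e25 e35 e14 e24 e34 e45 e16 e26 e36 e56 e46"
| "swap_pat S46 (Pat e12 e13 e14 e23 e24 e34 e15 e25 e35 e45 e16 e26 e36 e46 e56)
    = Pat e12 e13 e16 e23 e26 e36 e15 e25 e35 e56 e14 e24 e34 e46 e45"
| "swap_pat S56 (Pat e12 e13 e14 e23 e24 e34 e15 e25 e35 e45 e16 e26 e36 e46 e56)
    = Pat e12 e13 e14 e23 e24 e34 e16 e26 e36 e46 e15 e25 e35 e45 e56"

fun swap_tup :: "transp \<Rightarrow> 'a \<times> 'a \<times> 'a \<times> 'a \<times> 'a \<times> 'a \<Rightarrow> 'a \<times> 'a \<times> 'a \<times> 'a \<times> 'a \<times> 'a" where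
  "swap_tup S12 (u1, u2, u3, u4, u5, u6) = (u2, u1, u3, u4, u5, u6)"
| "swap_tup S13 (u1, u2, u3, u4, u5, u6) = (u3, u2, u1, u4, u5, u6)"
| "swap_tup S14 (u1, u2, u3, u4, u5, u6) = (u4, u2, u3, u1, u5, u6)"
| "swap_tup S15 (u1, u2, u3, u4, u5, u6) = (u5, u2, u3, u4, u1, u6)"
| "swap_tup S16 (u1, u2, u3, u4, u5, u6) = (u6, u2, u3, u4, u5, u1)"
| "swap_tup S23 (u1, u2, u3, u4, u5, u6) = (u1, u3, u2, u4, u5, u6)"
| "swap_tup S24 (u1, u2, u3, u4, u5, u6) = (u1, u4, u3, u2, u5, u6)"
| "swap_tup S25 (u1, u2, u3, u4, u5, u6) = (u1, u5, u3, u4, u2, u6)"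
| "swap_tup S26 (u1, u2, u3, u4, u5, u6) = (u1, u6, u3, u4, u5, u2)"
| "swap_tup S34 (u1, u2, u3, u4, u5, u6) = (u1, u2, u4, u3, u5, u6)"
| "swap_tup S35 (u1, u2, u3, u4, u5, u6) = (u1, u2, u5, u4, u3, u6)"
| "swap_tup S36 (u1, u2, u3, u4, u5, u6) = (u1, u2, u6, u4, u5, u3)"
| "swap_tup S45 (u1, u2, u3, u4, u5, u6) = (u1, u2, u3, u5, u4, u6)"
| "swap_tup S46 (u1, u2, u3, u4, u5, u6) = (u1, u2, u3, u6, u5, u4)"
| "swap_tup S56 (u1, u2, u3, u4, u5, u6) = (u1, u2, u3, u4, u6, u5)"

fun bits :: "pattern \<Rightarrow> bool list" where
  "bits (Pat e12 e13 e14 e23 e24 e34 e15 e25 e35 e45 e16 e26 e36 e46 e56)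
    = [e12, e13, e14, e23, e24, e34, e15, e25, e35, e45, e16, e26, e36, e46, e56]"

primrec apply_word :: "transp list \<Rightarrow> pattern \<Rightarrow> pattern" where
  "apply_word [] p = p"
| "apply_word (m # ms) p = apply_word ms (swap_pat m p)"

lemma swap_tup_swap_tup: "swap_tup m (swap_tup m x) = x"
  by (cases m; cases x) simp_all

lemma swap_pat_swap_pat: "swap_pat m (swap_pat m p) = p"
  by (cases m; cases p) simp_all

lemma bits_inj: "bits p = bits q \<longleftrightarrow> p = q"
  by (cases p; cases q) simp

lemma length_bits [simp]: "length (bits p) = 15"
  by (cases p) simp

fun pat_of :: "('a \<Rightarrow> 'a \<Rightarrow> bool) \<Rightarrow> 'a \<times> 'a \<times> 'a \<times> 'a \<times> 'a \<times> 'a \<Rightarrow> pattern" where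
  "pat_of a (u1, u2, u3, u4, u5, u6)
    = Pat (a u1 u2) (a u1 u3) (a u1 u4) (a u2 u3) (a u2 u4) (a u3 u4)
        (a u1 u5) (a u2 u5) (a u3 u5) (a u4 u5) (a u1 u6) (a u2 u6) (a u3 u6) (a u4 u6) (a u5 u6)"

definition pow6 :: "'a set \<Rightarrow> ('a \<times> 'a \<times> 'a \<times> 'a \<times> 'a \<times> 'a) set" where
  "pow6 V = V \<times> V \<times> V \<times> V \<times> V \<times> V"

text \<open>Tries are keyed by bit lists, relabelling works on patterns, hence two versions of the
  same count. A list of length other than 15 has count zero, which keeps the count nonnegative on
  every key.\<close>

definition count_bits :: "'a set \<Rightarrow> ('a \<Rightarrow> 'a \<Rightarrow> bool) \<Rightarrow> bool list \<Rightarrow> real" where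
  "count_bits V a bs = (\<Sum>x\<in>pow6 V. of_bool (bits (pat_of a x) = bs))"

definition count_pat :: "'a set \<Rightarrow> ('a \<Rightarrow> 'a \<Rightarrow> bool) \<Rightarrow> pattern \<Rightarrow> real" where
  "count_pat V a p = (\<Sum>x\<in>pow6 V. of_bool (pat_of a x = p))"

lemma count_bits_bits: "count_bits V a (bits p) = count_pat V a p"
  by (simp add: count_bits_def count_pat_def bits_inj)

lemma count_bits_nonneg: "count_bits V a bs \<ge> 0"
  by (simp add: count_bits_def sum_nonneg)

text \<open>Symmetry of \<open>a\<close> enters because a swap may reverse the order in which the
  two ends of an adjacency are listed.\<close>

lemma pat_of_swap_tup:
  assumes "\<And>x y. a x y \<longleftrightarrow> a y x"
  shows "pat_of a (swap_tup m x) = swap_pat m (pat_of a x)"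
  by (cases x; cases m) (simp_all add: assms)

text \<open>\<open>swap_tup m\<close> is an involution of \<open>pow6 V\<close>, so reindexing by it
  turns one count into the other. This invariance is what allows isomorphic patterns to share one
  coefficient.\<close>

lemma count_pat_swap:
  assumes "\<And>x y. a x y \<longleftrightarrow> a y x"
  shows "count_pat V a (swap_pat m p) = count_pat V a p"
proof -
  have mem: "swap_tup m x \<in> pow6 V" if "x \<in> pow6 V" for x
    using that by (cases m; cases x) (auto simp: pow6_def)
  have "count_pat V a (swap_pat m p) = (\<Sum>x\<in>pow6 V. of_bool (pat_of a (swap_tup m x) = p))"
    unfolding count_pat_def pat_of_swap_tup[OF assms]
    by (rule sum.cong) (auto simp: of_bool_def swap_pat_swap_pat)
  also have "\<dots> = count_pat V a p"
    unfolding count_pat_def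
    by (rule sum.reindex_bij_witness[of _ "swap_tup m" "swap_tup m"])
      (auto simp: swap_tup_swap_tup mem)
  finally show ?thesis .
qed

lemma count_pat_word:
  assumes "\<And>x y. a x y \<longleftrightarrow> a y x"
  shows "count_pat V a (apply_word w p) = count_pat V a p"
  by (induction w arbitrary: p) (simp_all add: count_pat_swap[OF assms])

section \<open>Integer combinations of pattern counts, stored in binary tries\<close>

datatype trie = Empty | Leaf int | Node trie trie

text \<open>Inserting at an existing key adds the coefficients. The last two equations drop the new
  coefficient; they concern a key whose length disagrees with the depth of the trie, which
  \<open>trie_depth\<close> rules out.\<close>

fun insert_trie :: "bool list \<Rightarrow> int \<Rightarrow> trie \<Rightarrow> trie" where
  "insert_trie [] x Empty = Leaf x"
| "insert_trie [] x (Leaf y) = Leaf (x + y)"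
| "insert_trie (True # bs) x Empty = Node (insert_trie bs x Empty) Empty"
| "insert_trie (False # bs) x Empty = Node Empty (insert_trie bs x Empty)"
| "insert_trie (True # bs) x (Node l r) = Node (insert_trie bs x l) r"
| "insert_trie (False # bs) x (Node l r) = Node l (insert_trie bs x r)"
| "insert_trie [] x (Node l r) = Node l r"
| "insert_trie (b # bs) x (Leaf y) = Leaf y"

text \<open>The path walked so far is absorbed into \<open>c\<close>, so the key at a leaf is the
  empty list and the induction hypotheses must allow \<open>c\<close> to vary.\<close>

fun trie_sum :: "trie \<Rightarrow> (bool list \<Rightarrow> real) \<Rightarrow> real" where
  "trie_sum Empty c = 0"
| "trie_sum (Leaf x) c = of_int x * c []"
| "trie_sum (Node l r) c = trie_sum l (\<lambda>bs. c (True # bs)) + trie_sum r (\<lambda>bs. c (False # bs))"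

fun trie_depth :: "nat \<Rightarrow> trie \<Rightarrow> bool" where
  "trie_depth n Empty \<longleftrightarrow> True"
| "trie_depth n (Leaf x) \<longleftrightarrow> n = 0"
| "trie_depth n (Node l r) \<longleftrightarrow> (\<exists>m. n = Suc m \<and> trie_depth m l \<and> trie_depth m r)"

fun trie_nonpos :: "trie \<Rightarrow> bool" where
  "trie_nonpos Empty = True"
| "trie_nonpos (Leaf x) = (x \<le> 0)"
| "trie_nonpos (Node l r) = (trie_nonpos l \<and> trie_nonpos r)"

lemma trie_depth_insert: "trie_depth (length bs) t \<Longrightarrow> trie_depth (length bs) (insert_trie bs x t)"
  by (induction bs x t rule: insert_trie.induct) auto

lemma trie_sum_insert:
  "trie_depth (length bs) t \<Longrightarrow> trie_sum (insert_trie bs x t) c = trie_sum t c + of_int x * c bs"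
  by (induction bs x t arbitrary: c rule: insert_trie.induct) (auto simp: algebra_simps)

lemma trie_sum_nonpos:
  assumes "trie_nonpos t" "\<And>bs. c bs \<ge> 0"
  shows "trie_sum t c \<le> 0"
  using assms
proof (induction t arbitrary: c)
  case (Leaf x)
  then show ?case by (simp add: mult_nonpos_nonneg)
next
  case (Node l r)
  then show ?case by (simp add: add_nonpos_nonpos)
qed simp

section \<open>Quadratic forms with integer coefficients and sums of squares\<close>

fun quad_row :: "int list \<Rightarrow> 'k list \<Rightarrow> ('k \<Rightarrow> real) \<Rightarrow> real" where
  "quad_row (x # xs) (l # ls) c = of_int x * c l + quad_row xs ls c"
| "quad_row [] ls c = 0"
| "quad_row xs [] c = 0"

text \<open>Symmetric forms are stored as the rows of their upper triangle, with the off-diagonal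
  entries doubled.\<close>

fun quad :: "int list list \<Rightarrow> 'k list \<Rightarrow> ('k \<Rightarrow> 'k \<Rightarrow> real) \<Rightarrow> real" where
  "quad (r # rs) (k # ks) c = quad_row r (k # ks) (c k) + quad rs ks c"
| "quad [] ks c = 0"
| "quad rs [] c = 0"

fun add_row :: "int list \<Rightarrow> int list \<Rightarrow> int list" where
  "add_row (x # xs) (y # ys) = (x + y) # add_row xs ys"
| "add_row [] ys = ys"
| "add_row xs [] = xs"

fun add_rows :: "int list list \<Rightarrow> int list list \<Rightarrow> int list list" where
  "add_rows (x # xs) (y # ys) = add_row x y # add_rows xs ys"
| "add_rows [] ys = ys"
| "add_rows xs [] = xs"

fun scale_row :: "int \<Rightarrow> int list \<Rightarrow> int list" where
  "scale_row d [] = []"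
| "scale_row d (x # xs) = (d * x) # scale_row d xs"

text \<open>The expansion of \<open>d\<close> times the square of the linear form \<open>q\<close>,
  in upper-triangular storage; the factor 2 in the tail is the doubling of the off-diagonal
  entries.\<close>

fun square_rows :: "int \<Rightarrow> int list \<Rightarrow> int list list" where
  "square_rows d [] = []"
| "square_rows d (x # xs) = (d * (x * x) # scale_row (2 * (d * x)) xs) # square_rows d xs"

fun sos_rows :: "(int \<times> int list) list \<Rightarrow> int list list" where
  "sos_rows [] = []"
| "sos_rows ((d, q) # s) = add_rows (square_rows d q) (sos_rows s)"

fun sos_nonneg :: "(int \<times> int list) list \<Rightarrow> bool" where
  "sos_nonneg [] = True"
| "sos_nonneg ((d, q) # s) = (0 \<le> d \<and> sos_nonneg s)"

fun form_row :: "('k \<Rightarrow> 'k \<Rightarrow> int) \<Rightarrow> 'k \<Rightarrow> 'k list \<Rightarrow> int list" where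
  "form_row f k [] = []"
| "form_row f k (l # ls) = (2 * f k l) # form_row f k ls"

fun form_rows :: "('k \<Rightarrow> 'k \<Rightarrow> int) \<Rightarrow> 'k list \<Rightarrow> int list list" where
  "form_rows f [] = []"
| "form_rows f (k # ks) = (f k k # form_row f k ks) # form_rows f ks"

text \<open>The words run parallel to the entries of the row, and each sends its pattern to the
  chosen representative before insertion. An exhausted list of words stands for identity
  words.\<close>

fun fill_row :: "('k \<Rightarrow> 'k \<Rightarrow> pattern) \<Rightarrow> 'k \<Rightarrow> int list \<Rightarrow> 'k list \<Rightarrow> transp list list \<Rightarrow> trie \<Rightarrow> trie"
where
  "fill_row P k (x # xs) (l # ls) (w # ws) t
    = fill_row P k xs ls ws (insert_trie (bits (apply_word w (P k l))) x t)"
| "fill_row P k (x # xs) (l # ls) [] t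
    = fill_row P k xs ls [] (insert_trie (bits (P k l)) x t)"
| "fill_row P k [] ls ws t = t"
| "fill_row P k xs [] ws t = t"

fun fill :: "('k \<Rightarrow> 'k \<Rightarrow> pattern) \<Rightarrow> int list list \<Rightarrow> 'k list \<Rightarrow> transp list list list \<Rightarrow> trie \<Rightarrow> trie"
where
  "fill P (r # rs) (k # ks) (w # ws) t = fill P rs ks ws (fill_row P k r (k # ks) w t)"
| "fill P (r # rs) (k # ks) [] t = fill P rs ks [] (fill_row P k r (k # ks) [] t)"
| "fill P [] ks ws t = t"
| "fill P rs [] ws t = t"

lemma quad_row_Nil [simp]: "quad_row xs [] c = 0"
  by (cases xs) simp_all

lemma quad_Nil [simp]: "quad rs [] c = 0"
  by (cases rs) simp_all

lemma quad_row_add: "quad_row (add_row r s) ks c = quad_row r ks c + quad_row s ks c"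
proof (induction r ks c arbitrary: s rule: quad_row.induct)
  case (1 x xs l ls c)
  then show ?case by (cases s) (simp_all add: algebra_simps)
qed simp_all

lemma quad_add: "quad (add_rows r s) ks c = quad r ks c + quad s ks c"
proof (induction r ks c arbitrary: s rule: quad.induct)
  case (1 x xs l ls c)
  then show ?case by (cases s) (simp_all add: quad_row_add)
qed simp_all

lemma quad_row_plus: "quad_row xs ks (\<lambda>l. c l + d l) = quad_row xs ks c + quad_row xs ks d"
  by (induction xs ks c rule: quad_row.induct) (simp_all add: algebra_simps)

lemma quad_plus: "quad r ks (\<lambda>k l. c k l + d k l) = quad r ks c + quad r ks d"
  by (induction r ks c rule: quad.induct) (simp_all add: quad_row_plus)

lemma quad_zero: "quad r ks (\<lambda>k l. 0) = 0"
proof -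
  have "quad_row xs ls (\<lambda>l. 0) = 0" for xs and ls :: "'a list"
    by (induction xs ls "\<lambda>l::'a. 0::real" rule: quad_row.induct) simp_all
  then show ?thesis
    by (induction r ks "\<lambda>(k::'a) (l::'a). 0::real" rule: quad.induct) simp_all
qed

lemma quad_row_scale: "quad_row (scale_row d xs) ks c = of_int d * quad_row xs ks c"
  by (induction xs ks c rule: quad_row.induct) (simp_all add: algebra_simps)

lemma quad_row_sum:
  "quad_row q ks (\<lambda>l. \<Sum>w\<in>A. y w * x w l) = (\<Sum>w\<in>A. y w * quad_row q ks (x w))"
proof (induction q arbitrary: ks)
  case (Cons z q)
  then show ?case
    by (cases ks) (simp_all add: sum.distrib sum_distrib_left algebra_simps)
qed simp

text \<open>On a Gram matrix, the sum over \<open>w\<close> of \<open>x w k * x w l\<close>, a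
  squared linear form evaluates to the sum of the squares of its values at the vectors
  \<open>x w\<close>. The induction splits off one coordinate: with \<open>r\<close> the rest of the
  linear form, the terms \<open>z^2 x^2\<close> and \<open>2 z x r\<close> come from the first row
  and \<open>r^2\<close> from the remaining rows.\<close>

lemma quad_square_rows:
  "quad (square_rows d q) ks (\<lambda>k l. \<Sum>w\<in>A. x w k * x w l)
    = of_int d * (\<Sum>w\<in>A. (quad_row q ks (x w))\<^sup>2)"
proof (induction q arbitrary: ks)
  case (Cons z q)
  show ?case
  proof (cases ks)
    case (Cons k ls)
    have "(\<Sum>w\<in>A. (quad_row (z # q) ks (x w))\<^sup>2)
        = of_int (z * z) * (\<Sum>w\<in>A. x w k * x w k)
          + of_int (2 * z) * (\<Sum>w\<in>A. x w k * quad_row q ls (x w))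
          + (\<Sum>w\<in>A. (quad_row q ls (x w))\<^sup>2)"
      unfolding sum_distrib_left sum.distrib[symmetric] using Cons
      by (intro sum.cong) (simp_all add: power2_eq_square algebra_simps)
    then show ?thesis
      using Cons
      by (simp add: Cons.IH quad_row_scale quad_row_sum distrib_left sum.distrib)
        (simp add: sum_distrib_left mult_ac)
  qed simp
qed simp

text \<open>Semidefiniteness never has to be tested: the form is given as a sum of squares with
  nonnegative multipliers, and the counts it is evaluated on form a Gram matrix.\<close>

lemma quad_sos_nonneg:
  assumes "sos_nonneg s" "\<And>k l. c k l = (\<Sum>w\<in>A. x w k * x w l)"
  shows "quad (sos_rows s) ks c \<ge> 0"
proof -
  have c: "c = (\<lambda>k l. \<Sum>w\<in>A. x w k * x w l)" using assms(2) by blast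
  show ?thesis using assms(1) unfolding c
    by (induction s rule: sos_rows.induct)
      (simp_all add: quad_add quad_square_rows sum_nonneg)
qed

text \<open>Symmetry of both \<open>f\<close> and \<open>c\<close> pairs the entry
  \<open>(k, l)\<close> with \<open>(l, k)\<close>, so the doubled upper triangle equals the full
  double sum.\<close>

lemma quad_form_rows:
  assumes "\<And>k l. f k l = f l k" "\<And>k l. c k l = c l k"
  shows "quad (form_rows f ks) ks c = (\<Sum>k\<leftarrow>ks. \<Sum>l\<leftarrow>ks. of_int (f k l) * c k l)"
proof (induction ks)
  case (Cons k ks)
  let ?g = "\<lambda>k l. of_int (f k l) * c k l"
  have row: "quad_row (form_row f k ls) ls (c k) = 2 * (\<Sum>l\<leftarrow>ls. ?g k l)" for ls
    by (induction ls) simp_all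
  have "(\<Sum>l\<leftarrow>ks. ?g l k) = (\<Sum>l\<leftarrow>ks. ?g k l)"
    by (rule arg_cong[of _ _ sum_list], rule map_cong[OF refl], subst assms(1), subst assms(2), rule refl)
  then have "(\<Sum>i\<leftarrow>k # ks. \<Sum>l\<leftarrow>k # ks. ?g i l)
      = ?g k k + 2 * (\<Sum>l\<leftarrow>ks. ?g k l) + (\<Sum>i\<leftarrow>ks. \<Sum>l\<leftarrow>ks. ?g i l)"
    by (simp only: list.map sum_list.Cons sum_list_addf)
  moreover have "quad (form_rows f (k # ks)) (k # ks) c
      = ?g k k + 2 * (\<Sum>l\<leftarrow>ks. ?g k l) + quad (form_rows f ks) ks c"
    by (simp only: form_rows.simps quad.simps quad_row.simps row)
  ultimately show ?case by (simp only: Cons)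
qed simp

definition trie_value :: "'a set \<Rightarrow> ('a \<Rightarrow> 'a \<Rightarrow> bool) \<Rightarrow> trie \<Rightarrow> real" where
  "trie_value V a t = trie_sum t (count_bits V a)"

lemma trie_value_insert:
  assumes "trie_depth 15 t"
  shows "trie_depth 15 (insert_trie (bits p) x t)"
    "trie_value V a (insert_trie (bits p) x t) = trie_value V a t + of_int x * count_pat V a p"
  using trie_depth_insert[of "bits p" t x] trie_sum_insert[of "bits p" t x] assms
  by (simp_all add: trie_value_def count_bits_bits)

text \<open>The relabelling by words is invisible in the value, because counts are invariant under
  words; this is why nothing is assumed about \<open>ws\<close>.\<close>

lemma fill_row_value:
  assumes sym: "\<And>x y. a x y \<longleftrightarrow> a y x" and "trie_depth 15 t"
  shows "trie_depth 15 (fill_row P k xs ls ws t) \<and>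
    trie_value V a (fill_row P k xs ls ws t)
      = trie_value V a t + quad_row xs ls (\<lambda>l. count_pat V a (P k l))"
  using assms(2)
  by (induction P k xs ls ws t rule: fill_row.induct)
    (simp_all add: trie_value_insert count_pat_word[OF sym])

lemma fill_value:
  assumes sym: "\<And>x y. a x y \<longleftrightarrow> a y x" and "trie_depth 15 t"
  shows "trie_depth 15 (fill P rs ks ws t) \<and>
    trie_value V a (fill P rs ks ws t)
      = trie_value V a t + quad rs ks (\<lambda>k l. count_pat V a (P k l))"
  using assms(2)
  by (induction P rs ks ws t rule: fill.induct) (simp_all add: fill_row_value[OF sym])

section \<open>Types, flags and the shape of a certificate\<close>

datatype four = Four bool bool bool bool

datatype five = Five bool bool bool bool bool

text \<open>\<open>six\<close> is the graph on four roots, \<open>five\<close> a pair of vertices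
  attached to a root edge, and \<open>four\<close> the attachment of one vertex to four roots. In
  \<open>edge_pat\<close>, \<open>four\<close> is reused for the adjacencies between two pairs of
  vertices.\<close>

datatype six = Six bool bool bool bool bool bool

instance four :: finite
proof
  have "(UNIV :: four set) = (\<lambda>(b, c, d, e). Four b c d e) ` UNIV"
  proof (rule set_eqI)
    fix x show "x \<in> UNIV \<longleftrightarrow> x \<in> (\<lambda>(b, c, d, e). Four b c d e) ` UNIV"
      by (cases x) (auto simp: image_iff)
  qed
  then show "finite (UNIV :: four set)" by (metis finite finite_imageI)
qed

text \<open>This order gives the coordinates of the integer vectors in the certificates their
  meaning, and it also orders the layers of \<open>edge_words\<close>.\<close>

definition fours :: "four list" where
  "fours = [Four False False False False, Four False False False True, Four False False True False,
    Four False False True True, Four False True False False, Four False True False True,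
    Four False True True False, Four False True True True, Four True False False False,
    Four True False False True, Four True False True False, Four True False True True,
    Four True True False False, Four True True False True, Four True True True False,
    Four True True True True]"

lemma set_fours: "set fours = UNIV" and distinct_fours: "distinct fours"
proof -
  have "x \<in> set fours" for x
  proof (cases x)
    case (Four b c d e)
    then show ?thesis by (cases b; cases c; cases d; cases e) (simp_all add: fours_def)
  qed
  then show "set fours = UNIV" by auto
qed (simp add: fours_def)

lemma sum_list_fours: "(\<Sum>k\<leftarrow>fours. g k) = (\<Sum>k\<in>UNIV. g k)"
  by (simp add: sum_list_distinct_conv_sum_set distinct_fours set_fours)

fun type_pat :: "six \<Rightarrow> bool \<Rightarrow> four \<Rightarrow> four \<Rightarrow> pattern" where
  "type_pat (Six e12 e13 e14 e23 e24 e34) e56 (Four e15 e25 e35 e45) (Four e16 e26 e36 e46)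
    = Pat e12 e13 e14 e23 e24 e34 e15 e25 e35 e45 e16 e26 e36 e46 e56"

text \<open>The roots are the adjacent vertices 1 and 2; the two flags are carried by the pairs 3, 4
  and 5, 6. The first argument lists the adjacencies between these pairs, over which one must sum
  before the flags become independent.\<close>

fun edge_pat :: "four \<Rightarrow> five \<Rightarrow> five \<Rightarrow> pattern" where
  "edge_pat (Four e35 e45 e36 e46) (Five e13 e14 e23 e24 e34) (Five e15 e16 e25 e26 e56)
    = Pat True e13 e14 e23 e24 e34 e15 e25 e35 e45 e16 e26 e36 e46 e56"

text \<open>Ten of the twenty flags over an edge suffice; flags that differ by exchanging the two unlabelled
  vertices are represented only once.\<close>

definition flags :: "five list" where
  "flags = [Five False False True True False, Five False True False True True,
    Five False True True False True, Five False True True True False,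
    Five False True True True True, Five True True False False False,
    Five True True False True False, Five True True False True True,
    Five True True True True False, Five True True True True True]"

fun sel :: "bool \<Rightarrow> bool \<Rightarrow> int \<Rightarrow> int" where
  "sel True True x = x"
| "sel False b x = 0"
| "sel b False x = 0"

text \<open>The coefficient of a tuple whose vertices 5 and 6 are adjacent: \<open>ri\<close> is
  subtracted if 5 and 6 span a triangle with root i. Summing over 5 and 6 therefore produces
  \<open>tri_sum\<close> at the roots.\<close>

fun root_form :: "int \<Rightarrow> int \<Rightarrow> int \<Rightarrow> int \<Rightarrow> int \<Rightarrow> four \<Rightarrow> four \<Rightarrow> int" where
  "root_form b r1 r2 r3 r4 (Four k1 k2 k3 k4) (Four l1 l2 l3 l4)
    = b - (sel k1 l1 r1 + (sel k2 l2 r2 + (sel k3 l3 r3 + sel k4 l4 r4)))"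

fun const_form :: "int \<Rightarrow> four \<Rightarrow> four \<Rightarrow> int" where
  "const_form c k l = c"

type_synonym words = "transp list list list"

text \<open>The two families of words belong to the layers in which 5 and 6 are non-adjacent and
  adjacent, respectively. The tables run over the eleven graphs on four vertices up to
  isomorphism.\<close>

datatype type_table = Type_Table six words words

datatype type_cert = Type_Cert int int int int int int "(int \<times> int list) list"

text \<open>The form \<open>q\<close> enters both layers, since the flags at 5 and 6 are independent
  only after summing over the adjacency of 5 and 6. The linear inequality contributes
  \<open>c\<close> to a non-adjacent pair and \<open>root_form\<close> to an adjacent one.\<close>

fun type_step :: "int list list \<Rightarrow> int \<Rightarrow> int \<Rightarrow> int \<Rightarrow> int \<Rightarrow> int \<Rightarrow> int \<Rightarrow> six \<Rightarrow> words \<Rightarrow> words \<Rightarrow> trie \<Rightarrow> trie"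
where
  "type_step q c b r1 r2 r3 r4 s w0 w1 t
    = fill (type_pat s True) (add_rows q (form_rows (root_form b r1 r2 r3 r4) fours)) fours w1
        (fill (type_pat s False) (add_rows q (form_rows (const_form c) fours)) fours w0 t)"

text \<open>For each type, \<open>Type_Cert\<close> holds the weights of the triangle inequality at its four roots,
  those of the lower and the upper bound on the edge density, and a sum of squares. The triangle
  inequality is scaled by \<open>10^5\<close> and the density bounds by \<open>10^7\<close>, to have integer coefficients.\<close>

fun types_step :: "int \<Rightarrow> int \<Rightarrow> int \<Rightarrow> int \<Rightarrow> type_table list \<Rightarrow> type_cert list \<Rightarrow> trie \<Rightarrow> trie" where
  "types_step tc ec lo hi (Type_Table s w0 w1 # ts) (Type_Cert x1 x2 x3 x4 y z q # cs) t
    = types_step tc ec lo hi ts cs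
        (type_step (sos_rows q)
          ((x1 + x2 + x3 + x4) * tc - lo * y + hi * z)
          ((x1 + x2 + x3 + x4) * (tc + ec) + (10000000 - lo) * y + (hi - 10000000) * z)
          (100000 * x1) (100000 * x2) (100000 * x3) (100000 * x4) s w0 w1 t)"
| "types_step tc ec lo hi [] cs t = t"
| "types_step tc ec lo hi ts [] t = t"

fun cert_nonneg :: "type_cert list \<Rightarrow> bool" where
  "cert_nonneg [] = True"
| "cert_nonneg (Type_Cert x1 x2 x3 x4 y z q # cs)
    = (0 \<le> x1 \<and> 0 \<le> x2 \<and> 0 \<le> x3 \<and> 0 \<le> x4 \<and> 0 \<le> y \<and> 0 \<le> z \<and> sos_nonneg q \<and> cert_nonneg cs)"

text \<open>The same form is added once for every choice of the four adjacencies between the two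
  pairs, each time with the words of that layer.\<close>

fun edge_step :: "int list list \<Rightarrow> four list \<Rightarrow> words list \<Rightarrow> trie \<Rightarrow> trie" where
  "edge_step q (x # xs) (w # ws) t = edge_step q xs ws (fill (edge_pat x) q flags w t)"
| "edge_step q (x # xs) [] t = edge_step q xs [] (fill (edge_pat x) q flags [] t)"
| "edge_step q [] ws t = t"

section \<open>Counting identities: Gram matrices and linear inequalities as pattern counts\<close>

fun sig :: "('a \<Rightarrow> 'a \<Rightarrow> bool) \<Rightarrow> 'a \<times> 'a \<times> 'a \<times> 'a \<Rightarrow> six" where
  "sig a (u1, u2, u3, u4) = Six (a u1 u2) (a u1 u3) (a u1 u4) (a u2 u3) (a u2 u4) (a u3 u4)"

fun att :: "('a \<Rightarrow> 'a \<Rightarrow> bool) \<Rightarrow> 'a \<times> 'a \<times> 'a \<times> 'a \<Rightarrow> 'a \<Rightarrow> four" where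
  "att a (u1, u2, u3, u4) v = Four (a u1 v) (a u2 v) (a u3 v) (a u4 v)"

definition pow4 :: "'a set \<Rightarrow> ('a \<times> 'a \<times> 'a \<times> 'a) set" where
  "pow4 V = V \<times> V \<times> V \<times> V"

text \<open>Twice the number of edges, and twice the triangle-degree of \<open>v\<close>.\<close>

definition edge_sum :: "'a set \<Rightarrow> ('a \<Rightarrow> 'a \<Rightarrow> bool) \<Rightarrow> real" where
  "edge_sum V a = (\<Sum>x\<in>V. \<Sum>y\<in>V. of_bool (a x y))"

definition tri_sum :: "'a set \<Rightarrow> ('a \<Rightarrow> 'a \<Rightarrow> bool) \<Rightarrow> 'a \<Rightarrow> real" where
  "tri_sum V a v = (\<Sum>x\<in>V. \<Sum>y\<in>V. of_bool (a x y \<and> a v x \<and> a v y))"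

lemma sum_Times: "sum h (A \<times> B) = (\<Sum>x\<in>A. \<Sum>y\<in>B. h (x, y))"
  by (simp add: sum.cartesian_product)

lemma sum_pow6:
  "(\<Sum>x\<in>pow6 V. h x)
    = (\<Sum>u\<in>pow4 V. \<Sum>v\<in>V. \<Sum>w\<in>V. h (fst u, fst (snd u), fst (snd (snd u)), snd (snd (snd u)), v, w))"
  by (simp add: pow6_def pow4_def sum_Times)

lemma pat_of_eq_type_pat:
  "pat_of a (fst u, fst (snd u), fst (snd (snd u)), snd (snd (snd u)), v, w) = type_pat s z k l
    \<longleftrightarrow> (sig a u = s \<and> a v w = z) \<and> att a u v = k \<and> att a u w = l"
  by (cases u; cases s; cases k; cases l) (simp, argo)

lemma count_type_pat:
  "count_pat V a (type_pat s z k l)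
    = (\<Sum>u\<in>pow4 V. \<Sum>v\<in>V. \<Sum>w\<in>V. of_bool (sig a u = s \<and> a v w = z) *
        (of_bool (att a u v = k) * of_bool (att a u w = l)))"
  unfolding count_pat_def sum_pow6 pat_of_eq_type_pat
  by (intro sum.cong refl) (simp add: of_bool_conj)

text \<open>With the roots fixed and the adjacency of 5 and 6 left free, the two attachments are
  chosen independently, so the count is a product. The indicator of the type is idempotent and is
  placed in both factors to make the expression a Gram matrix indexed by the roots.\<close>

lemma count_type_pat_gram:
  "count_pat V a (type_pat s False k l) + count_pat V a (type_pat s True k l)
    = (\<Sum>u\<in>pow4 V. (of_bool (sig a u = s) * (\<Sum>v\<in>V. of_bool (att a u v = k)))
        * (of_bool (sig a u = s) * (\<Sum>v\<in>V. of_bool (att a u v = l))))"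
proof -
  have "count_pat V a (type_pat s False k l) + count_pat V a (type_pat s True k l)
    = (\<Sum>u\<in>pow4 V. \<Sum>v\<in>V. \<Sum>w\<in>V. (of_bool (sig a u = s) * of_bool (att a u v = k))
        * (of_bool (sig a u = s) * of_bool (att a u w = l)))"
    unfolding count_type_pat sum.distrib[symmetric]
  proof (intro sum.cong refl)
    fix u v w
    show "of_bool (sig a u = s \<and> a v w = False) * (of_bool (att a u v = k) * of_bool (att a u w = l))
        + of_bool (sig a u = s \<and> a v w = True) * (of_bool (att a u v = k) * of_bool (att a u w = l))
      = (of_bool (sig a u = s) * of_bool (att a u v = k))
        * (of_bool (sig a u = s) * of_bool (att a u w = l) :: real)"
      by (cases "a v w"; cases "sig a u = s") simp_all
  qed
  then show ?thesis
    by (simp only: sum_product[symmetric] sum_distrib_left[symmetric] sum_distrib_right[symmetric])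
qed

lemma count_type_pat_sym:
  assumes "\<And>x y. a x y \<longleftrightarrow> a y x"
  shows "count_pat V a (type_pat s z k l) = count_pat V a (type_pat s z l k)"
proof -
  have "type_pat s z l k = swap_pat S56 (type_pat s z k l)"
    by (cases s; cases k; cases l) simp
  then show ?thesis by (simp only: count_pat_swap[OF assms])
qed

text \<open>Every tuple realises exactly one pair of attachments, so summing the counts against
  \<open>f\<close> evaluates \<open>f\<close> at that pair.\<close>

lemma sum_count_type_pat:
  "(\<Sum>k\<in>UNIV. \<Sum>l\<in>UNIV. of_int (f k l) * count_pat V a (type_pat s z k l))
    = (\<Sum>u\<in>pow4 V. \<Sum>v\<in>V. \<Sum>w\<in>V. of_bool (sig a u = s \<and> a v w = z) *
        of_int (f (att a u v) (att a u w)))"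
proof -
  have "(\<Sum>k\<in>UNIV. \<Sum>l\<in>UNIV. of_int (f k l) * count_pat V a (type_pat s z k l))
    = (\<Sum>k\<in>UNIV. \<Sum>x\<in>pow6 V. \<Sum>l\<in>UNIV. of_int (f k l) * of_bool (pat_of a x = type_pat s z k l))"
    unfolding count_pat_def sum_distrib_left by (rule sum.cong[OF refl], rule sum.swap)
  also have "\<dots> = (\<Sum>x\<in>pow6 V. \<Sum>k\<in>UNIV. \<Sum>l\<in>UNIV.
      of_int (f k l) * of_bool (pat_of a x = type_pat s z k l))"
    by (rule sum.swap)
  also have "\<dots> = (\<Sum>u\<in>pow4 V. \<Sum>v\<in>V. \<Sum>w\<in>V. of_bool (sig a u = s \<and> a v w = z) *
        of_int (f (att a u v) (att a u w)))"
    unfolding sum_pow6 pat_of_eq_type_pat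
  proof (intro sum.cong refl)
    fix u v w
    let ?P = "sig a u = s \<and> a v w = z"
    have "(\<Sum>k\<in>UNIV. \<Sum>l\<in>UNIV. of_int (f k l) * of_bool (?P \<and> att a u v = k \<and> att a u w = l))
        = (\<Sum>k\<in>UNIV. \<Sum>l\<in>UNIV. if l = att a u w then
            (if k = att a u v then of_bool ?P * of_int (f k l) else 0) else 0 :: real)"
      by (intro sum.cong refl) simp
    also have "\<dots> = of_bool ?P * of_int (f (att a u v) (att a u w))"
      by simp
    finally show "(\<Sum>k\<in>UNIV. \<Sum>l\<in>UNIV. of_int (f k l) * of_bool (?P \<and> att a u v = k \<and> att a u w = l))
        = (of_bool ?P * of_int (f (att a u v) (att a u w)) :: real)" .
  qed
  finally show ?thesis .
qed

text \<open>An adjacent pair exceeds a non-adjacent one by \<open>b - c\<close>, apart from the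
  triangle terms. All ordered pairs with repetition are counted, so the first term is the exact
  square of \<open>card V\<close>, without lower-order corrections.\<close>

lemma root_form_sum:
  assumes "u \<in> pow4 V" "u = (u1, u2, u3, u4)"
  shows "(\<Sum>v\<in>V. \<Sum>w\<in>V. of_bool (\<not> a v w) * of_int c
      + of_bool (a v w) * of_int (root_form b r1 r2 r3 r4 (att a u v) (att a u w)))
    = of_int c * (real (card V))\<^sup>2 + of_int (b - c) * edge_sum V a
      - (of_int r1 * tri_sum V a u1 + of_int r2 * tri_sum V a u2
        + of_int r3 * tri_sum V a u3 + of_int r4 * tri_sum V a u4)"
proof -
  have sel: "of_int (sel p q r) = of_int r * (of_bool (p \<and> q) :: real)" for p q r
    by (cases p; cases q) simp_all
  have "(\<Sum>v\<in>V. \<Sum>w\<in>V. of_bool (\<not> a v w) * of_int c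
      + of_bool (a v w) * of_int (root_form b r1 r2 r3 r4 (att a u v) (att a u w)))
    = (\<Sum>v\<in>V. \<Sum>w\<in>V. of_int c + of_int (b - c) * of_bool (a v w)
      - (of_int r1 * of_bool (a v w \<and> a u1 v \<and> a u1 w)
        + of_int r2 * of_bool (a v w \<and> a u2 v \<and> a u2 w)
        + of_int r3 * of_bool (a v w \<and> a u3 v \<and> a u3 w)
        + of_int r4 * of_bool (a v w \<and> a u4 v \<and> a u4 w) :: real))"
  proof (intro sum.cong refl)
    fix v w
    show "of_bool (\<not> a v w) * of_int c
      + of_bool (a v w) * of_int (root_form b r1 r2 r3 r4 (att a u v) (att a u w))
    = of_int c + of_int (b - c) * of_bool (a v w)
      - (of_int r1 * of_bool (a v w \<and> a u1 v \<and> a u1 w)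
        + of_int r2 * of_bool (a v w \<and> a u2 v \<and> a u2 w)
        + of_int r3 * of_bool (a v w \<and> a u3 v \<and> a u3 w)
        + of_int r4 * of_bool (a v w \<and> a u4 v \<and> a u4 w) :: real)"
      by (cases "a v w") (simp_all only: assms(2) att.simps root_form.simps of_int_diff of_int_add sel, simp_all)
  qed
  also have "\<dots> = of_int c * (real (card V))\<^sup>2 + of_int (b - c) * edge_sum V a
      - (of_int r1 * tri_sum V a u1 + of_int r2 * tri_sum V a u2
        + of_int r3 * tri_sum V a u3 + of_int r4 * tri_sum V a u4)"
    unfolding edge_sum_def tri_sum_def sum.distrib sum_subtractf sum_distrib_left
    by (simp add: power2_eq_square)
  finally show ?thesis .
qed

definition edge_flag :: "('a \<Rightarrow> 'a \<Rightarrow> bool) \<Rightarrow> 'a \<Rightarrow> 'a \<Rightarrow> 'a \<Rightarrow> 'a \<Rightarrow> five" where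
  "edge_flag a u1 u2 v w = Five (a u1 v) (a u1 w) (a u2 v) (a u2 w) (a v w)"

text \<open>A tuple determines the adjacencies between its two pairs, so the sum over
  \<open>x\<close> merely forgets them. Given the root edge, the two pairs are then independent and
  a Gram matrix indexed by ordered pairs of roots results.\<close>

lemma sum_count_edge_pat:
  "(\<Sum>x\<in>UNIV. count_pat V a (edge_pat x k l))
    = (\<Sum>u\<in>V \<times> V. (of_bool (a (fst u) (snd u))
          * (\<Sum>z\<in>V \<times> V. of_bool (edge_flag a (fst u) (snd u) (fst z) (snd z) = k)))
        * (of_bool (a (fst u) (snd u))
          * (\<Sum>z\<in>V \<times> V. of_bool (edge_flag a (fst u) (snd u) (fst z) (snd z) = l))))"
proof -
  have eq: "pat_of a (u1, u2, u3, u4, v, w) = edge_pat x k l \<longleftrightarrow>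
      x = Four (a u3 v) (a u4 v) (a u3 w) (a u4 w) \<and>
      a u1 u2 \<and> edge_flag a u1 u2 u3 u4 = k \<and> edge_flag a u1 u2 v w = l" for u1 u2 u3 u4 v w x
    by (cases k; cases l; cases x) (simp add: edge_flag_def, argo)
  have "(\<Sum>x\<in>UNIV. count_pat V a (edge_pat x k l))
    = (\<Sum>y\<in>pow6 V. \<Sum>x\<in>UNIV. of_bool (pat_of a y = edge_pat x k l))"
    unfolding count_pat_def by (rule sum.swap)
  also have "\<dots> = (\<Sum>u1\<in>V. \<Sum>u2\<in>V. \<Sum>u3\<in>V. \<Sum>u4\<in>V. \<Sum>v\<in>V. \<Sum>w\<in>V.
      \<Sum>x\<in>UNIV. of_bool (pat_of a (u1, u2, u3, u4, v, w) = edge_pat x k l))"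
    by (simp only: pow6_def sum_Times)
  also have "\<dots> = (\<Sum>u1\<in>V. \<Sum>u2\<in>V. \<Sum>u3\<in>V. \<Sum>u4\<in>V. \<Sum>v\<in>V. \<Sum>w\<in>V.
      (of_bool (a u1 u2) * of_bool (edge_flag a u1 u2 u3 u4 = k))
        * (of_bool (a u1 u2) * of_bool (edge_flag a u1 u2 v w = l)))"
  proof (intro sum.cong refl)
    fix u1 u2 u3 u4 v w
    have "(\<Sum>x\<in>UNIV. of_bool (pat_of a (u1, u2, u3, u4, v, w) = edge_pat x k l))
        = (\<Sum>x\<in>UNIV. if x = Four (a u3 v) (a u4 v) (a u3 w) (a u4 w) then
            of_bool (a u1 u2 \<and> edge_flag a u1 u2 u3 u4 = k \<and> edge_flag a u1 u2 v w = l) else 0 :: real)"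
      unfolding eq by (intro sum.cong refl) simp
    also have "\<dots> = (of_bool (a u1 u2) * of_bool (edge_flag a u1 u2 u3 u4 = k))
        * (of_bool (a u1 u2) * of_bool (edge_flag a u1 u2 v w = l))"
      by simp
    finally show "(\<Sum>x\<in>UNIV. of_bool (pat_of a (u1, u2, u3, u4, v, w) = edge_pat x k l))
      = (of_bool (a u1 u2) * of_bool (edge_flag a u1 u2 u3 u4 = k))
        * (of_bool (a u1 u2) * of_bool (edge_flag a u1 u2 v w = l) :: real)" .
  qed
  also have "\<dots> = (\<Sum>u\<in>V \<times> V. (of_bool (a (fst u) (snd u))
          * (\<Sum>z\<in>V \<times> V. of_bool (edge_flag a (fst u) (snd u) (fst z) (snd z) = k)))
        * (of_bool (a (fst u) (snd u))
          * (\<Sum>z\<in>V \<times> V. of_bool (edge_flag a (fst u) (snd u) (fst z) (snd z) = l))))"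
    by (simp only: sum_Times fst_conv snd_conv sum_distrib_left[symmetric] sum_distrib_right[symmetric])
  finally show ?thesis .
qed

section \<open>Soundness: each step can only increase the value of the trie\<close>

lemma type_step_value:
  assumes sym: "\<And>x y. a x y \<longleftrightarrow> a y x" and t: "trie_depth 15 t" and s: "sos_nonneg q"
    and form: "\<And>u1 u2 u3 u4. {u1, u2, u3, u4} \<subseteq> V \<Longrightarrow>
      of_int c * (real (card V))\<^sup>2 + of_int (b - c) * edge_sum V a
      - (of_int r1 * tri_sum V a u1 + of_int r2 * tri_sum V a u2
        + of_int r3 * tri_sum V a u3 + of_int r4 * tri_sum V a u4) \<ge> 0"
  shows "trie_depth 15 (type_step (sos_rows q) c b r1 r2 r3 r4 s w0 w1 t) \<and>
    trie_value V a t \<le> trie_value V a (type_step (sos_rows q) c b r1 r2 r3 r4 s w0 w1 t)"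
proof -
  let ?n = "\<lambda>z k l. count_pat V a (type_pat s z k l)"
  let ?f = "const_form c" and ?g = "root_form b r1 r2 r3 r4"
  let ?t = "fill (type_pat s False) (add_rows (sos_rows q) (form_rows ?f fours)) fours w0 t"
  have t': "trie_depth 15 ?t"
    "trie_value V a ?t = trie_value V a t
      + (quad (sos_rows q) fours (?n False) + quad (form_rows ?f fours) fours (?n False))"
    using fill_value[where a = a, OF sym t, of "type_pat s False"] by (auto simp: quad_add)
  \<comment> \<open>The two layers must be added before positivity is available; neither of them is
    a Gram matrix by itself.\<close>
  have sq: "quad (sos_rows q) fours (?n False) + quad (sos_rows q) fours (?n True) \<ge> 0"
    unfolding quad_plus[symmetric] by (rule quad_sos_nonneg[OF s count_type_pat_gram])
  have gsym: "?g k l = ?g l k" for k l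
  proof -
    have "sel x y r = sel y x r" for x y r by (cases x; cases y) simp_all
    then show ?thesis by (cases k; cases l) simp
  qed
  have "quad (form_rows ?f fours) fours (?n False) + quad (form_rows ?g fours) fours (?n True)
    = (\<Sum>u\<in>pow4 V. \<Sum>v\<in>V. \<Sum>w\<in>V. of_bool (sig a u = s \<and> a v w = False) * of_int c)
      + (\<Sum>u\<in>pow4 V. \<Sum>v\<in>V. \<Sum>w\<in>V. of_bool (sig a u = s \<and> a v w = True)
          * of_int (?g (att a u v) (att a u w)))"
    using count_type_pat_sym[where a = a, OF sym] gsym
    by (simp add: quad_form_rows sum_list_fours sum_count_type_pat)
  also have "\<dots> = (\<Sum>u\<in>pow4 V. of_bool (sig a u = s) * (\<Sum>v\<in>V. \<Sum>w\<in>V.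
      of_bool (\<not> a v w) * of_int c + of_bool (a v w) * of_int (?g (att a u v) (att a u w))))"
    unfolding sum.distrib[symmetric] sum_distrib_left
    by (intro sum.cong refl) (simp add: of_bool_conj algebra_simps)
  \<comment> \<open>The inequality \<open>form\<close> is used for each quadruple of roots
    separately, weighted by the indicator of the type. This is the multiplication of the assumed
    bound by a nonnegative weight.\<close>
  also have "\<dots> \<ge> 0"
  proof (rule sum_nonneg)
    fix u assume u: "u \<in> pow4 V"
    obtain u1 u2 u3 u4 where eq: "u = (u1, u2, u3, u4)" by (cases u)
    then have "{u1, u2, u3, u4} \<subseteq> V" using u by (auto simp: pow4_def)
    then show "of_bool (sig a u = s) * (\<Sum>v\<in>V. \<Sum>w\<in>V.
      of_bool (\<not> a v w) * of_int c + of_bool (a v w) * of_int (?g (att a u v) (att a u w))) \<ge> (0 :: real)"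
      using form unfolding root_form_sum[OF u eq] by (intro mult_nonneg_nonneg) simp_all
  qed
  finally have fm: "quad (form_rows ?f fours) fours (?n False)
    + quad (form_rows ?g fours) fours (?n True) \<ge> 0" .
  show ?thesis
    using fill_value[where a = a, OF sym t'(1), of "type_pat s True" "add_rows (sos_rows q) (form_rows ?g fours)"]
      t'(2) sq fm
    by (auto simp: quad_add)
qed

lemma types_step_value:
  assumes sym: "\<And>x y. a x y \<longleftrightarrow> a y x" and t: "trie_depth 15 t" and nonneg: "cert_nonneg cs"
    and tri: "\<And>v. v \<in> V \<Longrightarrow>
      100000 * tri_sum V a v \<le> of_int tc * (real (card V))\<^sup>2 + of_int ec * edge_sum V a"
    and lo: "of_int lo * (real (card V))\<^sup>2 \<le> 10000000 * edge_sum V a"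
    and hi: "10000000 * edge_sum V a \<le> of_int hi * (real (card V))\<^sup>2"
  shows "trie_depth 15 (types_step tc ec lo hi ts cs t) \<and>
    trie_value V a t \<le> trie_value V a (types_step tc ec lo hi ts cs t)"
  using t nonneg tri lo hi
proof (induction tc ec lo hi ts cs t rule: types_step.induct)
  case step: (1 tc ec lo hi s w0 w1 ts x1 x2 x3 x4 y z q cs t)
  let ?n = "(real (card V))\<^sup>2" and ?e = "edge_sum V a"
  let ?c = "(x1 + x2 + x3 + x4) * tc - lo * y + hi * z"
  let ?b = "(x1 + x2 + x3 + x4) * (tc + ec) + (10000000 - lo) * y + (hi - 10000000) * z"
  have x: "0 \<le> x1" "0 \<le> x2" "0 \<le> x3" "0 \<le> x4" "0 \<le> y" "0 \<le> z" "sos_nonneg q" "cert_nonneg cs"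
    using step.prems(2) by simp_all
  have form: "of_int ?c * ?n + of_int (?b - ?c) * ?e
      - (of_int (100000 * x1) * tri_sum V a u1 + of_int (100000 * x2) * tri_sum V a u2
        + of_int (100000 * x3) * tri_sum V a u3 + of_int (100000 * x4) * tri_sum V a u4) \<ge> 0"
    if u: "{u1, u2, u3, u4} \<subseteq> V" for u1 u2 u3 u4
  proof -
    let ?d = "\<lambda>u. of_int tc * ?n + of_int ec * ?e - 100000 * tri_sum V a u"
    have d: "?d u1 \<ge> 0" "?d u2 \<ge> 0" "?d u3 \<ge> 0" "?d u4 \<ge> 0"
      using step.prems(3) u by auto
    \<comment> \<open>The constants \<open>?c\<close> and \<open>?b\<close> are designed for this
      regrouping: nonnegative multiples of the slack of the triangle bound at each root and of the
      slacks of the two density bounds.\<close>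
    have "of_int ?c * ?n + of_int (?b - ?c) * ?e
      - (of_int (100000 * x1) * tri_sum V a u1 + of_int (100000 * x2) * tri_sum V a u2
        + of_int (100000 * x3) * tri_sum V a u3 + of_int (100000 * x4) * tri_sum V a u4)
      = of_int x1 * ?d u1 + of_int x2 * ?d u2 + of_int x3 * ?d u3 + of_int x4 * ?d u4
        + of_int y * (10000000 * ?e - of_int lo * ?n) + of_int z * (of_int hi * ?n - 10000000 * ?e)"
      by (simp add: algebra_simps)
    also have "\<dots> \<ge> 0"
      using d x step.prems(4,5) by (intro add_nonneg_nonneg mult_nonneg_nonneg) simp_all
    finally show ?thesis .
  qed
  show ?case
    using type_step_value[where a = a, OF sym step.prems(1) x(7) form, of s w0 w1] step.IH step.prems(3-5) x(8)
    by fastforce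
qed auto

text \<open>An equality for an arbitrary list \<open>xs\<close>, as the induction requires;
  positivity can be used only once \<open>xs\<close> is all of \<open>fours\<close>.\<close>

lemma edge_step_value:
  assumes sym: "\<And>x y. a x y \<longleftrightarrow> a y x" and t: "trie_depth 15 t"
  shows "trie_depth 15 (edge_step q xs ws t) \<and>
    trie_value V a (edge_step q xs ws t)
      = trie_value V a t + quad q flags (\<lambda>k l. \<Sum>x\<leftarrow>xs. count_pat V a (edge_pat x k l))"
  using t
proof (induction q xs ws t rule: edge_step.induct)
  case (1 q x xs w ws t)
  then show ?case
    using fill_value[where a = a, OF sym 1(2), of "edge_pat x" q flags w V] by (simp add: quad_plus)
next
  case (2 q x xs t)
  then show ?case
    using fill_value[where a = a, OF sym 2(2), of "edge_pat x" q flags "[]" V] by (simp add: quad_plus)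
next
  case (3 q ws t)
  then show ?case by (simp add: quad_zero)
qed

text \<open>If every vertex obeyed the bound, the value of the trie would start positive, never
  decrease, and end as a combination of nonnegative counts with coefficients at most zero. The
  coefficient 1 given to the empty pattern at the start provides the strictness.\<close>

lemma tri_sum_lower_bound:
  assumes sym: "\<And>x y. a x y \<longleftrightarrow> a y x" and irr: "\<And>x. \<not> a x x"
    and fin: "finite V" and ne: "V \<noteq> {}"
    and cert: "cert_nonneg cs" "sos_nonneg q"
      "trie_nonpos (edge_step (sos_rows q) fours ews
        (types_step tc ec lo hi ts cs
          (insert_trie (bits (Pat False False False False False False False False False False
            False False False False False)) 1 Empty)))"
    and lo: "of_int lo * (real (card V))\<^sup>2 \<le> 10000000 * edge_sum V a"
    and hi: "10000000 * edge_sum V a \<le> of_int hi * (real (card V))\<^sup>2"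
  shows "\<exists>v\<in>V. 100000 * tri_sum V a v > of_int tc * (real (card V))\<^sup>2 + of_int ec * edge_sum V a"
proof (rule ccontr)
  assume "\<not> ?thesis"
  then have tri: "100000 * tri_sum V a v \<le> of_int tc * (real (card V))\<^sup>2 + of_int ec * edge_sum V a"
    if "v \<in> V" for v
    using that by force
  let ?p = "Pat False False False False False False False False False False False False False False False"
  obtain v where v: "v \<in> V" using ne by blast
  have "0 < count_pat V a ?p"
    unfolding count_pat_def
  proof (rule sum_pos2)
    show "finite (pow6 V)" using fin by (simp add: pow6_def)
    \<comment> \<open>Without loops a constant tuple has no adjacencies, so the empty pattern occurs
      in every nonempty graph.\<close>
    show "(v, v, v, v, v, v) \<in> pow6 V" using v by (simp add: pow6_def)
  qed (simp_all add: irr)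
  moreover define t0 where "t0 = insert_trie (bits ?p) 1 Empty"
  ultimately have t0: "trie_depth 15 t0" "trie_value V a t0 > 0"
    using trie_value_insert(1)[where t = Empty and p = ?p and x = 1]
      trie_value_insert(2)[where t = Empty and p = ?p and x = 1 and V = V and a = a] by (simp_all add: trie_value_def)
  define t1 where "t1 = types_step tc ec lo hi ts cs t0"
  have t1: "trie_depth 15 t1" "trie_value V a t1 > 0"
    using types_step_value[where a = a, OF sym t0(1) cert(1) tri lo hi, of ts] t0(2)
    unfolding t1_def by auto
  have "quad (sos_rows q) flags (\<lambda>k l. \<Sum>x\<in>UNIV. count_pat V a (edge_pat x k l)) \<ge> 0"
    by (rule quad_sos_nonneg[OF cert(2) sum_count_edge_pat])
  then have "trie_value V a (edge_step (sos_rows q) fours ews t1) > 0"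
    using edge_step_value[where a = a and V = V, OF sym t1(1), where q = "sos_rows q" and xs = fours and ws = ews] t1(2)
    by (simp add: sum_list_fours)
  moreover have "trie_value V a (edge_step (sos_rows q) fours ews t1) \<le> 0"
    using cert(3) unfolding trie_value_def t1_def t0_def
    by (rule trie_sum_nonpos) (rule count_bits_nonneg)
  ultimately show False by simp
qed

section \<open>Canonical forms and certificates\<close>

text \<open>The words send the patterns of each layer, row by row over the upper triangle, to one
  representative per isomorphism class. Soundness holds for arbitrary words.\<close>

definition type_tables :: "type_table list" where
  "type_tables =
    [Type_Table (Six False False False False False False) [[[], [S34], [], [S45], [S23], [S45,S23], [S25],
    [S25], [S13], [S45,S13], [S15], [S15], [S25,S13], [S25,S13], [S25,S14], [S15]], [[S46,S34], [S13], [S23],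
    [S12], [], [], [], [], [S12], [S12], [S12], [S13], [S13], [], [S45]], [[S36], [S34,S23], [S34,S12], [S34],
    [S34], [S34], [S34], [S34,S12], [S34,S12], [S34,S12], [S34,S13], [S34], [S34,S13], [S35,S34]], [[],
    [S56,S24], [S35,S34], [S45], [], [S56,S14,S12], [S35,S34,S12], [S45,S12], [S12], [S45], [S15,S14,S13],
    [S15,S14], [S15,S14]], [[S26,S23], [S24], [S24,S23], [S24], [S24], [S24,S13], [S24,S12], [S24], [S24,S12],
    [S24,S13], [S24,S12], [S25,S24]], [[S23], [S45,S23], [S23], [S56,S14,S13], [S25,S24,S23,S12], [S45,S23],
    [S35,S34,S12], [S45,S23,S12], [S23,S12], [S23,S15,S14], [S35,S34,S12]], [[S24], [S24], [S56,S14],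
    [S25,S24], [S25,S24,S12], [S45,S12], [S35,S34,S23,S12], [S45,S23,S12], [S24,S12], [S45,S12]], [[],
    [S56,S14], [S56,S35,S34], [S56,S45], [S25,S24], [S56,S45,S23], [S35,S34], [S45], [S56,S15,S14]],
    [[S16,S13], [S14,S12], [S23,S14], [S14,S12], [S14], [S14,S13], [S14], [S15,S14]], [[S13], [S45,S13,S12],
    [S13,S12], [S45,S13], [S13], [S35,S34,S13], [S35,S34]], [[S14], [S14,S12], [S35,S34,S13], [S45,S13],
    [S14], [S45]], [[S12], [S56,S45,S13,S12], [S35,S34,S12], [S45,S12], [S56,S25,S24]], [[S24,S13], [S24,S13],
    [S23,S14], [S45,S23]], [[S13], [S45,S13], [S56,S35,S34]], [[S14], [S56,S45]], [[S15]]] [[[S35], [S34], [],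
    [], [S23], [S23], [S24], [], [S13], [S13], [S14], [S12], [S24,S13], [S13], [S14], []], [[], [S45,S23], [],
    [S45], [S23], [S45], [], [S45,S12], [S13], [S45,S12], [S12], [S45,S13], [S13], [], [S46]], [[S34], [S34],
    [S35,S34], [S35,S34], [S34,S23], [S34], [S35,S34,S12], [S35,S34,S12], [S34,S13], [S34,S12], [S35,S34,S13],
    [S34], [S34,S13], [S36,S34]], [[], [S56,S25,S24], [S35,S34], [S45], [S25,S24], [S56,S15,S14,S12],
    [S35,S34,S12], [S45,S12], [S15,S14,S12], [S25,S24], [S35,S34], [S45], [S56,S25,S24]], [[S24], [S24,S23],
    [S24], [S24], [S25,S24,S12], [S25,S24,S13], [S25,S24,S12], [S24], [S24,S13], [S24,S13], [S24,S12],
    [S26,S24]], [[S23], [S45,S23], [S35,S34], [S56,S15,S14,S13], [S25,S24,S23,S12], [S35,S34], [S25,S24,S23],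
    [S45,S23,S12], [S15,S14,S13], [S45,S23], [S56,S35,S34]], [[S24], [S45], [S56,S15,S14], [S45],
    [S25,S24,S12], [S25,S24], [S35,S34,S23,S12], [S35,S34,S23], [S15,S14], [S56,S45]], [[S45], [S56,S14],
    [S56,S15,S14,S13], [S56,S15,S14], [S23,S15,S14], [S56,S23,S15,S14], [S15,S14], [S15,S14,S13],
    [S56,S15,S14]], [[S14], [S14,S13], [S14], [S14,S12], [S23,S14], [S14,S13], [S14], [S16,S14]], [[S13],
    [S45,S13,S12], [S35,S34,S12], [S45,S13], [S25,S24,S13], [S45,S13], [S56,S35,S34,S12]], [[S14], [S45,S12],
    [S35,S34,S13], [S35,S34,S13], [S25,S24,S12], [S56,S45,S12]], [[S45,S12], [S56,S25,S24,S13], [S25,S24],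
    [S25,S24,S23], [S56,S25,S24]], [[S24,S13], [S45,S13], [S35,S34,S13], [S56,S45,S13]], [[S45,S13],
    [S35,S34], [S56,S35,S34]], [[S15,S14], [S56,S45]], [[S15]]], Type_Table (Six False False False False False
    True) [[[S46], [S46,S45], [S45,S36], [S35], [S35,S12], [S35], [S45,S34], [S35,S23], [S35], [S35,S12],
    [S45,S34,S12], [S35,S13], [S35,S13], [S35,S13], [S45,S34,S13], [S35,S13]], [[S46], [S36,S23], [S46,S35],
    [S46,S25], [S46,S25], [], [], [S46,S15,S12], [S46,S15,S12], [S12], [S12], [], [S25], [S15], []], [[S36],
    [S36,S35], [S36,S35,S24], [S34], [S36,S34,S25], [S34], [S36,S35,S14,S12], [S34,S12], [S36,S34,S15,S12],
    [S34,S12], [S34], [S34,S15], [S34,S25], [S34]], [[S46,S35], [S15,S12], [S25], [S34,S25], [S25], [S25],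
    [S15,S12], [S34,S15,S12], [S15,S12], [S25], [S46,S25], [S36,S34,S25], []], [[S35,S26], [S46,S24,S23],
    [S36,S24], [S26,S24], [], [S24,S23,S15], [S24,S15], [S24,S15], [S23,S15,S12], [S46,S23,S15,S12],
    [S26,S24,S15], [S26,S24,S15]], [[S46,S25,S23], [], [S26], [S46,S35], [S35], [S35], [S46,S15,S13,S12],
    [S25,S24,S23], [S56,S35,S34], [S25,S23,S12], [S56,S23,S15,S14]], [[S36,S25,S24], [S34,S26], [S56,S25,S24],
    [S45,S34], [S45,S34], [S36,S34,S15,S13,S12], [S25,S24], [S45,S12], [S56,S45], [S56,S23,S15,S14,S12]],
    [[S25], [S56,S25,S24], [S46,S25,S24,S23], [S36,S25,S24], [S25], [S25,S24], [S25,S24,S23], [S25,S24],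
    [S15,S14,S12]], [[S35,S16,S12], [S46,S14,S13,S12], [S36,S14,S12], [S16,S14,S12], [S16,S13], [S46,S25,S13],
    [S25,S16,S14,S12], [S25,S16,S14,S12]], [[S46,S15,S13,S12], [S12], [S16,S12], [S46,S14,S13], [S25,S16,S13],
    [S15,S13], [S56,S25,S24,S13,S12]], [[S36,S15,S14,S12], [S34,S16,S12], [S36,S14], [S45], [S56,S45,S12],
    [S56,S25,S24,S13]], [[S15,S12], [S15,S14,S12], [S15,S14,S13,S12], [S15,S14,S12], [S25,S24]], [[S45],
    [S46,S15,S13], [S36,S34,S15,S13], [S56,S25,S24]], [[S35], [S15,S13], [S56,S35,S34,S13]], [[S45,S34],
    [S56,S45,S13]], [[S25,S24]]] [[[S35,S13], [S35,S23], [S36,S34,S23], [S35], [S35], [S35], [S45,S34], [S35],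
    [S35,S12], [S35,S12], [S45,S34,S12], [S35,S12], [S35], [S45,S34], [S35], [S46,S35]], [[S46], [S36], [S45],
    [S35], [S35], [S45], [S25], [S35,S12], [S35,S12], [S45,S12], [S15,S12], [S15,S13], [S35], [S15],
    [S46,S25]], [[S36,S34], [S35], [S45,S34], [S35], [S45,S34], [S34,S25], [S45,S34,S12], [S35,S12],
    [S45,S34,S12], [S34,S15,S12], [S34,S15,S13], [S34,S15], [S45,S34], [S36,S34,S25]], [[S25], [S25,S24],
    [S25,S23], [S25,S24], [S25], [S15,S14,S12], [S15,S13,S12], [S15,S14,S12], [S15,S12], [S56,S25,S24], [S35],
    [S45], [S46,S25]], [[S46,S15,S13], [S46,S35], [S45,S36,S34], [S26,S24], [S15,S13], [S46,S15,S13],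
    [S56,S15,S14,S12], [S56,S15,S14,S12], [S15,S13], [S46,S15,S13], [S36,S34,S15,S13], [S46,S23,S12]],
    [[S46,S35], [S46,S35,S23], [S46,S35], [S25,S24,S23], [S25,S23], [S46,S25,S23], [S56,S15,S14,S13,S12],
    [S56,S15,S14,S13], [S46,S15,S13], [S46,S15], [S46,S25,S23]], [[S45,S36], [S56,S25,S24], [S25,S24],
    [S36,S34,S25,S23], [S45], [S56,S15,S14,S12], [S56,S15,S14], [S36,S34,S15], [S36,S34,S15,S13], [S56,S45]],
    [[S25,S24], [S25,S24], [S25,S24,S23], [S25,S24], [S25,S24], [S56,S25,S24], [S35,S34], [S45],
    [S56,S23,S15,S14]], [[S46,S25,S13], [S46,S35,S12], [S45,S36,S34,S12], [S16,S14,S12], [S25,S13],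
    [S46,S25,S13], [S36,S34,S25,S13], [S46,S13]], [[S46,S35,S12], [S46,S35,S13,S12], [S46,S35,S12],
    [S56,S25,S24,S23,S12], [S46,S25,S23,S12], [S46,S25,S12], [S46,S15,S13,S12]], [[S45,S36,S12],
    [S56,S15,S14,S12], [S56,S25,S24,S12], [S36,S34,S25,S12], [S36,S34,S25,S23,S12], [S56,S45,S12]],
    [[S15,S14,S12], [S56,S15,S14,S12], [S35,S34,S12], [S45,S12], [S56,S25,S24,S13]], [[S46,S15,S13],
    [S46,S15,S13], [S36,S34,S15,S13], [S56,S45]], [[S46,S15,S13], [S46,S15], [S56,S35,S34]], [[S36,S15,S14],
    [S56,S45]], [[S25,S13]]], Type_Table (Six False False False False True True) [[[S46,S25], [S46,S25],
    [S36,S25,S23], [S46,S35,S23], [S35,S26], [S46,S25], [S45,S24], [S45,S24], [S46,S15], [S46,S15], [S25,S12],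
    [S25,S12], [S35,S23,S12], [S35,S23,S12], [S45,S24,S12], [S15]], [[S46], [S46,S45,S34], [S46,S35],
    [S46,S45,S24], [S46,S25], [S46,S45,S24], [S46], [S46,S15], [S46,S45,S14], [S46], [S46,S15], [S46,S23],
    [S46,S23,S15], [], [S15,S13]], [[S36,S25], [S36,S25], [S34,S26], [S36], [S36,S25], [S36], [S46,S25],
    [S25], [S34], [], [S25], [S46,S15], [S46], [S36,S34,S15]], [[S46,S34,S25], [S26,S25], [S25], [S25,S23],
    [S25], [S46,S25], [S25], [S36,S25], [S25], [S25], [S46,S25], [S25], []], [[S35,S26], [S46,S24,S23],
    [S35,S26,S23], [S26,S23], [S26,S24,S23], [S35,S23], [S35,S23], [S46,S23,S15], [S24,S23], [S23], [S46,S23],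
    [S26,S24,S23,S15]], [[S46,S35,S24], [S35], [S26,S23], [S46,S35], [S35], [S35], [S46,S35], [S35,S26,S23],
    [S35,S23], [S35,S23], [S23]], [[S36,S25], [S36], [S56,S13], [S35], [S34,S23], [S15,S13,S12], [S24],
    [S15,S13], [S26,S24,S15], [S46,S15,S13]], [[S34,S26], [S35], [S35], [S36,S34,S25], [S25], [S35,S26,S24],
    [S35,S23], [S25], [S46,S15,S13]], [[S25,S16], [S46,S35,S14,S13], [S34,S16,S15], [S25,S13,S12],
    [S46,S25,S13], [S35,S13], [S35,S16,S14,S13], [S35,S16,S14,S13]], [[S46,S35,S14], [S46,S13], [S25,S23,S16],
    [S46,S13,S12], [S35,S16], [S35,S34], [S35,S16]], [[S46,S34,S13,S12], [S46,S25,S23], [S12], [S36,S24,S15],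
    [S15,S13,S12], [S46,S25,S23]], [[S36,S25,S13], [S34,S25,S16], [S46,S25,S23], [S15,S13,S12],
    [S46,S25,S23]], [[S46,S24,S13], [S46,S35], [S15,S13], [S46,S35]], [[S35,S26,S13], [S15,S13], [S46,S35]],
    [[S15,S14,S13], [S46,S15,S13]], [[S46,S25,S13]]] [[[S46], [S46], [S25], [S25], [S35,S23], [S35,S23],
    [S45,S24], [], [S25], [], [S12], [S25], [S23,S12], [S35,S23], [S12], [S46]], [[S46], [S46,S45], [S46,S25],
    [S46,S45,S23], [S46,S35], [S45], [], [S46,S35], [S46,S15,S13], [S25], [S23,S15], [S35], [S15], [S46,S15],
    [S46,S15]], [[S46,S34,S25], [S46,S25], [S35,S23], [S36,S34,S23], [S46,S25,S23], [S46,S25], [S34],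
    [S36,S34,S25], [S36,S34,S15,S12], [S46,S15,S12], [S12], [S36,S34,S15,S13], [S46,S23,S15,S12], [S46]],
    [[S46,S25], [S25], [S25,S23], [S25,S24], [S25], [S56,S25,S23], [S25,S23], [S25,S24], [S25], [S25,S23],
    [S35], [S15,S12], [S46,S23,S15]], [[S46,S35,S24], [S46,S35,S23], [S46,S35], [S26,S24,S23], [S24,S23],
    [S56,S15,S13], [S23,S12], [S26,S24,S15,S13,S12], [S26,S24,S23,S15,S12], [S46,S23,S15,S12], [S46,S15,S12],
    [S46,S23]], [[S46,S35], [S35,S24], [S35], [S56,S35], [S35], [S35], [S25,S23], [S35,S24], [S35], [S15,S13],
    [S46,S15]], [[S45,S36], [S36,S24], [S35,S34], [S46,S15,S13], [S15,S14,S13,S12], [S36,S34,S23,S15],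
    [S24,S15,S12], [S26,S24,S15], [S56,S15,S14,S13], [S46,S13]], [[S36,S25], [S35,S34], [S35], [S25,S24],
    [S25,S23], [S35,S34,S23], [S35], [S56,S15,S14,S13], [S46,S15,S12]], [[S46,S35,S12], [S35,S12],
    [S46,S35,S12], [S35,S12], [S46,S25,S13], [S25,S13], [S46,S35,S12], [S46,S13]], [[S46,S15,S13],
    [S46,S35,S12], [S46,S15,S13,S12], [S46,S25,S23,S12], [S46,S15,S13], [S46,S15], [S46,S15,S13]],
    [[S36,S15,S12], [S46,S15,S12], [S36,S25,S14], [S25,S23,S12], [S56,S15,S14,S13,S12], [S46,S13,S12]],
    [[S46,S15,S13,S12], [S56,S35,S12], [S25,S16], [S56,S15,S14,S13,S12], [S56,S23,S15]], [[S26,S15,S13],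
    [S46,S23,S15,S12], [S56,S15,S14,S13], [S46,S13]], [[S46,S15,S13], [S56,S15,S14,S13], [S56,S15]],
    [[S15,S14,S13], [S56,S15,S14,S13]], [[S36,S25,S13]]], Type_Table (Six False False False True True True)
    [[[S36,S25], [S46,S34,S25], [S36,S25], [S46,S35,S23], [S35,S26,S23], [S46,S25], [S36,S25], [], [], [S15],
    [S34,S15], [S15], [S24,S15], [S23,S15], [S24,S15], [S15]], [[S46,S35,S24], [S36,S23], [S46,S34], [S26],
    [S46,S24], [S46,S24], [S46], [S46], [], [S36], [], [S26,S23], [S23], [S24], []], [[S36,S25], [S36],
    [S34,S26], [S36,S23], [S36,S24], [S36], [S36,S34], [S46,S34], [S34], [S34], [S34,S26,S23], [S23],
    [S34,S23], [S34]], [[S36], [S26,S25], [S36,S23], [S46,S34,S23], [S36], [], [], [S34], [], [S26,S24],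
    [S23], [S34,S23], []], [[S35,S26], [S26], [S34,S26], [S26], [S26,S24], [S46,S24,S23], [S36,S24], [],
    [S24], [S24,S23], [S24], [S24]], [[S26], [S46,S24], [S26], [S23], [S23], [S36,S34], [], [S24,S23], [S23],
    [S24], [S23]], [[S36,S24], [S36,S24], [S24], [S46], [S34,S23], [S34], [S24], [S24,S23], [S24], [S24]],
    [[], [], [], [S34], [], [S24], [S23], [S24], [S15]], [[S16], [S16,S15], [S34,S16,S15], [S25,S14,S12],
    [S24,S16,S15], [S35,S14,S13], [S45,S14], [S45,S16,S14]], [[S16], [S24,S23], [S36,S25,S13,S12], [S34],
    [S35,S26,S13], [S35,S34], [S25,S16,S12]], [[S34,S16], [S46,S34,S25,S13,S12], [], [S45], [S45,S34,S26,S13],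
    [S56,S45,S23]], [[S36,S25,S13], [S56,S45,S23], [S25,S23], [S34,S25,S23], [S56,S25,S24]], [[S24,S16],
    [S46,S35,S24,S13], [S45,S36,S24,S13,S12], [S56,S45]], [[S35,S26,S13], [S35,S24], [S56,S35,S34]],
    [[S45,S36,S24,S13], [S56,S45]], [[S46,S35,S13]]] [[[S15], [], [S34], [], [S24], [S23], [S24], [], [],
    [S46], [S36,S34], [S25], [S26,S24], [S35,S23], [S45,S24], [S46]], [[], [S23], [], [], [S23], [S24], [],
    [], [S46], [], [S25], [S23], [S35,S23], [S15], [S46,S15,S13]], [[S34], [S34], [S34], [S23], [S34,S23],
    [S34], [S34], [S34], [S36,S34], [S34,S25], [S34,S23], [S34,S15], [S45,S34,S23], [S36,S34,S15,S13]],
    [[S36,S25], [S56], [S34], [], [S26], [S56,S25,S24], [S25,S23], [S34,S25,S23], [S25], [S23], [S46,S15],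
    [S36,S34,S15], [S46,S23,S15]], [[S24], [S24,S23], [S24], [S24], [S24], [S24,S23], [S24], [S24,S15],
    [S26,S24], [S35,S24,S23], [S45,S24], [S26,S24,S15,S13]], [[S35,S26], [S23], [S36], [S56,S35,S34], [S35],
    [], [S46,S23,S15], [S35,S24], [S35,S23], [S26,S24,S23,S15], [S46,S15]], [[S45,S36,S24], [S46], [S56,S45],
    [S34], [S45,S34], [S36,S34,S23,S15], [S45,S24,S23], [S26,S24,S15], [S45,S24], [S36,S34,S15]], [[], [S45],
    [S35], [S45], [S15,S12], [S45,S23], [S15,S13], [S15,S14], [S46,S15]], [[], [], [S34], [], [S24], [S23],
    [S24], [S16]], [[S46,S35,S12], [S45], [S25,S24,S23], [S45,S23], [S35,S34], [S15], [S46,S15,S13]],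
    [[S45,S36,S12], [S25,S24], [S35,S34,S23], [S34,S15], [S45], [S36,S34,S15,S13]], [[S25,S24], [S56,S24,S15],
    [S46,S15,S12], [S36,S34,S15,S12], [S56,S23,S15,S14]], [[S45,S26,S23,S12], [S35,S34,S23], [S45,S23],
    [S26,S24,S15,S13]], [[S35,S34], [S26,S15,S14], [S56,S15,S14]], [[S45], [S56,S15,S14,S13]], [[S46,S15]]],
    Type_Table (Six False False True False True True) [[[S46,S25,S14], [S46,S15], [S46,S45,S34,S13],
    [S46,S35,S13], [S46,S45,S24,S12], [S46,S25,S12], [S46,S45,S24,S12], [S46,S15], [S46,S45,S14], [S46,S15],
    [S46,S45,S14], [S46,S25,S12], [S46,S45,S23,S14], [S46,S35,S13], [S45,S14], [S15]], [[S46], [S46,S35],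
    [S35], [S46,S25], [S25], [S46,S12], [], [S46,S15], [S15], [S46], [S12], [S46,S23], [S13], [], []],
    [[S36,S13], [S46,S34], [S26,S15,S12], [S36,S15], [], [S36,S15], [S25,S16], [S36,S25,S12], [S12],
    [S36,S25,S12], [S36,S15], [S36,S15], [S34], [S36,S15]], [[S36,S25], [S26,S15,S12], [S12], [S23,S15,S12],
    [], [S25,S16], [], [S25,S13], [S12], [S25], [], [S13], []], [[S26,S12], [S46,S24,S23], [S23],
    [S26,S23,S15], [S35,S26,S13], [S35,S26,S13], [S26,S23,S15], [S26,S23,S15], [S23,S12], [S35,S26,S23,S12],
    [S24,S23], [S26,S23,S15]], [[S35,S26], [S15,S12], [S23], [S35,S16], [S23], [S35], [S23], [S35,S13,S12],
    [S23,S12], [S12], [S23]], [[S26,S15], [S15,S13], [S35,S16], [S56,S35,S12], [S46,S25,S23], [S15,S13,S12],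
    [S46,S35], [S15,S13], [S15,S13], [S15,S13]], [[S13], [S35,S16], [S56,S13], [S56,S25,S23], [S23],
    [S56,S35], [], [S56,S15,S13], [S15,S13]], [[S16], [S46,S14,S13], [S13,S12], [S25,S16,S13,S12], [S13],
    [S35,S16,S13], [S14,S13], [S35,S16,S13]], [[S35,S16,S12], [S25], [S13,S12], [S35,S23], [S13], [], [S13]],
    [[S25,S16], [S25,S23], [S24,S16], [S25,S23,S12], [S25,S23], [S25,S23]], [[S23], [S56,S35,S12], [S12],
    [S56,S25,S23], [S25,S23]], [[S35,S26,S13], [S35], [S35], [S35]], [[], [S56,S35], [S35]], [[], [S35,S14]],
    [[S46,S15]]] [[[S46], [S46,S45], [S46,S15], [S46], [S46,S23,S15], [S46,S23], [S15], [S13], [S46,S35,S13],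
    [S46,S13], [S25,S12], [S23], [S35,S13], [], [S46], [S46]], [[], [S46,S15], [S25], [S46,S35,S12], [S35],
    [S15], [S15], [S46,S35], [S35,S12], [S25], [S25], [S35], [S35], [S14], [S14]], [[S36,S25], [S46],
    [S46,S35,S12], [S56,S15], [S46,S25], [S46], [S46,S35], [S56,S25,S12], [S46,S15,S12], [S46,S12], [S34,S15],
    [S56,S15], [S46,S13], [S46]], [[S25], [S23,S15], [S35], [S46,S15,S12], [S23,S15], [S25,S13,S12],
    [S35,S12], [S46,S25], [S25,S13], [S35,S13], [S35], [S25], [S25,S24,S13]], [[S35,S26], [S46,S23],
    [S46,S35,S23], [S46,S23], [S46,S25,S23], [S56,S35,S23,S12], [S24,S23,S15], [S56,S23,S15],
    [S46,S23,S15,S12], [S46,S23,S12], [S46,S12], [S46,S23]], [[S35], [S46,S15,S13], [S15], [S35,S13],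
    [S25,S23,S12], [S25,S12], [S25,S23], [S46,S35], [S35,S13], [S35], [S24,S15]], [[S46,S25], [S15,S13],
    [S46,S35], [S56,S15], [S46,S25,S23], [S15,S13,S12], [S46,S35], [S15,S13], [S56,S15,S14,S13],
    [S46,S15,S13]], [[S15,S12], [S35,S13], [S56,S15,S13], [S56,S25,S23], [S23,S15,S14], [S56,S35], [S15,S14],
    [S56,S25,S13], [S36,S25,S24,S13]], [[S35,S16,S12], [S46,S13], [S46,S35,S13,S12], [S46,S13,S12],
    [S46,S25,S13], [S46,S13], [S46], [S46,S13]], [[S35,S12], [S46,S25,S13], [S25], [S46,S35,S12], [S35,S23],
    [S35,S12], [S25,S24]], [[S46,S15,S12], [S25,S23], [S46,S35,S12], [S25,S23,S12], [S56,S25,S24,S23],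
    [S46,S25,S23]], [[S25], [S56,S35,S12], [S25,S24,S12], [S56,S35,S23], [S36,S23,S15,S14]], [[S46,S25,S13],
    [S35], [S56,S35,S34], [S46,S35]], [[S35,S23], [S56,S25], [S26,S15,S14]], [[S34,S15], [S15]], [[S15]]],
    Type_Table (Six False False True True False False) [[[S36,S15,S12], [S46,S34,S25,S12], [S36,S15],
    [S36,S15], [S26,S15], [S26,S23,S15], [S46], [S46,S15], [S34,S25,S16,S12], [S36,S12], [S45,S36,S14],
    [S36,S34,S25,S12], [S35,S24,S16,S13], [S35,S26,S24,S13], [S45,S16,S14], [S46,S15]], [[S46,S35,S24],
    [S36,S13], [S46,S34,S12], [S26,S13], [S46,S24,S23,S12], [S46], [], [S46,S24,S13], [S46,S34,S12],
    [S46,S15], [S12], [S46,S23,S15], [S23,S12], [S46,S15], [S15]], [[S36,S15], [S36], [S36,S23],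
    [S46,S45,S24], [S36], [S34], [S45,S36,S14], [S36,S12], [S36,S14], [S34,S12], [S24,S16,S15,S12],
    [S36,S34,S25,S12], [S34,S13], [S34,S25,S12]], [[S36,S15,S12], [S46,S34,S23], [S46,S24,S12], [S46,S34],
    [S46,S34], [S45,S16], [S36,S12], [S36,S14,S13], [S36,S12], [S35], [S26,S14,S13], [S24,S16,S12], [S15]],
    [[S26,S15], [S26,S23], [S26], [S24,S23], [S24,S16], [S26,S13], [S35,S26,S24,S13], [S35,S26,S24,S13],
    [S26,S23,S14], [S24,S13], [S24,S13,S12], [S35,S24,S13]], [[S26,S15,S13], [S46,S24], [S46,S24,S23],
    [S26,S13], [S26,S13], [S25,S23], [S36,S14,S13,S12], [S26,S14,S13,S12], [S26,S23,S12], [S34,S23,S16,S12],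
    [S23,S15]], [[S46,S24], [], [S45,S16], [S45], [S34,S16,S15,S13], [S45,S34], [S24,S16,S15,S12], [S45,S24],
    [S14], [S45,S24]], [[S46,S34], [S45,S16], [S46,S45], [S45,S24,S23], [], [S45,S34], [S23], [S35],
    [S15,S14]], [[S35,S24,S16], [S34,S16,S12], [S34,S16,S13,S12], [S14,S12], [S24,S16,S13], [S23,S14,S12],
    [S14], [S45,S14]], [[S26,S13], [S36,S35,S14,S12], [S34,S12], [S26,S25,S14,S13], [S24,S13], [S16,S14],
    [S25,S13]], [[S45,S36,S14,S12], [S36,S14,S12], [S24,S16], [S26,S13], [S34,S16,S13], [S45,S14]],
    [[S36,S12], [S35,S12], [S45,S34,S12], [S56,S14], [S25,S24,S13]], [[S35,S24,S16,S12], [S26,S23,S14,S12],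
    [S24,S16,S13,S12], [S35,S24,S13]], [[S26,S23,S12], [S24,S13], [S35,S34,S12]], [[S34,S16,S13], [S45]],
    [[S45]]] [[[S26,S13], [S34,S12], [], [S46], [S23], [S46,S23], [], [S46], [S24,S13], [S34,S12], [S16,S14],
    [S36,S34,S12], [S26,S24,S13], [S26,S24,S13], [S16,S14], [S46,S25]], [[S46,S34,S15,S12], [S46], [S15,S12],
    [S46,S23], [S23,S15,S12], [S46], [], [S25], [S36,S12], [S36,S34,S12], [S36,S34,S12], [S26,S24,S23,S12],
    [S26,S24,S23,S12], [S46], [S46,S25]], [[S36,S25], [S34,S25], [S34,S15], [S46], [S46], [S46],
    [S16,S15,S14], [S36,S34,S12], [S34,S25,S13], [S34,S12], [S16,S14], [S36,S34,S12], [S16,S14],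
    [S36,S34,S15]], [[S46,S25,S23], [S46,S45,S23], [S46,S15,S12], [S56,S25], [S46,S25,S23], [S45,S36,S13,S12],
    [S56,S34,S15,S12], [S36,S34,S25], [S36,S34,S15,S13,S12], [S25], [S46,S15,S12], [S36,S34,S25],
    [S46,S35,S23]], [[S35,S26], [S35,S24,S23], [S46,S23], [S46,S23], [S26,S24,S13], [S26,S24,S13],
    [S23,S16,S14], [S26,S24,S13], [S35,S24,S13,S12], [S24,S13], [S23,S16,S14], [S45,S26,S24,S13]], [[S46,S35],
    [S56,S35], [S46,S35], [S45,S26,S13], [S56,S24,S15,S13], [S35,S23], [S46,S23,S15,S12], [S35,S34,S26,S13],
    [S26,S24,S15,S13], [S35,S26,S24,S23], [S46,S25]], [[S46], [S46], [S16,S15,S14], [S45], [S25,S14], [S45],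
    [S35,S14], [S45,S23], [S16,S14], [S45,S16]], [[S46,S35], [S45,S16], [S56,S35,S12], [S36,S25,S24,S13,S12],
    [S25,S23], [S35,S34,S26,S13], [S35], [S46,S25], [S56,S15,S14,S13]], [[S45,S34,S16,S12], [S36,S14,S12],
    [S45,S14,S12], [S36,S34,S13,S12], [S45,S23,S14,S12], [S26,S24,S13], [S14], [S25,S16,S14]], [[S36,S12],
    [S45,S34,S12], [S36,S34,S12], [S45,S24,S13], [S26,S24,S13], [S35,S14,S12], [S35,S26,S12]], [[S45,S36,S12],
    [S45,S36,S34,S12], [S45,S16,S14,S12], [S45,S16,S14,S12], [S25,S23,S16,S14], [S36,S34,S15,S12]],
    [[S45,S36,S12], [S45,S23,S16,S12], [S45,S26,S13], [S45,S34,S12], [S56,S25,S24]], [[S35,S16,S14],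
    [S45,S26,S24,S23,S12], [S35,S16,S14], [S25,S16,S14]], [[S45,S26,S23,S12], [S56,S35,S14],
    [S56,S35,S34,S23]], [[S35,S16,S14], [S56,S45,S13]], [[S46,S15]]], Type_Table (Six False False True True
    False True) [[[S36,S15], [S46,S34,S25,S12], [S36,S15], [S36,S15], [S26,S15], [S46,S25,S12], [S46,S34,S15],
    [S46,S15], [S34,S25,S16,S12], [S36,S25,S12], [S36,S15], [S36,S25,S12], [S35,S13], [S35,S26,S13],
    [S46,S23,S15], [S46,S15]], [[S46,S35,S24], [S46,S34], [S46,S34,S25], [S46,S24,S12], [S46,S24,S12], [S36],
    [S46,S25], [S16], [S36,S12], [S25,S12], [S36,S12], [S46,S35,S23], [S26,S12], [S46,S15], [S46,S25,S12]],
    [[S45,S36,S14], [S36,S15], [S34,S26,S12], [S26], [S46,S34], [S46,S34], [S36,S14,S13], [S46,S34,S12],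
    [S36,S14], [S36,S15], [S36,S25,S14], [S36,S34,S25,S12], [S34,S16], [S36,S34,S15]], [[S36,S25,S13],
    [S36,S23,S15,S12], [S26,S23,S15,S12], [S36], [S46,S34,S25], [S46,S34,S25,S13], [S46,S34,S12],
    [S34,S25,S16,S13], [S36,S15,S12], [S25,S24,S16], [S46,S15,S12], [S36], [S26,S13]], [[S26], [S26,S15],
    [S36,S24,S23], [S46], [S35,S26,S13], [S35,S26,S13], [S45,S34,S26,S13], [S36,S24,S15], [S26,S25,S13],
    [S35,S26,S23,S12], [S34,S26,S13], [S26,S24,S15]], [[S26,S15], [S46,S24], [S46,S24,S15], [S23,S16],
    [S26,S13], [S46,S23], [S23,S15], [S46,S23], [S26,S15,S12], [S46,S23], [S23,S15]], [[S46,S34,S23],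
    [S46,S34], [S45,S34,S16], [S36,S12], [S45,S34,S16], [S36,S12], [S45], [S35,S23], [S34,S26,S13], []],
    [[S36,S23,S15], [S46,S25,S14], [S46,S45], [S56,S34,S25,S13,S12], [S46,S25], [S46,S23], [S46,S24,S15,S12],
    [S34,S25], [S36,S23,S15]], [[S34,S16,S12], [S46,S14,S12], [S36,S14,S12], [S36,S12], [S45,S24,S16],
    [S16,S14,S12], [S45,S34,S16,S13], [S25,S16,S14,S13,S12]], [[S36,S13,S12], [S36,S35,S14,S13,S12],
    [S36,S12], [S35,S34,S12], [S23,S16,S12], [S35,S16,S13], [S34,S12]], [[S34,S25,S16], [S36,S25,S14,S12],
    [S24,S16], [S36,S34,S13,S12], [S34,S25,S16], [S34,S25,S13,S12]], [[S46,S34,S25,S13], [S24,S16], [S15,S12],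
    [S36,S25,S14,S13], [S46,S25,S23]], [[S26,S13], [S26,S13], [S34,S23,S16,S12], [S35,S26,S24,S13]],
    [[S35,S23,S16], [S25], [S35,S23,S16,S12]], [[S45,S34,S26,S13], [S46,S25,S23]], [[S46,S25,S13]]]
    [[[S46,S15], [S15], [S34,S25,S12], [S25,S12], [S34,S25,S12], [S26,S23], [S36,S34], [S46], [S15],
    [S46,S12], [S46,S25,S12], [S36,S34,S12], [S25], [S36,S34,S23,S12], [S46,S13], [S46,S25,S12]],
    [[S36,S15,S12], [S25], [S36,S15,S12], [S46,S24,S23,S12], [S26,S15,S12], [S46], [S46,S25], [S36,S12],
    [S36,S12], [S34,S25], [S36,S12], [S34,S12], [S26,S12], [S46,S25,S13], [S46,S25]], [[S46,S34,S25],
    [S46,S34,S25], [S46,S34], [S15], [S46,S34], [S46], [S36,S14], [S36,S34,S12], [S34,S25,S16],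
    [S36,S34,S15,S12], [], [S36,S34,S15,S13], [S46,S13], [S36,S34,S15]], [[S36,S15,S12], [S46,S34,S15,S12],
    [S56,S23,S15], [S46,S34,S25,S23], [S46,S25], [S36,S25], [S36,S15,S13,S12], [S56,S34,S25,S13],
    [S36,S15,S12], [S25], [S46,S15,S12], [S36,S34,S25], [S36,S25,S13]], [[S46,S35,S24], [S46,S35,S24,S23],
    [S36], [S46], [S25], [S36,S14,S12], [S23], [S46,S23,S15], [S36,S15,S14], [S23,S15,S12], [S26,S24,S23],
    [S46,S25,S23]], [[S46,S24,S15,S13], [S46], [S23,S15], [S46,S35,S23], [S23,S15,S12], [S23,S15], [S23,S15],
    [S46,S35,S23], [S23,S15,S12], [S26,S24,S23,S15], [S46,S23,S15]], [[S46,S34], [S46], [S45,S24], [S35],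
    [S56,S34,S25,S13], [S25], [], [S34,S15,S13], [S46,S23], [S36,S34,S15]], [[S46,S15,S12], [S36,S25,S24,S13],
    [S46,S25,S23], [S36,S25,S24,S13], [S25], [S25,S24,S23], [S56,S15,S14,S12], [S46,S25], [S46,S23,S15]],
    [[S45,S36,S14,S12], [S46,S34,S12], [S45,S36,S14,S12], [S36,S34,S12], [S45,S26,S13], [S16,S14,S12], [S14],
    [S36,S34,S15,S13,S12]], [[S36,S12], [S45,S36,S12], [S36,S12], [S34,S12], [S26,S13], [S25,S13], [S46,S25]],
    [[S36,S25,S14], [S34,S25,S13], [S36,S25,S14], [S25,S16,S14], [S34,S25,S13], [S36,S34,S25,S13]],
    [[S36,S25], [S15,S14,S12], [S36,S34,S15,S12], [S56,S34,S25,S13], [S36,S34,S25,S13]], [[S26,S13],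
    [S46,S23,S15,S12], [S16,S14], [S26,S13]], [[S26,S15,S13], [S25,S24,S16,S12], [S26,S15]],
    [[S34,S25,S16,S13], [S34,S25,S16,S12]], [[S36,S25,S13]]], Type_Table (Six False False True True True True)
    [[[S46,S35,S24,S13], [S46,S34,S25,S12], [S36,S23,S15], [S46,S34,S15], [S26,S15], [S46,S24,S15],
    [S46,S24,S15], [S46,S15], [S16,S15], [S15], [S23,S15], [S15], [S15], [S23,S15], [S24,S15], [S15]],
    [[S36,S25], [S46,S45,S34,S23], [S36], [S46,S45,S24], [S26], [S46,S45,S24], [], [S16], [S25], [S13],
    [S25,S12], [S13,S12], [S35,S23,S12], [S46], [S13]], [[S36,S23,S15], [S36,S13], [S26,S12], [S36,S23,S15],
    [S46,S34,S23], [S36,S15], [S46,S34,S13], [S46,S34,S25,S12], [S34,S16,S13], [S36,S15], [S36],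
    [S36,S23,S15], [S34,S26,S13], [S36,S15]], [[S36,S15], [S26,S15,S12], [S26], [S46,S45,S34,S23],
    [S36,S15,S13], [S16], [S36,S15], [S13], [S36,S15], [S36], [S35], [S36], [S34,S15,S13]], [[S26,S15],
    [S26,S13], [S46,S24], [S26,S15], [S46,S24,S13,S12], [S46,S35,S24,S13], [S26,S23], [S26,S15],
    [S24,S16,S13,S12], [S26,S23,S15], [S36,S24,S13], [S26,S23,S15]], [[S26,S15], [S46,S45,S24], [S26,S15,S13],
    [S23,S16], [S26,S25,S13], [S26,S23], [S25,S23], [S13,S12], [S26,S23,S15], [S26,S23], [S24,S15,S13,S12]],
    [[S46,S24], [S46,S24], [S46,S14], [S46,S45,S24], [S34,S26,S13,S12], [S46], [S36,S24,S13], [S46,S23],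
    [S36,S24,S13], []], [[S36,S15], [S16], [S15,S14], [S23], [S36,S15], [], [S26,S23,S15], [], [S15,S13]],
    [[S46,S14], [S46,S45,S14], [S34,S16,S15], [S25,S16,S13,S12], [S24,S23,S16,S15], [S35,S16,S13],
    [S34,S16,S15], [S35,S16,S13]], [[S25,S16], [S46,S14], [S36,S15,S13,S12], [S46,S23,S14], [S25,S16,S12],
    [S46], [S13]], [[S34,S25,S16,S13], [S46,S34,S25,S13,S12], [S24,S16], [S16,S15], [S34,S26,S13],
    [S34,S25,S16,S12]], [[S36,S25,S13], [S23,S16], [S24,S16], [S56,S25,S23], [S56,S25,S24,S13]],
    [[S35,S24,S16,S12], [S46,S35,S24,S13], [S36,S24,S13], [S35,S24,S16,S13]], [[S35,S26,S13], [S56,S35],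
    [S35,S24,S16]], [[S26,S13], [S35]], [[S15,S13]]] [[[S46,S15], [S15], [S36,S15], [S15], [S26,S23,S15],
    [S23,S15], [S24,S15], [S15], [S15], [S46,S15], [S15], [S25,S12], [S23,S15], [S35,S23,S12], [], [S46,S13]],
    [[S25,S12], [S15,S13], [S25], [S15,S13,S12], [S26,S23], [S46,S15], [S15,S13], [], [S25], [S25,S13], [S25],
    [S35,S12], [S35,S23], [], [S24,S13]], [[S36,S25], [S46,S34], [S46,S34,S15], [S26,S15,S13], [S46,S34,S23],
    [S46], [S24,S16], [S46,S15], [S36,S25], [S26,S24,S13], [], [S46,S15], [S36,S34], [S36,S13]],
    [[S36,S23,S15], [S36,S15], [S26,S13], [S36,S15], [S23,S15], [S36,S25], [S35,S23], [S36,S25],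
    [S34,S23,S15,S12], [S36,S15], [S15], [S36,S13,S12], [S34,S26,S13]], [[S35,S26], [S46,S24,S23], [S46,S24],
    [S46,S23], [S56,S34,S15], [S46,S23,S15], [S23], [S46,S23,S15], [S26,S24,S23], [S56,S15], [S26,S24,S23],
    [S26,S13,S12]], [[S26,S15], [S26,S23,S15], [S15], [S35,S26,S23], [S25], [S26,S23,S15], [S23,S15],
    [S35,S26,S23], [S24,S15,S12], [S26,S13], [S36,S24,S13]], [[S46,S24], [S46,S15], [S46,S35], [S46,S15,S14],
    [S34], [S36,S15,S13,S12], [S24,S23], [S26,S15,S13], [S46], [S46,S15,S13]], [[S15], [S25], [S56,S15,S13],
    [S25], [S23,S15], [S35], [S15], [S36,S13], [S56,S15]], [[S16], [S46,S25,S13], [S45,S14], [S46,S34,S12],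
    [S45,S23,S14], [S35,S14,S13], [], [S46,S13]], [[S36,S25,S14], [S46,S25,S13], [S25], [S46,S35,S12],
    [S35,S23], [], [S16]], [[S36,S25,S14], [S25,S23], [S13,S12], [S26,S15,S13], [S34,S26,S13], [S56,S25,S13]],
    [[S36,S25,S13], [S36,S15,S12], [S26,S15,S14,S12], [S56,S25,S13], [S36,S25,S24,S13]], [[S35,S26,S14],
    [S35], [S56,S35,S34], [S56,S35,S13,S12]], [[S35,S26,S13], [S26,S15], [S56,S24,S15]], [[S35,S34],
    [S46,S15,S13]], [[S36,S25,S13]]], Type_Table (Six False True True True True False) [[[S26,S15],
    [S46,S35,S24,S13], [S45,S36,S23,S14], [S46,S35,S13], [S26,S15], [S36,S15], [S46,S34,S15], [S46,S23,S15],
    [S25,S16,S12], [S36,S25,S12], [S46,S34,S25,S12], [S46,S25,S13,S12], [S26,S15], [S35,S16,S13],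
    [S45,S16,S14], [S36,S15]], [[S46,S34,S23], [S36,S13], [S36], [S24,S23,S16], [S36,S13,S12],
    [S46,S34,S23,S15], [S46,S34], [S36,S35,S13], [S36,S23], [S46,S34,S25,S13,S12], [S46,S34,S12], [S26,S13],
    [], [S46,S23,S15], []], [[S36,S23], [S46,S34], [S24,S16], [S36,S23,S15], [S46,S34,S13,S12], [S36],
    [S26,S14,S12], [S36,S25,S13,S12], [S46,S34,S23], [S36,S12], [S34,S26,S13], [S36,S23,S15], [S34], [S34]],
    [[S46,S13], [S46,S45,S24], [S36,S35,S12], [S46,S45,S34,S12], [S36], [S46,S45,S14], [S36,S35],
    [S46,S45,S34], [S36,S12], [S36], [], [S34], [S25,S23]], [[S26,S14], [S24,S16,S12], [S24,S23,S16,S12],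
    [S24,S13], [S24,S16], [S35,S26,S14,S13], [S45,S26,S14], [S45,S26,S14], [S24,S16], [S26,S14,S13],
    [S26,S14], [S24,S13]], [[S36,S13,S12], [S26], [S26], [S35,S24,S23,S16], [S46,S24,S13], [S26,S15],
    [S46,S34,S12], [S24,S16,S12], [S46,S24,S13], [S26,S14], []], [[S46,S34,S13,S12], [S34,S26], [S45,S24,S16],
    [S25,S16], [S36,S24,S13,S12], [S36,S12], [S24,S16,S13], [S26,S14,S13], [S36,S24,S13,S12], [S34]],
    [[S26,S13,S12], [S45,S16], [S46,S45,S34], [S36,S35], [S36,S12], [S56,S24,S13], [], [S34], [S13,S12]],
    [[S24,S16,S12], [S26,S14], [S26,S14,S13], [S23,S14], [S26,S14], [S24,S16,S13], [S24,S16,S12], [S23,S14]],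
    [[S26,S14], [S16,S12], [S16,S12], [S26,S14], [S46,S23,S14,S12], [S24,S16,S12], [S12]], [[S26,S14,S13],
    [S34,S16,S12], [S26,S14,S13], [S24,S16,S13], [S36,S23,S14], [S34,S12]], [[S23,S16], [S56,S23,S14], [S12],
    [S34,S12], [S23]], [[S26], [S26,S14,S13], [S26,S14], [S35,S14]], [[S46,S14], [S26,S14], [S14]],
    [[S36,S14,S13], [S14,S13]], [[]]] [[[S36], [S15], [S34,S15], [S46], [S35,S24,S13], [], [S34],
    [S26,S24,S13], [S45,S23,S14], [S12], [S34,S12], [S23,S16,S14], [S26,S24,S13], [S46], [S36,S34],
    [S46,S35]], [[S36,S25], [S46,S15], [S36,S13], [S46,S15], [], [S46,S15], [], [S46,S25,S12], [S12],
    [S46,S25,S12], [S12], [], [], [S36,S34], [S46]], [[S46,S34,S25], [S46,S34,S13], [S36], [S36], [S34],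
    [S34], [S36,S12], [S36,S12], [S34,S12], [S34,S12], [S34], [S46], [S34], [S36,S34]], [[S36,S25], [S36,S15],
    [S15], [S34,S15], [S13,S12], [S36,S25], [S25], [S34,S25], [S23], [S35], [S14], [S14,S13], [S13]],
    [[S35,S24,S16,S12], [S24,S13], [S24,S13,S12], [S24,S13], [S45,S23,S16], [S26,S23,S14,S12], [S26,S23,S14],
    [S23,S16,S14], [S24,S16], [S24,S13], [S24,S13,S12], [S26,S24,S13]], [[S36], [S46,S24], [S36],
    [S24,S16,S15,S13], [S26,S13], [S35,S13], [S56,S15,S12], [S56,S35,S24,S13], [S24,S16,S13], [S36,S34],
    [S36,S13,S12]], [[S46,S34], [S46,S34], [S45,S23,S16], [S26,S14], [S34,S26,S13], [S23,S16,S14],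
    [S56,S45,S24,S13], [S46], [S24,S16,S12], [S46,S34,S13,S12]], [[S13], [S26,S25,S24,S13], [S25], [S34,S25],
    [S25,S13,S12], [S56,S13,S12], [], [S34], [S46,S15]], [[S35,S26,S14], [S23,S14,S12], [S23,S14], [S23,S14],
    [S26,S14,S12], [S23,S14,S12], [S23,S14], [S23,S16,S14]], [[S36,S12], [S46,S14,S12], [S36,S12],
    [S56,S35,S23,S14], [S26,S14,S13], [S36,S34,S12], [S26,S14]], [[S46,S34,S12], [S46,S34,S12],
    [S56,S45,S23,S14], [S46,S12], [S26,S14], [S26,S14,S13]], [[S23,S12], [S56,S23], [S12], [S34,S12],
    [S46,S25]], [[S35,S26,S14], [S14], [S14,S13], [S24]], [[S24], [S45,S14], [S35,S26,S24,S13]], [[S24,S23],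
    [S45,S26,S24,S13]], [[S25,S14]]], Type_Table (Six False True True True True True) [[[S46,S35,S24,S13],
    [S46,S45,S34,S13], [S36,S35,S13], [S36,S15], [S26,S25,S12], [S26,S25,S12], [S34,S26,S25,S12], [S36,S15],
    [S16,S15], [S16,S15], [S34,S16,S15], [S36,S25,S12], [S16,S15], [S34,S15], [S15], [S26,S15]], [[S36,S13],
    [S46,S34], [S36], [S26,S12], [S26,S15], [S46,S45,S34,S23,S12], [S36,S13], [S16], [S25,S16,S12],
    [S46,S45,S34,S13], [S36,S23], [S36], [S35], [S36], [S23]], [[S46,S34,S13], [S46,S34], [S34,S26,S12],
    [S36,S35,S23,S12], [S34,S26,S15], [S46,S34,S13], [S34,S16], [S36,S35,S13], [S34,S25,S16,S12],
    [S46,S34,S23], [S46,S34], [S46,S34], [S45,S34], [S34,S23]], [[S46,S13], [S26,S12], [S36,S35,S23],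
    [S46,S45,S34,S23], [S46,S13,S12], [S16], [S36,S35,S13], [S46,S45,S34,S13], [S46,S23], [S36], [S36],
    [S46,S34], [S26,S24,S15,S13]], [[S26,S15], [S26,S15], [S34,S26,S15], [S26,S15], [S16], [S26,S25,S12],
    [S34,S26,S25,S12], [S26,S15], [S26,S14,S12], [S46,S24,S13], [S36,S24,S13], [S26]], [[S26,S15], [S13,S12],
    [S34,S26,S13], [S16], [S26,S23,S15], [S36,S14,S13], [S36,S23], [S46,S24,S13,S12], [S26,S13], [S36],
    [S26,S13]], [[S34,S26,S15], [S26,S13], [S34,S16], [S46,S14], [S34,S26,S23,S15], [S46,S34,S23],
    [S36,S24,S13], [S46,S34], [S34,S26,S13], [S34,S26,S13]], [[S24,S13], [S16], [S36,S35,S13],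
    [S46,S45,S34,S13], [S15,S13], [S24,S16], [S34,S13,S12], [S13,S12], [S24,S15,S13]], [[S25,S16],
    [S25,S16,S12], [S34,S25,S16,S12], [S25,S16,S12], [S24,S16], [S46,S23,S14], [S36,S23,S14], [S16,S12]],
    [[S25,S16], [S23], [S34,S23,S16,S12], [S46,S23,S14], [S23,S16], [S36,S12], [S23,S16]], [[S34,S25,S16],
    [S23,S16,S12], [S36,S23,S14,S12], [S46,S34,S12], [S34,S23,S16], [S34,S23,S16]], [[S23,S14], [S26,S14,S12],
    [S34,S23], [S23], [S23,S16,S14]], [[S24,S16], [S46,S35,S14], [S36,S35,S14], [S35,S24]], [[S46,S24],
    [S36,S14], [S26,S13]], [[S36,S24], [S34,S26,S13]], [[S46,S23]]] [[[S15], [S15], [S34,S15], [S15],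
    [S26,S24,S15], [S23,S15], [S34,S23,S15], [S15], [S25,S16,S14,S12], [S25,S13,S12], [S34,S25,S13,S12],
    [S25,S12], [S23,S15], [S46], [S36,S34], [S46,S23]], [[S36], [S15,S13], [S36], [S36,S15], [S35,S13],
    [S36,S15], [S34,S13], [S36,S25,S12], [S35,S23,S12], [S36,S25,S12], [S34,S23,S12], [S36], [],
    [S36,S25,S23], [S34,S26,S15,S13]], [[S46,S34], [S46,S34], [S46,S34,S15], [S46,S34,S15], [S45,S34,S13],
    [S13], [S46,S34,S25,S12], [S46,S34,S25,S12], [S45,S34,S23,S12], [S23,S12], [S46,S34], [S46,S25,S23],
    [S34], [S26,S15,S13]], [[S46,S23,S15], [S36,S15], [S36,S15], [S46,S34,S15], [S26,S24,S13], [S36,S25],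
    [S36,S25], [S46,S34,S25], [S23,S16,S14], [S36,S14], [S46,S13], [S36,S13], [S13]], [[S26,S12],
    [S46,S34,S23], [S36,S23], [S36], [S45,S23,S16], [S23,S15], [S34,S23,S15], [S26,S24,S15], [S26,S14,S12],
    [S46], [S36,S34], [S26,S24,S13]], [[S26,S15], [S26,S23,S15], [S36,S15,S13], [S35,S16], [S24,S15],
    [S26,S23,S15], [S26,S24,S15,S13], [S36], [S24,S16], [S36,S13,S12], [S34,S26,S13]], [[S34,S26,S15],
    [S46,S34,S15,S13], [S45,S34,S16], [S25,S23,S16], [S23], [S56,S23,S15], [S46,S34], [S46,S13,S12],
    [S46,S13,S12], [S26,S13]], [[S15,S13], [S25,S24,S16], [S34,S25,S13,S12], [S25,S13,S12], [S23,S15,S14],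
    [S36], [S15], [S34,S15], [S26,S13]], [[S16], [S46,S34,S13,S12], [S36,S13,S12], [S36,S12], [S24,S16],
    [S46,S12], [S36,S34,S12], [S23,S16,S14]], [[S25,S16], [S25,S16,S13,S12], [S36,S25,S23], [S36,S12],
    [S26,S14,S12], [S36,S23], [S34,S23,S16]], [[S34,S25,S16], [S46,S34,S25,S23], [S46,S34,S12], [S46,S23],
    [S46,S23], [S23,S16]], [[S25,S13], [S36,S12], [S25], [S34,S25], [S23,S16]], [[S24,S16], [S35,S14],
    [S36,S14,S13], [S26,S24,S13]], [[S35,S26,S13], [S36], [S24,S15]], [[S45,S34,S26,S13], [S23]],
    [[S25,S13]]], Type_Table (Six True True True True True True) [[[S16], [S46,S45,S14], [S36,S35,S13],
    [S36,S35,S13], [S26,S25,S12], [S26,S25,S12], [S34,S26,S25,S12], [S15], [S16,S15], [S16,S15],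
    [S34,S16,S15], [S25,S12], [S24,S16,S15], [S35,S13], [S45,S14], [S15]], [[S16], [S36,S13], [S36],
    [S26,S12], [S26,S23], [S46,S45,S24,S12], [S36], [S16], [S16,S13], [S46,S45,S14], [S36,S12],
    [S46,S45,S23,S14], [S16], [S46,S14], []], [[S34,S16], [S46,S34], [S34,S26,S12], [S36,S35,S23,S12],
    [S34,S26,S23], [S46,S34], [S34,S16], [S36,S35,S13], [S34,S16,S13], [S46,S34,S12], [S36,S35,S24,S13],
    [S36,S13], [S34,S16], [S34]], [[S36,S24], [S26,S12], [S36,S24,S12], [S46,S24,S23,S12], [S24,S15,S13],
    [S16], [S36,S14], [S46,S14,S13], [S25,S23,S14], [S24,S16], [S36], [S46,S34], [S13]], [[S24,S16],
    [S46,S24,S23], [S36,S24], [S36,S24], [S24,S16], [S26,S25,S13,S12], [S26,S25,S14,S12], [S26,S12],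
    [S24,S16,S13], [S24,S16], [S36,S24,S12], [S24]], [[S46,S34], [S46,S34,S12], [S34,S15,S13], [S23,S16],
    [S26,S23,S14], [S34,S16], [S26,S23], [S46,S14,S13,S12], [S35,S14], [S46,S24,S23], [S12]], [[S36],
    [S15,S13], [S24,S16], [S16], [S26,S23,S14,S12], [S34,S26,S23], [S36,S14,S12], [S36,S24], [S45,S14,S13],
    [S34,S12]], [[S36,S12], [S16,S15], [S16,S15,S13], [S34,S16,S15,S13], [S26,S23,S14], [S24,S16,S15,S13],
    [S36,S14], [S46,S14,S13], [S15,S13]], [[S46,S14], [S46,S14,S13], [S36,S14], [S36,S14,S12], [S26,S23,S14],
    [S46,S14], [S36,S14], [S14]], [[S46,S34,S12], [S46,S34], [S34,S25,S23], [S46,S24,S23], [S35,S24],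
    [S46,S14,S13], []], [[S36,S12], [S25,S23], [S36,S24], [S36,S14], [S45,S24,S23], [S34]], [[S36],
    [S26,S25,S23,S14], [S36,S24], [S46,S24,S23], [S25,S23]], [[S16,S13], [S35], [S45,S34], [S24]], [[S26],
    [S46,S34], [S35]], [[S36,S24], [S45,S34]], [[S36]]] [[[S15], [S15], [S34,S15], [S15], [S24,S15],
    [S23,S15], [S24,S15], [], [S45,S14], [S35,S13], [S45,S14], [S12], [S35,S24,S13], [S13], [S14], [S46]],
    [[S14], [S23,S15], [S36], [S15], [S26,S23], [S15], [S13], [S25,S12], [S16,S13], [S25,S12], [S23],
    [S35,S13], [], [S35,S16], [S16]], [[S13], [S46,S34], [S34,S15], [S34,S15], [S34,S26,S23], [S34,S13],
    [S34,S25,S12], [S34,S25,S12], [S34,S16,S13], [S34,S23], [S45,S34,S13], [S46,S15,S13], [S34], [S46,S13]],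
    [[S13], [S56,S24,S15], [S34,S15,S13,S12], [S15,S13,S12], [S24,S13], [S56,S25,S14,S12], [S34,S25,S23],
    [S25,S23], [S23,S14], [S36,S15], [], [S34], [S26,S15,S13]], [[S12], [S46,S24,S23], [S36,S24], [S24,S13],
    [S45,S24,S12], [S35,S24,S13], [S45,S24,S12], [S46,S35,S12], [S24,S16,S13], [S24], [S24,S23], [S46,S12]],
    [[S12], [S15,S13], [S34,S13], [S56,S35,S14,S13], [S35,S24], [S26,S23,S15], [S23], [S35], [S14], [S24,S23],
    [S35,S16]], [[S34,S12], [S13], [S56,S45,S14], [S35,S16], [S45,S24,S23], [S34,S23], [S45,S34], [S24],
    [S14,S13], [S46,S15,S13]], [[S13], [S45,S36], [S56,S13], [S56,S34,S13], [S36,S14,S12], [S56,S24,S13],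
    [S46,S14], [S36,S14], [S13]], [[], [S46,S14,S13], [S36,S14], [S23,S14], [S26,S23,S14], [S14], [S14,S13],
    [S46]], [[], [S25,S23,S12], [S34,S23], [S35,S12], [S24], [S14,S13], [S35,S26]], [[S34], [S23],
    [S45,S34,S12], [S14], [S24,S23], [S46,S25,S23]], [[S23], [S56,S23,S14], [S24,S16], [S36,S24,S12], [S23]],
    [[S24], [], [S34], [S46,S35]], [[], [S16,S15], []], [[S34], [S34]], [[]]]]"

text \<open>Sixteen layers, one for each element of \<open>fours\<close> as adjacencies between the
  two pairs; inside a layer the words follow the upper triangle over \<open>flags\<close>.\<close>

definition edge_words :: "words list" where
  "edge_words =
    [[[[S26], [S26,S24,S13], [S35,S26,S24], [S24,S15], [S35,S24,S12], [S24,S16], [S26,S23,S14], [S26,S24,S13],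
    [S35,S24,S16,S12], [S35,S24,S12]], [[S35,S24,S13], [S46,S35,S14], [S46,S24,S13], [S46,S24,S13],
    [S35,S23,S16], [S46,S23,S14,S12], [S46,S23,S14,S12], [S46,S24,S13], [S46,S24,S13]], [[S45,S16], [S46,S24],
    [S24,S23,S12], [S34,S16,S12], [S36,S14,S13,S12], [S14], [S46,S24], [S36,S14]], [[S24,S16,S13],
    [S24,S16,S13], [S35,S24,S23,S16], [S24,S16], [S26,S23,S14,S12], [S35,S24,S16], [S35,S24,S23,S16]],
    [[S45,S24,S12], [S35,S23,S16], [S35,S24,S23,S16,S12], [S26,S13], [S35,S24,S23,S16], [S35,S24,S23,S16]],
    [[S16], [S25,S14], [S35,S14], [S35,S26,S14], [S35,S14]], [[S26,S14,S13], [S26,S23,S14,S12], [S35,S26,S14],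
    [S35,S26,S14,S13]], [[S45,S14], [S35,S26,S14,S13], [S35,S26,S14,S13]], [[S26], [S45,S16]], [[S24]]],
    [[[S45,S24], [S24], [S35,S24], [S24,S13], [S35,S24], [S24,S13], [S35,S24,S16,S13], [S26,S24,S13],
    [S24,S13], [S35,S24,S23]], [[S35,S13], [S35,S16], [S46,S24,S13], [S46,S23,S12], [S16], [S46,S14,S13],
    [S46,S13], [S46,S24,S13], [S46,S35,S13]], [[S26,S23,S12], [S26,S13], [S24,S23,S12], [S36,S23,S14], [S14],
    [S14], [S24,S23,S16,S12], [S46,S24,S13]], [[S24,S13], [S35,S24], [S26,S14,S13], [S26,S14,S13],
    [S26,S24,S13], [S35,S24,S16], [S35,S24,S12]], [[S12], [S35,S23,S16,S12], [S35,S23,S16,S12], [S26,S13],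
    [S16,S12], [S46,S35,S24]], [[S45,S14], [S14,S13], [S35,S14], [S23,S14,S12], [S35,S14,S13]], [[S14,S13],
    [S35,S14], [S35,S26,S14], [S35,S14]], [[], [S26], [S46,S35,S14]], [[S16], [S46]], [[]]], [[[S35,S24],
    [S24,S23], [S45,S24], [S24,S12], [S45,S24], [S24,S13,S12], [S45,S24,S16,S13,S12], [S26,S24,S13,S12],
    [S24,S13,S12], [S45,S24]], [[S13], [S23,S12], [S24,S16], [S26,S24,S23,S12], [S36,S14], [S26,S14],
    [S16,S14,S13], [S26,S14], [S46,S13]], [[S24,S23], [S24,S23], [S24,S23], [S36,S14], [S34,S16,S13], [S14],
    [S26,S14], [S36,S14]], [[S45,S24,S13,S12], [S45,S24,S13], [S36,S14,S12], [S35,S24,S16,S13], [S46],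
    [S35,S24,S16,S13], [S35,S14,S13,S12]], [[S24,S23], [S34,S16], [S26,S14], [S26,S14], [S24,S16], [S46]],
    [[S35,S14], [S14], [S45,S14], [S23,S14], [S45,S14]], [[S45,S23,S14], [S45,S23,S14], [S35,S26,S23,S14],
    [S35,S24,S23]], [[S14,S13], [S26,S14], [S46,S12]], [[S34,S16], [S36,S34]], [[S34]]], [[[S24], [S26,S24],
    [S12], [S24], [S12], [S23,S14], [S35,S24,S16,S13], [S26,S24,S13], [S24,S13], [S45]], [[S46],
    [S46,S35,S23,S12], [S35,S26,S23,S12], [S26,S12], [S35,S16,S13], [S35,S16,S13], [S16], [S13], [S46,S35]],
    [[S46,S23], [S24,S23], [S26,S24,S23], [S34,S16,S12], [S14], [S16,S14], [S14], [S46,S24]], [[S24], [],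
    [S46,S14], [S35,S24,S16,S13], [S24,S16], [S16,S14,S12], [S46,S14]], [[S35,S16], [S46,S14], [S16,S13],
    [S16,S14], [S24,S16], [S16]], [[S14,S12], [S14], [], [S23,S14], [S45,S12]], [[S14], [S12], [S26,S24],
    [S46,S24]], [[S35,S26], [S26,S14], [S26]], [[S46,S35], [S24]], [[S46,S35]]], [[[S46,S24],
    [S56,S35,S24,S23,S12], [S35,S24,S13], [S24,S23], [S45,S24,S23,S12], [S56,S24,S13], [S56,S35,S24,S23],
    [S35,S34,S26,S13], [S56,S24,S13], [S56,S35,S24,S23]], [[S46,S35,S13], [S35,S26,S23], [S46,S45,S24,S13],
    [S35,S26,S23], [S16,S15], [S46,S45,S23,S14,S12], [S35,S16,S13], [S46,S45,S24,S13], [S46,S35,S14]],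
    [[S56,S14], [S46,S45,S24], [S35,S24,S23], [S36,S35,S23,S14], [S23,S16,S12], [S46,S23,S14,S12],
    [S24,S23,S16,S15,S12], [S46,S45,S24,S13]], [[S24,S23,S16,S12], [S24,S16], [S26,S25,S14,S13],
    [S26,S14,S13], [S35,S24,S16], [S35,S24,S16,S13], [S56,S35,S24,S12]], [[S46,S35,S24,S23], [S35,S23,S16],
    [], [S35,S16,S13], [S16,S15,S12], [S46,S35,S24,S23]], [[S46,S14], [S14,S13,S12], [S45,S14,S13],
    [S56,S23,S14,S12], [S56,S35,S14,S13]], [[S26,S14,S13], [S26,S14], [S35,S26,S23,S14], [S56,S35,S14]],
    [[S46,S35,S14,S13], [S26,S25], [S46,S35,S14,S13]], [[S16,S15], [S45]], [[S56]]], [[[S46,S35,S24],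
    [S26,S24,S23,S12], [S35,S26,S24], [S24,S23,S12], [S35,S24,S13], [S46,S35,S24,S13], [S35,S24], [S35,S24],
    [S24], [S35,S24,S23]], [[S35], [S16], [S35,S26], [S35], [S35,S16], [S35,S16], [S35,S12], [S35,S16],
    [S35]], [[S35,S23], [S26,S13], [], [S26], [S23,S16,S12], [S26,S13], [S16], [S12]], [[S46,S35,S24],
    [S35,S24], [S26,S13], [S26,S13], [S35,S26,S13], [S35,S24,S16], [S35,S24]], [[S16,S14], [S35,S23,S16],
    [S24,S16,S12], [S35,S26], [S14], [S35,S12]], [[S46,S35,S14,S12], [S14,S13], [S35,S23,S14], [S14],
    [S35,S23,S14]], [[S46,S35,S14], [S35,S14,S12], [S46,S35,S14], [S35,S14]], [[S26,S24], [S24], [S35]], [[],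
    [S35,S24]], [[]]], [[[S24,S23,S12], [S46,S35,S12], [S45,S24,S12], [S24,S23], [S45,S24,S23], [S16,S15],
    [S35,S24,S12], [S35,S24,S12], [S24,S23,S12], [S35,S34,S12]], [[S13], [S35,S26,S23], [S26,S23,S12], [S26],
    [], [S16,S13], [S16,S12], [S13], [S16]], [[S25], [S24,S23], [S34,S12], [S36,S14], [S34,S16,S13],
    [S56,S25,S14], [S56,S14], [S56,S14]], [[S45,S24,S23,S12], [S35,S24,S23], [S46,S14], [S26,S24,S13],
    [S35,S24,S16,S12], [S35,S24,S16,S13], [S35,S24,S23]], [[S26,S12], [S46,S14], [S26,S14,S12], [S26], [],
    [S35,S24,S23]], [[S14,S13], [S14,S13], [S45,S14,S13], [S14,S13], [S35,S34]], [[S45,S14,S13],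
    [S35,S14,S13], [S35,S26,S23,S14], [S35,S14,S13]], [[S16], [S12], [S35,S14,S13]], [[S35,S24], [S35,S34]],
    [[S16,S15]]], [[[S24,S23], [S26,S24,S23], [S35,S24], [S24,S23], [S15], [S16], [S35,S24], [S35,S26,S24],
    [S35,S24], [S45,S16]], [[S24], [S35,S23], [S26,S24,S12], [S24,S16], [S35,S16,S13], [S16,S14], [S26,S14],
    [S35], [S35,S16]], [[S23,S14], [S35], [S12], [S46,S14,S12], [S14,S12], [S26], [], [S46,S35,S23]],
    [[S35,S12], [S16], [S16], [S24,S13], [S35,S26,S24], [S35,S24], [S46,S35,S12]], [[S12], [S16], [S16],
    [S24,S16], [S16,S14], [S16]], [[S14,S13,S12], [S14,S13], [S25,S12], [S35,S14], [S45,S26]], [[S35], [S26],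
    [S35,S14], [S46,S35]], [[], [S26,S24], [S26]], [[S35], [S46]], [[]]], [[[S36,S24], [S56,S45,S24,S12],
    [S45,S24,S13,S12], [S24], [S35,S24,S12], [S56,S24,S13,S12], [S56,S45,S24], [S45,S26,S13],
    [S56,S24,S13,S12], [S56,S45,S24]], [[S34,S15], [S56,S13], [S24,S16,S15], [S56,S24,S23,S12], [S36,S35,S14],
    [S26,S25,S14,S12], [S56,S14,S13], [S26,S25,S14], [S46,S45,S13]], [[S45,S16], [S34,S26,S13],
    [S36,S24,S13,S12], [S36,S35,S14], [S36,S35,S14,S12], [S45,S14], [S26,S25,S14], [S36,S35,S14]], [[S24,S16],
    [S24,S16,S12], [S36,S35,S14,S12], [S56,S24], [S45,S24,S23,S16,S12], [S35,S24,S16], [S45,S16,S12]], [[],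
    [S34,S16,S15], [S26,S25,S14,S12], [S45,S14], [S24,S16,S15], [S46,S45]], [[S36,S14], [S14,S12], [S35,S14],
    [S56,S23,S14], [S56,S45,S14]], [[S26,S14], [S26,S14], [S35,S26,S14], [S45,S26]], [[S12], [S26,S25,S14],
    [S46,S45,S12]], [[S45,S16,S13], [S35,S34]], [[S56,S34]]], [[[S24,S12], [S56,S24,S15], [S35,S24,S13],
    [S24], [S35,S24], [S16], [S45,S24,S23,S12], [S45,S24,S23,S12], [S24,S12], [S45,S12]], [[S56,S25,S13],
    [S35,S16], [S56,S13], [S56,S15,S13], [S56], [S56,S23,S12], [S56,S25,S13], [S56,S13], [S15]], [[S26],
    [S26,S13], [S16,S14], [S36,S35,S14], [S14], [], [S14], [S14]], [[S36,S12], [S35,S24], [S46,S45,S14],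
    [S45,S36,S14], [S56,S45,S24,S13], [S35,S24,S16], [S56,S35,S24,S23]], [[S56,S15], [S46,S45,S14],
    [S36,S35,S14,S13], [S45,S14], [S56], [S46,S35,S24]], [[S14], [S14], [S35,S14], [S14], [S45]], [[S36],
    [S35,S14], [S35,S26,S14], [S56,S35,S14,S13]], [[S56,S25,S12], [S56,S12], [S46,S35,S14]], [[S36,S24],
    [S45]], [[S16]]], [[[S45,S36,S24], [S26,S24,S12], [S45,S26,S24], [S24,S12], [S45,S24,S13], [S45,S24,S16],
    [S45,S24,S23], [S45,S24,S23], [S24,S23], [S45,S24]], [[S13], [], [S24,S16], [S24,S16,S12], [S36,S25,S14],
    [S26,S14], [S26,S14], [S26], [S26,S14]], [[S56,S45,S34,S13], [S34,S26,S13], [S34,S16,S13], [S36],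
    [S36,S14], [S34,S12], [S34,S26,S12], [S34]], [[S35,S24,S16,S12], [S45,S24,S13], [S45,S36,S14,S12],
    [S45,S26,S14], [S45,S14], [S45,S24,S16], [S45,S24,S16]], [[S46,S13], [S34,S16], [S45,S34,S26,S12],
    [S34,S26,S12], [S34,S26], [S45,S24,S16]], [[S36,S25,S14], [S14], [S45,S23,S14], [S14,S13], [S45,S14,S12]],
    [[S35,S26,S14], [S45,S23,S14], [S45,S26,S14], [S45,S26,S14]], [[S46,S23,S12], [S34,S16,S12],
    [S45,S26,S14]], [[S34], [S45,S24]], [[S34]]], [[[S24], [S26,S24], [S45,S24], [S24], [S45,S13], [S34,S16],
    [S45,S24,S23], [S45,S26,S24,S23], [S45,S24,S23], [S35,S34,S16]], [[S46], [S35,S16,S12], [S36,S24,S15],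
    [S56,S15,S12], [S46,S25,S14,S12], [S36,S25,S14,S12], [S56,S25], [S15,S13], [S46,S35]], [[S46,S23],
    [S34,S13], [S34,S16,S12], [S36,S14,S12], [S45,S34,S12], [S34], [S34,S12], [S45,S16,S14]], [[S24],
    [S46,S15,S12], [S46,S14], [S45,S36,S14], [S56,S45,S24], [S56,S45], [S45,S16]], [[S36,S13],
    [S46,S45,S34,S12], [S45,S34], [S16,S14], [S24,S16], []], [[S14,S12], [S14], [S45,S23,S12], [S45,S14,S13],
    [S35,S34,S26]], [[S14], [S46,S25], [S56,S45,S12], [S45,S26]], [[S36,S23], [S26,S14], [S12]], [[S36,S34],
    [S36,S34]], [[S34]]], [[[S56,S24], [S56,S24,S15], [S35,S24,S13], [S56,S24,S13], [S56,S24,S15,S13],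
    [S56,S23,S14], [S56,S24], [S45,S26,S13], [S56,S24,S13], [S56,S45]], [[S46,S35,S13], [S46,S35,S34,S13],
    [S46,S45,S23,S12], [S35,S26,S23], [S35,S16], [S46,S45,S13], [S35,S16,S13,S12], [S56,S13], [S46,S35,S34]],
    [[S36,S35,S34,S13], [S26,S25], [S35,S24,S23], [S34,S16,S15,S12], [S34,S16,S15,S12], [S45,S14,S12],
    [S56,S14], [S46,S45,S24]], [[S24,S16], [S56,S35,S24,S13], [S46,S45,S14], [S24,S16,S15,S13], [S45,S16],
    [S16,S15,S14,S12], [S45,S14]], [[S35,S13], [S46,S45,S14], [S46,S45,S14], [S46,S45], [S24,S16,S15],
    [S16,S15]], [[S56,S14,S12], [S56,S23,S14], [S56,S25,S23,S14], [S56,S23,S14], [S56,S45,S12]],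
    [[S26,S14,S12], [S56,S35,S23,S14], [S26,S25,S24], [S45,S24]], [[S35,S23,S12], [S26,S25,S14], [S26,S25]],
    [[S45,S36], [S56,S24]], [[S45,S36]]], [[[S56,S24,S23], [S24,S15,S13], [S56,S35,S24], [S24], [S15,S14,S12],
    [S16,S15], [S35,S24], [S45], [S56,S35,S24], [S46,S15]], [[S35], [S56,S35,S13], [S35,S26], [S56,S35,S13],
    [S35,S16], [S35,S16], [S56,S35,S23], [S56,S35], [S35,S13]], [[S35,S23], [S26,S13], [S35,S13],
    [S46,S45,S14,S12], [S14,S12], [S14,S12], [S56], [S35,S34,S26]], [[S46,S35,S24], [S56,S35,S24,S13],
    [S16,S15], [S56,S24,S13], [S45,S12], [S56,S35,S24], [S35,S34,S12]], [[S15,S14], [S16,S15], [S56,S24],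
    [S35,S26], [S16,S15,S14], [S15]], [[S56,S14,S13,S12], [S14,S12], [S25,S24], [S56,S35,S14], [S46,S25]],
    [[S46,S35,S14], [S56,S35,S23,S14], [S56,S35,S14], [S35,S34]], [[S25,S24], [S26,S25,S24], [S25]],
    [[S56,S35], [S45]], [[S56]]], [[[S56,S24], [S24,S15,S13,S12], [S56,S45,S24,S23], [S24,S23],
    [S15,S14,S13,S12], [S34,S16,S15], [S45,S24,S23], [S35,S34], [S56,S45,S24,S23], [S36,S34,S15]], [[S13],
    [S35,S26,S23], [S24,S16], [S56,S15,S12], [S46,S25,S14], [S26,S14,S12], [S56,S25], [S24,S16], [S35,S34]],
    [[S56,S13], [S24,S23], [S24,S23], [S34,S25,S16], [S36,S14], [S45,S23,S14], [S56,S34,S12], [S45,S16]],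
    [[S35], [S46,S35,S13], [S46,S45,S14], [S46,S45,S14], [S45], [S45], [S35,S14,S13]], [[S24,S23,S15],
    [S46,S34,S12], [S26,S23,S14], [S26,S14], [S24,S16,S15], [S56]], [[S56,S14,S12], [S14,S13,S12],
    [S25,S24,S23], [S56,S45,S14,S13], [S36,S34,S25]], [[S35,S12], [S46,S35,S23,S12], [S45,S12],
    [S35,S24,S23]], [[S25,S14,S13], [S26,S25,S14], [S56,S12]], [[S36,S35,S34], [S35,S34]], [[S56,S34]]],
    [[[S24,S13], [S26,S24,S15,S13], [S56,S45,S13], [S24,S15,S13], [S45,S36,S13], [S24], [S35,S12], [S45,S12],
    [S45,S26,S12], [S45,S12]], [[S36,S13], [S35,S26,S24,S13], [S56,S15,S14,S12], [S26,S15,S14], [S25,S16],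
    [S56,S25,S24], [S25,S24,S16], [S35], [S26,S15]], [[S23], [S13], [S46,S23,S15], [S46,S23,S14], [S23,S14],
    [S25,S16,S14], [S14], [S25]], [[S36,S15,S13], [S56,S35,S13], [S46], [S16,S15], [S35,S26,S24], [S35,S24],
    [S46,S15]], [[S36,S13], [S46,S34], [S16], [S24], [S46], [S15]], [[S23,S14], [S25,S23,S14], [S45,S36,S23],
    [S45,S16], [S45]], [[S36,S25,S23,S12], [S56,S35,S23], [S35,S14], [S46,S25]], [[S36,S23], [S46,S12],
    [S25]], [[S16,S14], [S45]], [[]]]]"

section \<open>The eight certificates and their verification\<close>

fun check_cert :: "int \<Rightarrow> int \<Rightarrow> int \<Rightarrow> int \<Rightarrow> type_cert list \<Rightarrow> (int \<times> int list) list \<Rightarrow> bool" where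
  "check_cert tc ec lo hi cs q = (cert_nonneg cs \<and> sos_nonneg q \<and>
    trie_nonpos (edge_step (sos_rows q) fours edge_words
      (types_step tc ec lo hi type_tables cs
        (insert_trie (bits (Pat False False False False False False False False False False
          False False False False False)) 1 Empty))))"

text \<open>The eleven entries follow \<open>type_tables\<close>. Roots in one orbit under
  automorphisms of the type yield equivalent inequalities, so positive weights occur at one root of
  each orbit only; for the star, for example, at the first leaf and at the centre.\<close>

definition cert_A :: "type_cert list" where
  "cert_A =
    [Type_Cert 10819 0 0 0 0 0 [(5006035, [8,-5,-5,-6,-5,-6,-6,-1,-5,-6,-6,-1,-6,-1,-1,-4]), (7681461,
    [-8,6,6,4,6,4,4,1,6,4,4,1,4,1,1,4])], Type_Cert 1249548 0 0 0 0 0 [(5475875434,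
    [0,0,0,0,0,-1,1,0,0,-1,1,0,0,0,0,0]), (770307085, [5,5,5,0,-2,2,2,0,-2,2,2,0,-3,-1,-1,-4]), (284768996,
    [2,3,3,0,1,1,1,0,1,1,1,0,-1,-2,-2,-2]), (1587141, [6,12,12,-1,8,1,1,0,8,1,1,0,-5,-2,-2,-7]), (582551397,
    [0,-3,3,0,0,0,0,0,0,0,0,0,0,-2,2,0]), (68324237, [0,0,0,0,8,-3,-3,0,-8,3,3,0,0,0,0,0]), (299854556,
    [0,0,0,0,5,1,1,0,-5,-1,-1,0,0,0,0,0]), (1227592487, [8,7,7,4,3,4,4,-1,3,4,4,-1,1,1,1,-7]), (638580418,
    [0,5,-5,0,0,4,-4,0,0,4,-4,0,0,3,-3,0]), (482050, [-6,-5,-5,-1,12,12,12,0,12,12,12,0,10,1,1,3]), (44001772,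
    [0,-5,5,0,0,0,0,0,0,0,0,0,0,-3,3,0]), (4593703, [0,0,0,0,7,12,12,0,-7,-12,-12,0,0,0,0,0]), (12527650,
    [-5,-2,-2,-1,5,4,4,0,5,4,4,0,2,0,0,3]), (27227336, [12,7,7,-3,4,3,3,0,4,3,3,0,2,-3,-3,-10])], Type_Cert 0
    2071857 0 463312 0 1828 [(486189797, [-6,-12,-2,0,-2,0,4,1,0,-5,5,0,5,0,12,5]), (629978209,
    [-1,-8,1,0,1,0,6,3,1,-2,3,0,3,0,5,1]), (732863382, [-7,-7,-5,0,-5,0,-1,8,-3,0,0,0,0,0,3,6]), (23238714588,
    [0,0,-1,0,1,0,0,0,0,0,-1,0,1,0,0,0]), (1476873214, [5,0,2,1,2,1,5,0,2,-2,3,0,3,0,3,-4]), (973697607,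
    [1,-2,1,0,1,0,3,0,2,-1,2,0,2,0,2,-1]), (2086042320, [7,8,2,0,2,0,0,-3,2,3,0,0,0,0,-3,-6]), (296518944,
    [-5,-8,2,-1,2,-1,2,3,-1,-7,0,0,0,0,8,4]), (84487549527, [0,0,0,0,0,0,0,0,0,0,0,1,0,-1,0,0])], Type_Cert
    643077 0 0 0 0 11963 [(854978624, [0,-12,1,0,11,0,0,0,0,0,0,-11,0,-1,12,0]), (38400415,
    [-5,-3,-3,-2,-3,-2,-2,2,2,1,1,12,1,12,12,0]), (437057912, [0,0,0,0,0,1,-1,0,0,1,-1,-1,0,12,-11,0]),
    (412413326, [0,0,0,0,0,0,0,0,3,0,0,0,0,0,0,-1]), (207499198, [0,8,8,-1,8,-1,-1,-4,12,4,4,1,4,1,1,-7]),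
    (207342775, [12,3,3,-1,3,-1,-1,-10,6,3,3,-5,3,-5,-5,-7]), (1329638506,
    [5,3,3,0,3,0,0,-3,1,4,4,-4,4,-4,-4,-3]), (808802378, [4,0,0,-2,0,-2,-2,-4,4,5,5,1,5,1,1,-4]), (2457222983,
    [2,3,3,0,3,0,0,-2,5,0,0,0,0,0,0,-2])], Type_Cert 0 0 0 891029 0 0 [(164418917,
    [2,12,-3,4,-3,4,-2,1,-3,4,-2,1,-2,1,-11,-1])], Type_Cert 608108 0 0 0 0 0 [(161311452,
    [0,0,0,0,0,0,5,-4,0,-5,0,4,0,4,-4,0]), (147693649, [0,2,0,8,0,12,0,1,-2,0,-12,0,-8,0,-1,0]), (535970960,
    [8,5,5,2,5,2,1,0,5,1,2,0,2,0,0,-7]), (1210748027, [8,5,5,4,5,4,0,0,5,0,4,0,4,0,0,-7]), (147693088,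
    [-8,-5,-5,-3,-5,-3,-8,-3,-5,-8,-3,-3,-3,-3,-3,7]), (225400456,
    [-8,-5,-5,-5,-5,-5,-2,2,-5,-2,-5,2,-5,2,2,7])], Type_Cert 0 0 2842674 0 0 19786 [(42264427,
    [1,8,8,0,-5,-1,12,2,-5,12,-1,2,-11,-6,-6,-1]), (125015376, [11,2,2,0,12,6,3,-1,12,3,6,-1,6,-6,-6,-10]),
    (1084665043, [12,9,9,4,7,4,-3,-4,7,-3,4,-4,2,-2,-2,-11]), (494879639,
    [7,3,3,0,5,2,0,0,5,0,2,0,12,-2,-2,-6]), (342343523, [0,-4,4,0,5,-2,-8,1,-5,8,2,-1,0,-6,6,0]), (120915334,
    [9,-4,-4,0,12,5,0,-1,12,0,5,-1,-1,-1,-1,-8]), (138381365, [5,-2,-2,0,5,4,0,0,5,0,4,0,8,0,0,-4]),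
    (215546150, [0,2,2,0,-1,-1,12,-2,-1,12,-1,-2,-6,0,0,0]), (300028511,
    [-3,-8,-8,0,5,1,-12,-1,5,-12,1,-1,8,6,6,2])], Type_Cert 0 913776 0 0 0 0 [(83297952,
    [-3,3,0,2,0,2,0,-8,0,0,0,7,0,7,-4,12]), (206238721, [0,3,0,1,0,1,0,12,-2,2,-1,-1,-1,-1,-2,-7]),
    (4670718970, [0,0,0,0,0,0,0,-1,3,0,0,0,0,0,0,0]), (641719604,
    [-1,-12,0,-7,0,-7,1,-4,-1,-7,2,-1,2,-1,11,7]), (305174815, [0,12,0,7,0,7,-1,5,2,4,-3,0,-3,0,-11,-4]),
    (3782702748, [0,0,0,-2,0,2,0,0,0,0,-3,-2,3,2,0,0]), (14706004830, [0,0,1,0,-1,0,0,0,0,0,0,0,0,0,0,0]),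
    (120714292, [1,6,0,3,0,3,0,12,3,6,12,-1,12,-1,-5,-10])], Type_Cert 0 0 0 0 0 0 [(999849414,
    [0,0,0,0,0,7,8,0,0,-8,-7,0,0,0,0,0])], Type_Cert 0 0 6455 0 0 2613 [(51442141,
    [0,0,0,0,0,3,3,8,0,-3,-3,-8,0,0,0,0]), (1229923721, [0,0,0,0,-5,-4,-4,-12,5,4,4,12,0,0,0,0]), (31213528,
    [1,-6,-6,-12,0,0,0,8,0,0,0,8,9,6,6,0]), (52863878, [-1,0,0,4,0,4,4,-4,0,4,4,-4,-3,-2,-2,12]), (59406583,
    [0,1,1,6,0,4,4,2,0,4,4,2,-6,-3,-3,12])], Type_Cert 299345 0 0 0 0 0 [(141188534,
    [0,-5,-3,-12,4,-1,1,-10,4,-1,1,-10,12,8,12,0]), (168231820, [0,5,0,7,-6,-1,-7,-1,1,7,1,12,-7,-1,-10,0]),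
    (16736290, [9,2,2,-2,2,-2,-2,10,2,-2,-2,10,-2,10,10,-12]), (78915723,
    [6,4,4,-1,4,-1,-1,5,4,-1,-1,5,-1,5,5,-8])]]"

definition edge_cert_A :: "(int \<times> int list) list" where
  "edge_cert_A =
    [(303735428, [1,0,0,2,0,-1,-2,0,0,0]), (1698696326, [-2,0,0,-5,-1,2,5,1,0,0]), (54445465,
    [-7,-12,14,-2,-6,-7,-2,-6,12,-1]), (159268271, [-3,0,0,10,2,3,-10,-2,0,0]), (236505488,
    [6,0,-12,5,0,6,5,0,0,0]), (60125172, [5,0,0,8,0,-5,-8,0,0,0])]"

text \<open>In units of 10^-5 and 10^-7 this refutes \<open>t <= 3/2 e - 0.75107\<close> for
  \<open>e\<close> between 0.499999 and 0.574075, a range slightly larger than [1/2, 31/54]. The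
  loss against \<open>tau_target\<close> is 0.00107. \<open>code_simp\<close> evaluates the check by
  the simplifier, so it passes through the kernel.\<close>

lemma check_A: "check_cert (-75107) 150000 4999990 5740750 cert_A edge_cert_A"
  by code_simp

definition cert_B :: "type_cert list" where
  "cert_B =
    [Type_Cert 69 0 0 0 0 0 [(5914678, [0,-1,1,0,0,2,-1,0,0,1,-2,0,0,-5,5,0]), (67809,
    [8,2,2,1,2,1,1,1,2,1,1,1,1,1,1,-5])], Type_Cert 1453 0 0 0 15 0 [(23159639,
    [0,0,0,3,0,0,0,0,0,0,0,0,0,-1,-1,0]), (35233681, [0,1,-1,0,0,0,0,0,0,0,0,0,0,3,-3,0]), (11806239,
    [0,0,0,5,0,0,0,0,0,0,0,0,0,-2,-2,0]), (56039338, [0,0,0,0,-1,0,0,0,1,0,0,0,0,0,0,0]), (8341993,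
    [5,2,2,0,4,3,3,0,4,3,3,0,2,4,4,-4])], Type_Cert 0 15160 0 0 0 83 [(2731415,
    [2,1,0,2,0,2,12,0,-3,-3,-4,0,-4,0,8,-4]), (32253569, [-1,-3,0,0,0,0,-2,0,1,-1,-1,0,-1,0,3,1]), (92915739,
    [3,5,2,0,2,0,2,0,1,4,0,0,0,0,0,-4]), (18389413, [3,-3,1,0,1,0,0,0,2,-1,1,-3,1,-3,5,-1]), (19824205,
    [1,0,0,3,0,3,-2,0,0,0,0,0,0,0,0,0])], Type_Cert 0 0 0 0 50 0 [(33848547,
    [4,0,0,0,0,0,0,0,0,0,0,-1,0,-1,-1,0]), (11067473, [0,2,2,0,2,0,0,1,0,4,4,0,4,0,0,-5]), (10567034,
    [3,0,0,0,0,0,0,0,0,0,0,-1,0,-1,-1,0])], Type_Cert 0 0 0 15883 0 0 [(9758398,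
    [1,11,-2,9,-2,9,-3,5,-2,9,-3,5,-3,5,-12,1]), (3013405, [0,0,-5,8,5,-8,0,0,0,0,-7,6,7,-6,0,0]), (648907,
    [-1,-5,0,5,0,5,0,-2,0,5,0,-2,0,-2,1,5])], Type_Cert 3083 0 0 0 0 0 [(75060360,
    [0,0,0,1,0,0,0,0,0,0,0,0,-1,0,0,0]), (758593, [0,-8,-5,0,5,0,0,0,8,0,0,0,0,0,0,0])], Type_Cert 14096 0 0 0
    0 0 [(2990340, [3,5,5,2,0,4,0,0,0,0,4,0,-3,0,0,-5]), (9464379,
    [7,12,12,5,1,10,1,1,1,1,10,1,-8,-1,-1,-11]), (23113568, [1,1,1,-2,1,0,0,0,1,0,0,0,3,-1,-1,-1]), (8739935,
    [0,-8,8,0,1,1,0,1,-1,0,-1,-1,0,1,-1,0]), (2343055, [0,-1,1,0,0,0,12,5,0,-12,0,-5,0,12,-12,0])], Type_Cert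
    7857 11615 0 0 0 0 [(44603516, [0,-4,-1,0,-1,0,-2,0,0,-2,0,0,0,0,2,8]), (2301816,
    [0,0,7,1,-7,-1,0,0,0,0,12,1,-12,-1,0,0]), (27824019, [0,7,0,7,0,7,-1,1,0,3,0,1,0,1,-8,6]), (24843053,
    [0,0,0,-4,0,4,0,0,0,0,0,-5,0,5,0,0]), (58079622, [3,-1,0,-1,0,-1,3,0,1,1,0,0,0,0,1,-3]), (702130,
    [-2,-5,0,-4,0,-4,-1,-12,7,2,8,0,8,0,4,3])], Type_Cert 6712 0 0 0 0 0 [(22117424,
    [0,-2,2,0,5,2,4,0,-5,-4,-2,0,0,0,0,0]), (647016, [-12,-9,-9,-4,-9,6,6,9,-9,6,6,9,-4,9,9,10]), (2324142,
    [0,0,0,0,0,1,-1,1,0,1,-1,-1,0,-12,12,0]), (38180823, [0,1,1,4,-1,0,0,2,-1,0,0,2,-4,-2,-2,0])], Type_Cert 0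
    0 22977 0 0 169 [(835261, [0,-7,-7,-2,-2,-2,-2,7,-2,-2,-2,7,-2,2,2,12]), (36217241,
    [0,0,0,0,-3,-2,-2,2,3,2,2,-2,0,0,0,0]), (1840557, [0,7,7,12,-1,0,0,4,-1,0,0,4,-11,-6,-6,3]), (3901758,
    [0,12,-12,0,0,11,-11,0,0,11,-11,0,0,12,-12,0]), (602733606, [0,1,-1,0,0,1,-1,0,0,1,-1,0,0,1,-1,0]),
    (16783905, [0,5,5,8,-1,0,0,3,-1,0,0,3,-8,-4,-4,2]), (182062,
    [0,0,0,0,-7,12,12,11,7,-12,-12,-11,0,0,0,0])], Type_Cert 1096 0 0 0 6 0 [(18451649,
    [0,1,2,-1,-3,1,1,0,0,-1,-1,2,1,-1,-1,0]), (4019861, [0,-1,0,-5,1,0,4,-1,0,-4,0,-4,5,1,4,0]), (7785543,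
    [0,0,0,-1,0,-1,-1,3,0,-1,-1,3,-1,3,3,0])]]"

definition edge_cert_B :: "(int \<times> int list) list" where
  "edge_cert_B =
    []"

text \<open>Loss 0.01 against \<open>3/2 (e - 1/2)\<close>, on a range around [31/54, 11/18].
  \<open>edge_cert_B\<close> is empty: squares rooted at four vertices suffice here.\<close>

lemma check_B: "check_cert (-76000) 150000 5740700 6112000 cert_B edge_cert_B"
  by code_simp

definition cert_C :: "type_cert list" where
  "cert_C =
    [Type_Cert 0 0 0 0 855 0 [(208589579, [5,2,2,1,2,1,1,-2,2,1,1,-2,1,-2,-2,-3]), (86787672,
    [0,-4,2,-1,-2,-2,0,-4,4,0,2,2,1,-3,5,0])], Type_Cert 80611 0 0 0 13594 0 [(657811375,
    [8,7,7,6,5,3,3,0,5,3,3,0,3,-2,-2,-6]), (275487718, [-2,-1,-1,-4,5,0,0,0,5,0,0,0,5,2,2,0]), (3519263,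
    [-5,-1,-1,-9,12,-1,-1,-1,12,-1,-1,-1,12,5,5,-1]), (2392665289, [5,4,4,4,3,2,2,0,3,2,2,0,2,-1,-1,-4]),
    (432276856, [0,-5,5,0,0,-3,3,0,0,-3,3,0,0,-4,4,0])], Type_Cert 104802 1184234 0 0 560 0 [(1350419473,
    [0,-1,1,0,1,0,0,0,3,-2,0,0,0,0,1,0]), (1914215777, [-1,-5,2,-1,2,-1,2,-3,4,-1,3,-1,3,-1,5,0]),
    (1602582394, [3,2,1,0,1,0,-1,0,3,2,1,0,1,0,-1,-2]), (586664278, [11,8,4,0,4,0,-5,1,12,9,5,1,5,1,-4,-7])],
    Type_Cert 1402477 468030 0 0 0 2598 [(47563736, [1,0,0,0,0,0,0,12,6,0,0,4,0,4,4,-5]), (567241235,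
    [0,0,0,0,0,0,0,0,0,1,-1,0,0,12,-12,0])], Type_Cert 0 0 0 139788 195 0 [(908236069,
    [0,0,-1,-7,2,8,0,1,0,-1,-2,-7,2,6,0,0]), (51930565, [0,0,-5,-4,6,5,2,1,-1,-1,-12,-4,10,3,0,0]),
    (438015847, [3,-4,8,-5,8,-5,6,-2,8,-5,6,-2,6,-2,6,-4])], Type_Cert 0 0 0 0 7739 0 [(309141889,
    [12,9,9,5,9,5,0,-5,9,0,5,-5,5,-5,-5,-10]), (615346697, [0,1,1,1,-1,0,0,8,-1,0,0,8,-1,-8,-8,0]), (41003617,
    [2,-4,-4,8,-4,8,0,1,-4,0,8,1,8,1,1,0]), (776694642, [3,2,2,1,2,1,0,-1,2,0,1,-1,1,-1,-1,-2]), (4907851,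
    [12,-9,-9,-4,-9,-4,-1,5,-9,-1,-4,5,-4,5,5,5]), (28059419, [0,0,-3,1,3,-1,0,0,0,0,1,0,-1,0,0,0])],
    Type_Cert 30456 0 0 0 0 0 [(587481996, [7,4,4,0,12,2,-4,-3,12,-4,2,-3,11,0,0,-8]), (2845428,
    [-12,-11,-11,0,-3,-3,8,1,-3,8,-3,1,8,-2,-2,8]), (176757956, [0,-4,4,0,-5,-4,-1,0,5,1,4,0,0,0,0,0]),
    (103470139, [12,-4,-4,0,6,0,4,0,6,4,0,0,6,0,0,-1]), (701015892, [0,1,-1,0,-2,-4,2,3,2,-2,4,-3,0,8,-8,0]),
    (1699773700, [0,0,0,0,-1,-1,1,1,1,-1,1,-1,0,3,-3,0]), (5882333, [3,2,2,0,5,1,-2,-1,5,-2,1,-1,5,0,0,-3]),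
    (1434465, [5,3,3,0,8,1,-3,-2,8,-3,1,-2,8,0,0,-5])], Type_Cert 1257787 91670 0 0 26652 0 [(2295413982,
    [0,0,-1,-12,1,12,0,0,0,0,-7,-11,7,11,0,0]), (380072667, [0,0,0,-12,0,12,0,0,0,0,0,-11,0,11,0,0]),
    (3315176050, [0,8,1,5,1,5,0,6,0,1,-1,-1,-1,-1,-6,-5]), (413469087,
    [0,-6,0,1,0,1,0,-5,1,-4,-2,1,-2,1,1,12]), (878304644, [-1,-4,0,-4,0,-4,-3,11,-4,-6,5,-5,5,-5,8,-12])],
    Type_Cert 0 0 0 0 253 0 [(699470271, [0,0,0,0,-1,-1,-3,-3,1,3,1,3,0,2,-2,0]), (1296673161,
    [0,1,1,2,-1,0,0,1,-1,0,0,1,-2,-1,-1,0]), (1181118410, [0,2,-2,0,1,10,-3,7,-1,3,-10,-7,0,12,-12,0])],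
    Type_Cert 0 0 4562034 0 0 0 [(7731877014, [0,0,0,0,-1,-1,-1,-5,1,1,1,5,0,0,0,0]), (173732031420,
    [0,-1,1,0,0,-1,1,0,0,-1,1,0,0,-1,1,0]), (151706826, [0,5,5,6,1,2,2,-8,1,2,2,-8,-1,-4,-4,7]), (791085119,
    [0,-11,11,0,0,-11,11,0,0,-11,11,0,0,-12,12,0]), (32721588,
    [0,-3,-3,2,-1,-5,-5,12,-1,-5,-5,12,-10,1,1,-1]), (164136195, [1,7,7,9,1,3,3,-12,1,3,3,-12,-1,-6,-6,10]),
    (1540783493, [0,0,0,0,-3,-2,-2,-12,3,2,2,12,0,0,0,0]), (1685308047,
    [0,0,0,0,-5,-1,-1,-4,5,1,1,4,0,0,0,0]), (1773717441, [6,2,2,10,-1,-2,-2,8,-1,-2,-2,8,-12,-4,-4,5])],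
    Type_Cert 678113 0 0 0 7587 0 [(1422082944, [0,-1,-5,-7,4,4,-1,-3,2,1,-4,-6,7,8,1,0]), (1841162175,
    [0,-1,0,-3,0,-3,1,0,1,-1,3,0,3,0,0,0]), (874482786, [0,2,2,1,2,1,1,-3,2,1,1,-3,1,-3,-3,-1]), (885973277,
    [0,-1,-8,-10,6,6,-2,-4,3,2,-6,-9,10,12,1,0]), (335345052, [0,2,-2,2,-1,-1,8,-5,2,-8,1,3,-2,6,-4,0]),
    (21895049, [0,3,3,5,3,5,5,-12,3,5,5,-12,5,-12,-12,1]), (369290740,
    [0,1,1,2,1,2,2,-5,1,2,2,-5,2,-5,-5,0])]]"

definition edge_cert_C :: "(int \<times> int list) list" where
  "edge_cert_C =
    []"

text \<open>The loss is 0.4485 - 4/9, about 0.00406, on a range around [11/18, 35/54]. Again the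
  squares rooted at four vertices suffice.\<close>

lemma check_C: "check_cert (-44850) 100000 6111000 6481500 cert_C edge_cert_C"
  by code_simp

definition cert_D :: "type_cert list" where
  "cert_D =
    [Type_Cert 0 0 0 0 4078 0 [(91540221, [0,18,38,11,4,4,8,30,-60,-8,-4,-2,-11,-19,-9,0]), (141102609,
    [0,-38,-10,-8,-12,-8,-3,-30,60,3,8,6,8,5,19,0]), (4486860,
    [60,41,41,18,41,18,18,-31,41,18,18,-31,18,-31,-31,-31]), (2854585,
    [60,46,46,11,46,11,11,-36,46,11,11,-36,11,-36,-36,-31])], Type_Cert 15337430 0 0 0 316925 0 [(944361878,
    [0,20,-20,0,0,16,-16,0,0,16,-16,0,0,19,-19,0]), (20992761,
    [56,60,60,-3,-25,4,4,0,-25,4,4,0,-58,-54,-54,-16]), (6550331451,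
    [20,19,19,14,10,8,8,0,10,8,8,0,6,-5,-5,-15]), (1656681090, [0,-20,20,0,0,-14,14,0,0,-14,14,0,0,-19,19,0]),
    (389604961, [0,60,-60,0,0,47,-47,0,0,47,-47,0,0,56,-56,0]), (77189589,
    [-30,-29,-29,-9,-9,-6,-6,0,-9,-6,-6,0,16,17,17,15]), (224432147763, [0,0,0,0,0,0,0,1,0,0,0,-1,0,0,0,0]),
    (6954799918, [0,0,0,0,-5,-1,-1,0,5,1,1,0,0,0,0,0]), (8066312,
    [0,-6,-6,3,-60,-4,-4,0,-60,-4,-4,0,-28,-7,-7,10]), (213040484,
    [0,-7,7,0,0,-20,20,0,0,-20,20,0,0,-6,6,0])], Type_Cert 0 19124378 0 0 160100 0 [(1871380,
    [-51,-60,-26,0,-26,0,48,-10,-48,-48,6,13,6,13,48,16]), (141061181,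
    [56,18,-6,0,-6,0,-22,-1,60,40,33,0,33,0,0,-22]), (607774847, [2,4,-3,0,-3,0,-3,-60,-4,2,-4,0,-4,0,-4,0]),
    (836286479, [24,-38,27,0,27,0,17,-23,56,12,60,-14,60,-14,51,-17]), (150341151,
    [29,60,11,2,11,2,-48,-20,-13,37,-38,0,-38,0,-60,-1]), (169739938,
    [-7,-32,-4,0,-4,0,20,16,60,-4,48,0,48,0,37,-7]), (11592843,
    [-60,-27,-49,0,-49,0,30,11,-32,-35,-11,0,-11,0,14,18])], Type_Cert 847834 0 0 0 179131 0 [(204447124,
    [-12,10,10,3,10,3,3,60,-39,-4,-4,-21,-4,-21,-21,4]), (156432117,
    [-1,0,0,0,0,0,0,5,29,60,60,0,60,0,0,-44]), (36528183822, [1,0,0,2,0,2,2,2,-10,-6,-6,1,-6,1,1,7]),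
    (921367722, [8,0,0,3,0,3,3,5,-7,-5,-5,-3,-5,-3,-3,0]), (2347205649,
    [-8,4,4,1,4,1,1,-4,5,0,0,-3,0,-3,-3,1]), (434594002, [0,0,0,-5,0,17,-12,0,0,0,0,-17,0,60,-43,0]),
    (719574151, [20,0,0,0,0,0,0,0,1,-1,-1,-9,-1,-9,-9,0]), (2635649210,
    [20,2,2,-4,2,-4,-4,-1,6,18,18,-12,18,-12,-12,-19]), (1391404004, [0,0,0,0,0,0,0,-8,5,-5,-5,0,-5,0,0,7])],
    Type_Cert 0 0 0 267451 0 0 [], Type_Cert 0 0 0 0 200385 0 [(43221761,
    [-55,-60,-60,-26,-60,-26,-39,30,-60,-39,-26,30,-26,30,30,60]), (367311851,
    [0,-2,2,0,2,0,60,17,-2,-60,0,-17,0,-17,17,0]), (180445008,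
    [-18,-20,-20,-9,-20,-9,-13,10,-20,-13,-9,10,-9,10,10,20]), (909174739,
    [0,23,24,60,-24,-2,0,15,-23,0,2,16,-60,-16,-15,0]), (312059200,
    [0,-22,-11,-36,11,-12,0,-60,22,0,12,-30,36,30,60,0]), (593003573,
    [60,40,40,23,40,23,10,-19,40,10,23,-19,23,-19,-19,-47]), (474995024,
    [0,-5,1,0,-1,0,0,-20,5,0,0,5,0,-5,20,0]), (368241533, [60,17,17,8,17,8,3,5,17,3,8,5,8,5,5,-19]),
    (249952385, [0,5,54,55,-54,-47,0,5,-5,0,47,60,-55,-60,-5,0]), (1190169573,
    [7,8,8,3,8,3,1,0,8,1,3,0,3,0,0,-7])], Type_Cert 0 0 0 0 0 0 [(155934451,
    [0,1,-1,0,-1,-1,-46,60,1,46,1,-60,0,-2,2,0]), (1650214431,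
    [37,5,5,-17,54,9,-17,-9,54,-17,9,-9,60,1,1,-23]), (1119206059,
    [0,-8,8,0,-18,-20,-20,2,18,20,20,-2,0,5,-5,0]), (271084943628, [0,0,0,0,0,0,0,-1,0,0,0,1,0,0,0,0]),
    (7971581, [12,-2,-2,0,60,6,6,0,60,6,6,0,56,5,5,-17]), (929752039,
    [60,-1,-1,0,25,4,4,0,25,4,4,0,30,4,4,-10]), (194937919214, [0,0,0,0,0,0,-1,2,0,-1,0,2,0,0,0,0]),
    (15155910, [0,-19,19,0,-60,-52,-42,21,60,42,52,-21,0,35,-35,0]), (5761419752,
    [0,2,-2,0,3,5,20,19,-3,-20,-5,-19,0,-1,1,0])], Type_Cert 23081001 1140844 0 0 0 0 [(37508462,
    [0,-1,0,1,0,1,0,20,-2,-7,1,-3,1,-3,2,-4]), (56352748, [0,20,0,6,0,6,-2,-60,-24,51,-17,17,-17,17,-24,16]),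
    (755324454, [0,29,0,14,0,14,-22,-1,36,21,6,2,6,2,-18,-60]), (75282435,
    [0,0,-3,-60,3,60,0,0,0,0,-46,-59,46,59,0,0]), (1264232260637, [0,0,1,0,-1,0,0,0,0,0,0,0,0,0,0,0]),
    (685322353, [0,17,0,9,0,9,-1,49,21,5,13,-4,13,-4,-7,-60]), (211854542,
    [0,0,0,-60,0,60,0,0,0,0,-34,-59,34,59,0,0]), (281254269, [0,25,0,9,0,9,0,29,7,36,9,9,9,9,-20,-60]),
    (120865220, [0,-49,0,-18,0,-18,3,-7,-10,-52,18,-12,18,-12,34,60])], Type_Cert 0 0 0 0 0 0 [(390876337,
    [0,0,0,0,0,-58,-60,-7,0,60,58,7,0,0,0,0]), (5230183, [0,-41,-41,-60,41,0,0,-28,41,0,0,-28,60,28,28,0]),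
    (4197507693, [0,0,0,0,0,-8,-8,-1,0,8,8,1,0,0,0,0])], Type_Cert 0 0 33270242 0 0 0 [(6218095329,
    [0,0,0,0,6,1,1,20,-6,-1,-1,-20,0,0,0,0]), (226799478,
    [60,10,10,42,1,-10,-10,56,1,-10,-10,56,-47,-20,-20,-37]), (14700223,
    [5,-18,-18,-60,0,11,11,-2,0,11,11,-2,58,29,29,-21]), (262361836,
    [25,12,12,28,6,-3,-3,-22,6,-3,-3,-22,-23,-14,-14,60]), (2037923437,
    [0,0,0,0,-17,-1,-1,-20,17,1,1,20,0,0,0,0]), (41775065, [0,43,-43,0,0,54,-54,0,0,54,-54,0,0,60,-60,0])],
    Type_Cert 6930820 0 0 0 83187 0 [(44810510, [0,-47,-19,60,51,-4,-29,17,15,29,4,58,-60,-22,-53,0]),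
    (101104739, [13,-3,-3,-5,-3,-5,-5,30,-3,-5,-5,30,-5,30,30,-6]), (37496204,
    [5,13,13,-3,13,-3,-3,20,13,-3,-3,20,-3,20,20,-10]), (24155809,
    [6,14,14,-4,14,-4,-4,20,14,-4,-4,20,-4,20,20,-5]), (92162537,
    [0,-7,6,1,-6,20,-1,16,6,1,-20,-15,-1,16,-17,0])]]"

definition edge_cert_D :: "(int \<times> int list) list" where
  "edge_cert_D =
    [(29913493, [9,64,-36,60,36,9,60,36,-60,-12]), (783796, [-10,38,42,-120,20,-10,-120,20,-55,9]), (13467363,
    [5,40,-22,53,18,5,53,18,-30,-8]), (48499151, [3,0,0,-88,-120,-3,88,120,0,0]), (250593635,
    [-1,-54,2,20,-30,-1,20,-30,60,3]), (430549646, [-2,1,0,43,60,2,-43,-59,-1,0])]"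

text \<open>The loss 0.44465 - 4/9 is about 0.00020556, just below the 0.0002057 to be shown on
  [35/54, 2/3]. The lower bound 6481480 is 10^7 times 35/54, rounded down to a number strictly below
  it.\<close>

lemma check_D: "check_cert (-44465) 100000 6481480 6666700 cert_D edge_cert_D"
  by code_simp

definition cert_E :: "type_cert list" where
  "cert_E =
    [Type_Cert 41999 0 0 0 0 0 [(3073227019, [0,0,0,0,0,0,0,-5,0,0,0,-5,0,12,-2,0]), (518757059,
    [-3,1,1,0,1,0,0,0,1,0,0,0,0,0,0,1])], Type_Cert 0 0 0 0 0 0 [(14974478225,
    [0,0,0,0,0,-4,4,0,0,-4,4,0,0,-5,5,0]), (57630141, [-12,11,11,-6,7,0,0,0,7,0,0,0,2,0,0,4]), (37313323571,
    [0,-1,1,0,0,0,0,0,0,0,0,0,0,0,0,0]), (81162114, [-3,0,0,2,1,0,0,0,1,0,0,0,-1,-1,-1,1]), (887546047,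
    [-5,2,2,3,-1,1,1,0,-1,1,1,0,-1,-5,-5,2]), (120354937, [-8,4,4,5,-2,2,2,0,-2,2,2,0,-2,-7,-7,3]),
    (615782119, [2,0,0,1,3,0,0,0,3,0,0,0,-1,0,0,-1]), (20147740240, [0,0,0,0,-1,0,0,0,1,0,0,0,0,0,0,0]),
    (3387470201, [0,1,1,1,-1,0,0,12,-1,0,0,12,-2,0,0,0])], Type_Cert 0 0 0 498764 0 0 [(1139137404,
    [-1,-7,0,0,0,0,-4,12,0,0,0,0,0,0,-2,0]), (530889831042, [0,0,0,0,0,0,0,0,0,0,0,1,0,-1,0,0]), (1027169926,
    [1,12,0,0,0,0,6,9,-9,0,1,0,1,0,0,-1]), (4039347674, [0,8,0,0,0,0,0,0,0,0,-3,0,-3,0,-6,0]), (7590977075,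
    [5,3,1,0,1,0,4,4,0,1,-1,-1,-1,-1,2,-2]), (97498554452, [0,0,0,0,0,0,0,0,0,0,-1,0,1,0,0,0]), (60576654961,
    [0,0,0,0,0,0,0,0,0,0,0,3,0,3,-1,0])], Type_Cert 33169 0 0 0 0 787 [(289674969,
    [-5,-2,-2,5,-2,5,5,-3,3,-1,-1,0,-1,0,0,1]), (411112606, [0,-12,-12,0,-12,0,0,0,0,0,0,7,0,7,7,0]),
    (55112158, [-1,0,0,2,0,2,2,12,-10,0,0,0,0,0,0,1]), (2885344956, [0,-9,4,0,6,0,0,0,0,0,0,-7,0,-5,12,0]),
    (182032425, [-5,1,1,7,1,7,7,8,-8,0,0,-1,0,-1,-1,2]), (537870841, [0,0,0,1,0,1,1,3,-3,0,0,0,0,0,0,0])],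
    Type_Cert 24846 0 0 2545416 0 0 [(2029761743, [-2,3,0,2,0,2,1,2,0,2,1,2,1,2,-3,0]), (715634942,
    [3,10,-1,10,-1,10,-2,5,-1,10,-2,5,-2,5,-12,1]), (859484132, [0,0,0,-3,0,-5,0,-2,0,8,0,1,0,1,0,0]),
    (14999200, [-3,-6,0,8,0,8,-1,9,0,8,-1,9,-1,9,-11,12])], Type_Cert 167054 0 0 0 0 799 [(3469206705,
    [0,1,-1,0,1,0,0,6,-1,0,0,-8,0,8,-6,0]), (124575487042, [0,0,0,0,0,0,0,1,0,0,0,0,0,0,-1,0]), (58354327,
    [5,12,12,0,12,0,-6,0,12,-6,0,0,0,0,0,-2])], Type_Cert 0 0 0 0 5640 0 [(13689110719,
    [0,0,0,0,-2,3,0,0,-2,0,3,0,0,0,0,-1]), (79065896, [0,0,0,0,12,-7,-1,0,-12,1,7,0,0,-1,1,0]), (1198478613,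
    [0,0,0,0,0,4,0,-8,0,0,-4,8,0,-5,5,0]), (9579141736, [0,0,0,0,-2,-1,3,0,-2,3,-1,0,0,0,0,0]), (14713576490,
    [0,-3,3,0,1,0,3,0,-1,-3,0,0,0,0,0,0]), (2595780740, [0,0,0,2,0,3,0,3,0,0,3,3,5,4,4,-2]), (323745563,
    [0,0,0,0,2,-1,11,0,-2,-11,1,0,0,12,-12,0]), (782670389, [1,4,4,6,-1,7,3,3,-1,3,7,3,-12,1,1,-1])],
    Type_Cert 1381146 1642262 0 0 0 0 [(79726848, [0,-6,0,-8,0,-8,-1,-1,1,2,0,2,0,2,12,-5]), (40110135,
    [0,1,0,0,0,0,0,5,0,4,0,1,0,1,3,-4]), (95003528, [0,0,-6,-10,6,10,0,0,0,0,-12,-9,12,9,0,0]), (2334913946,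
    [0,8,-1,6,-1,6,2,-1,2,3,1,1,1,1,6,-12]), (3536350183, [0,0,-2,-3,2,3,0,0,0,0,-3,-2,3,2,0,0]), (6880472373,
    [4,0,0,0,0,0,-1,2,-5,-2,-2,0,-2,0,0,0]), (1746643324, [0,0,-4,-7,4,7,0,0,0,0,-8,-6,8,6,0,0]), (5472628559,
    [0,-2,0,-2,0,-2,0,0,0,1,0,0,0,0,3,-1]), (6608863111, [0,3,0,3,0,3,1,-1,1,1,0,1,0,1,3,-5]), (958088983,
    [1,0,0,1,0,1,0,-2,3,1,3,-1,3,-1,0,0]), (32566369, [0,12,-1,10,-1,10,1,1,0,3,1,10,1,10,-8,-3]),
    (2009599750, [0,-3,0,-3,0,-3,0,-1,1,1,0,1,0,1,5,-2])], Type_Cert 1399507 0 0 0 0 0 [(42733250280,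
    [0,0,0,0,0,1,-1,0,0,-1,1,0,0,0,0,0]), (102543733, [-11,-2,-2,-6,-2,-4,-4,12,-2,-4,-4,12,-6,12,12,7]),
    (37363321989, [0,-2,2,0,3,0,3,0,-3,-3,0,0,0,0,0,0])], Type_Cert 0 0 1525277 0 0 120 [(1545874172,
    [0,0,0,0,-1,3,3,-3,1,-3,-3,3,0,0,0,0]), (3656158241, [0,-3,3,0,0,-1,1,0,0,-1,1,0,0,-3,3,0]), (80198616,
    [0,-7,7,0,0,-8,8,0,0,-8,8,0,0,-6,6,0]), (66338235, [0,0,0,0,4,3,3,-8,-4,-3,-3,8,0,0,0,0]), (5509830528,
    [0,0,0,0,0,-1,-1,-3,0,1,1,3,0,0,0,0]), (1061682402, [0,1,1,4,0,0,0,2,0,0,0,2,-4,-2,-2,0])], Type_Cert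
    740560 0 0 0 0 9875 []]"

definition edge_cert_E :: "(int \<times> int list) list" where
  "edge_cert_E =
    [(54234639, [-4,10,-8,24,6,-4,24,6,1,-8]), (1115718930, [1,-4,7,-1,-4,1,-1,-4,-1,4]), (1053706514,
    [-4,0,0,-5,-2,4,5,2,0,0]), (2016576143, [6,0,0,9,4,-6,-9,-4,0,0]), (165787232, [-5,6,-6,6,6,-5,6,6,4,-8]),
    (262316579, [0,2,-6,-8,2,0,-8,2,4,-5])]"

text \<open>On this piece \<open>tau_target\<close> is \<open>2 e - 10/9\<close>; the loss 1.11234 -
  10/9 is about 0.001229, on a range around [2/3, 25/36].\<close>

lemma check_E: "check_cert (-111234) 200000 6666660 6944500 cert_E edge_cert_E"
  by code_simp

definition cert_F :: "type_cert list" where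
  "cert_F =
    [Type_Cert 7 0 0 0 0 0 [(329185717, [0,-1,0,-1,-4,-3,-2,-8,5,2,3,6,1,0,2,0]), (316274338,
    [0,-4,-8,-10,0,-3,-6,-5,12,6,3,0,10,3,2,0]), (478288793, [0,-8,-1,-8,2,-5,1,-6,7,-1,5,-2,8,1,7,0])],
    Type_Cert 854131 0 0 0 0 0 [(14148758, [12,11,11,2,11,3,3,0,11,3,3,0,5,-2,-2,-5]), (585223703,
    [10,3,3,-4,12,7,7,1,12,7,7,1,11,2,2,-4]), (1106072562, [5,4,4,1,2,2,2,4,2,2,2,4,2,1,1,-2]), (85849918961,
    [0,0,0,0,0,0,0,1,0,0,0,-1,0,0,0,0]), (49595540, [12,12,12,-1,9,9,9,1,9,9,9,1,7,12,12,-5]), (1883172914,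
    [0,-5,5,0,0,-4,4,0,0,-4,4,0,0,0,0,0]), (390020464, [0,-5,5,0,0,-2,2,0,0,-2,2,0,0,-2,2,0]), (7111209975,
    [0,3,-3,0,0,2,-2,0,0,2,-2,0,0,4,-4,0])], Type_Cert 0 1584928 0 1325675 0 22892 [(145208372,
    [0,0,0,-3,0,3,0,0,0,0,-4,-5,4,5,0,0]), (32494213, [-12,-3,-3,-7,-3,-7,-6,0,-8,0,-4,0,-4,0,1,4]),
    (3049384525, [3,1,2,0,2,0,-2,1,3,2,0,0,0,0,-2,-1]), (325920526, [0,-12,7,0,7,0,11,7,4,-1,3,0,3,0,8,0]),
    (1650709000, [6,12,4,1,4,1,3,3,3,6,0,0,0,0,1,-3]), (12538035026, [0,0,-1,0,1,0,0,0,0,0,0,0,0,0,0,0]),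
    (126735368, [0,1,-1,1,-1,1,-1,-2,0,-4,0,-1,0,-1,5,0]), (105664647,
    [11,8,12,6,12,6,12,0,7,1,3,0,3,0,9,-5]), (4531986959, [0,0,0,-2,0,2,0,0,0,0,-2,-3,2,3,0,0]), (3593749619,
    [0,0,0,0,0,0,0,5,0,0,1,0,1,0,-2,0]), (4314462753, [3,2,1,0,1,0,-1,0,1,0,-1,0,-1,0,-1,-1]), (5461181905,
    [2,-3,3,0,3,0,6,-1,3,2,2,0,2,0,8,-1]), (126679234, [0,1,0,6,0,6,1,8,-2,1,0,2,0,2,-12,0]), (627407275,
    [8,5,1,3,1,3,7,-4,1,-3,1,1,1,1,1,-3]), (13209281454, [0,0,0,0,0,0,0,0,0,0,0,1,0,-1,0,0]), (1064237970,
    [0,0,-4,-2,4,2,0,0,0,0,-4,-5,4,5,0,0])], Type_Cert 116329 586144 0 0 0 8457 [(3069663810,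
    [0,0,0,0,0,0,0,0,0,-2,-1,-8,3,2,6,0]), (357033495, [-3,-10,-10,0,-10,0,0,0,3,0,0,12,0,12,12,-1]),
    (777585097, [0,-3,1,0,2,0,0,0,0,0,0,-6,0,-2,8,0]), (679224623, [-8,7,7,0,7,0,0,2,-2,1,1,0,1,0,0,0]),
    (3117216059, [-3,2,2,-1,2,-1,-1,1,0,1,1,0,1,0,0,0]), (804530109, [0,-7,-5,0,12,0,0,0,0,1,1,2,-2,-1,-1,0]),
    (99929292, [7,-1,-1,0,-1,0,0,1,-8,-1,-1,0,-1,0,0,3]), (1263635022, [3,0,0,0,0,0,0,0,0,0,0,-1,0,-1,-1,0]),
    (313132477, [0,0,0,0,0,0,0,0,0,4,-5,-3,1,12,-9,0]), (1345368617, [3,0,0,0,0,0,0,-2,1,0,0,-1,0,-1,-1,0]),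
    (89835940, [1,-7,-7,-12,-7,-12,-12,-2,-1,-4,-4,12,-4,12,12,4])], Type_Cert 68626 0 0 905391 0 0 [],
    Type_Cert 21003 0 0 0 0 0 [(699951270, [0,0,0,0,0,0,0,5,0,0,0,-12,0,12,-5,0]), (4525123,
    [0,-2,2,0,2,0,5,0,-2,-5,0,0,0,0,0,0]), (124286806, [0,11,-11,0,-11,0,-12,0,11,12,0,0,0,0,0,0]), (91947708,
    [0,8,9,-12,-9,1,0,0,-8,0,-1,0,12,0,0,0])], Type_Cert 0 0 1666547 0 0 18014 [(43410364,
    [0,8,-8,0,-12,11,0,3,12,0,-11,-3,0,-2,2,0]), (81955625, [0,5,5,1,2,6,-12,-10,2,-12,6,-10,-4,12,12,-1]),
    (1624755726, [5,4,4,0,8,3,0,0,8,0,3,0,-2,0,0,-2]), (1825868659, [0,5,-5,0,0,0,-2,-2,0,2,0,2,0,5,-5,0]),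
    (123838890, [0,-5,-5,0,2,11,-12,3,2,-12,11,3,0,-5,-5,0]), (277898483,
    [0,-9,9,0,6,4,7,12,-6,-7,-4,-12,0,0,0,0]), (427521324, [0,-2,2,0,0,-5,-2,2,0,2,5,-2,0,-3,3,0]),
    (188508153, [9,10,10,0,3,3,0,-1,3,0,3,-1,12,0,0,-4]), (809719919,
    [0,-1,-1,0,0,3,-3,1,0,-3,3,1,0,-1,-1,0]), (1137768708, [0,3,-3,0,-5,-4,-7,2,5,7,4,-2,0,8,-8,0]),
    (7648839501, [0,-2,2,0,1,1,2,3,-1,-2,-1,-3,0,0,0,0]), (731679125,
    [0,12,12,6,-5,1,3,1,-5,3,1,1,-4,-3,-3,-1]), (1126753357, [0,0,0,0,0,-1,-3,2,0,3,1,-2,0,0,0,0])], Type_Cert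
    184118 1499395 0 0 0 0 [(20255628146, [0,0,3,0,-3,0,0,0,0,0,2,0,-2,0,0,0]), (489514992,
    [0,3,0,2,0,2,0,5,0,-1,0,1,0,1,0,-2]), (99047946, [2,4,0,3,0,3,0,-2,0,4,0,3,0,3,12,-11]), (316594423,
    [-1,-6,0,-3,0,-3,0,9,-1,-12,0,-6,0,-6,-5,8]), (2718061143, [0,3,0,1,0,1,0,-1,0,3,0,0,0,0,0,-2]),
    (560991238, [0,5,0,3,0,3,0,2,0,4,0,0,0,0,-8,2]), (18781774, [0,12,0,5,0,5,0,0,0,1,0,7,0,7,4,-10]),
    (136083117, [0,5,0,3,0,3,0,1,0,8,0,8,0,8,-7,1]), (178963653, [0,0,-12,10,12,-10,0,0,0,0,-1,8,1,-8,0,0]),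
    (2358446576, [1,-1,-1,-1,-1,-1,2,-1,0,2,0,1,0,1,5,-3]), (2868651459,
    [0,0,0,-4,0,4,0,0,0,0,-5,-3,5,3,0,0]), (3604247, [0,0,0,-7,0,7,0,0,0,0,-8,-5,8,5,0,0]), (23033646739,
    [0,3,0,2,0,2,1,0,1,1,0,0,0,0,0,-2]), (584014902, [-1,3,0,3,0,3,0,-3,0,5,0,4,0,4,-5,1]), (103113300,
    [5,2,0,1,0,1,0,3,0,2,0,7,0,7,12,-10])], Type_Cert 641109 0 0 0 0 0 [(8442156177,
    [0,-1,1,0,2,1,3,0,-2,-3,-1,0,0,0,0,0]), (2115737793, [0,-5,5,0,-1,0,0,0,1,0,0,0,0,0,0,0]), (5783767506,
    [0,0,0,0,0,-1,1,0,0,1,-1,0,0,0,0,0])], Type_Cert 0 0 310782 0 0 0 [(2058665226,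
    [0,0,0,0,0,-1,-1,-3,0,1,1,3,0,0,0,0]), (96782266, [0,0,0,0,-12,-7,-7,-12,12,7,7,12,0,0,0,0]), (439585732,
    [0,0,0,0,-1,-3,-3,-5,1,3,3,5,0,0,0,0])], Type_Cert 235814 0 0 0 0 4224 []]"

definition edge_cert_F :: "(int \<times> int list) list" where
  "edge_cert_F =
    [(96950016, [-4,8,-14,10,8,-4,10,8,3,-8]), (1311008, [0,6,-10,-2,4,0,-2,4,5,-8]), (55045850,
    [3,12,-18,4,6,3,4,6,5,-12]), (263140490, [2,4,2,-10,0,2,-10,0,-2,-1]), (1120464139,
    [-6,0,0,-5,-1,6,5,1,0,0]), (44971134, [-2,0,0,-2,-1,2,2,1,0,0]), (672084375, [4,4,-4,-4,1,4,-4,1,-4,0])]"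

text \<open>Same slope as for the preceding certificate; the loss 1.11645 - 10/9 is about 0.005339,
  on a range around [25/36, 13/18].\<close>

lemma check_F: "check_cert (-111645) 200000 6944440 7222300 cert_F edge_cert_F"
  by code_simp

definition cert_G :: "type_cert list" where
  "cert_G =
    [Type_Cert 0 0 0 0 2182 0 [(1045070350, [0,-1,-2,-2,-5,-4,-5,-7,8,5,4,5,2,2,1,0]), (4517807584,
    [0,-2,-2,-3,2,0,0,-2,2,0,0,-2,3,2,2,0]), (246168330, [8,5,5,1,5,1,1,-2,5,1,1,-2,1,-2,-2,-3]), (339688255,
    [0,6,-3,2,-3,2,-4,-1,0,4,-2,4,-2,4,-8,0])], Type_Cert 0 0 0 0 21537 0 [(1889358841,
    [0,-2,2,0,0,-1,1,0,0,-1,1,0,0,-3,3,0]), (1207743155, [0,0,0,-5,0,0,0,2,0,0,0,2,1,-1,-1,0]), (5134947489,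
    [0,3,-3,0,0,1,-1,0,0,1,-1,0,0,1,-1,0]), (5012101701, [0,0,0,0,0,-1,1,0,0,-1,1,0,0,-5,5,0]), (801243330,
    [0,0,0,-8,0,0,0,4,0,0,0,4,1,-2,-2,0]), (2764519199, [8,4,4,-3,5,1,1,0,5,1,1,0,2,1,1,-3]), (33694906376,
    [0,0,0,0,-1,-1,-1,-5,1,1,1,5,0,0,0,0]), (3112010596, [0,5,-5,0,0,2,-2,0,0,2,-2,0,0,1,-1,0]), (161949697,
    [5,3,3,-11,12,3,3,-2,12,3,3,-2,12,-1,-1,-3]), (5301072797, [0,0,0,0,-1,-1,-1,-8,1,1,1,8,0,0,0,0])],
    Type_Cert 0 0 0 0 0 0 [(354587947, [0,-7,-11,0,-11,0,-10,-1,1,10,12,0,12,0,-5,1]), (606770203,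
    [0,0,0,0,0,0,-3,-2,3,0,0,0,0,0,0,0]), (82258130, [-5,12,-8,0,-8,0,10,-1,-5,-1,0,0,0,0,5,1]), (253629319,
    [1,-1,-1,0,-1,0,-5,0,3,-12,5,0,5,0,4,0]), (8925332083, [2,3,2,0,2,0,2,1,1,1,1,0,1,0,0,-1]), (10774985044,
    [3,0,1,0,1,0,-1,-2,3,0,0,0,0,0,0,-1]), (122999436, [5,6,6,0,6,0,12,0,6,5,8,0,8,0,7,-3]), (7444923296,
    [0,0,0,4,0,-4,0,0,0,0,1,8,-1,-8,0,0]), (93651194291, [0,0,0,-3,0,3,0,0,0,0,-1,0,1,0,0,0]), (325512328,
    [5,-9,7,-8,7,-8,6,11,12,10,2,-1,2,-1,-2,-2]), (146878, [-6,10,0,2,0,2,8,0,-12,1,2,0,2,0,1,1]),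
    (8604938311, [0,0,0,2,0,-2,0,0,0,0,1,5,-1,-5,0,0])], Type_Cert 0 0 0 0 0 387 [(2074248052,
    [5,-1,-1,-6,-1,-6,-6,-10,9,3,3,12,3,12,12,-1]), (3263357136, [0,0,0,1,0,-1,0,0,0,1,3,8,-4,-6,-2,0]),
    (580865430, [0,0,0,-5,0,-3,8,0,0,-3,1,0,2,0,0,0]), (4802638691, [0,0,0,1,0,-1,0,0,0,1,2,5,-3,-4,-1,0]),
    (6532979061, [3,0,0,2,0,2,2,0,-3,-1,-1,0,-1,0,0,1]), (2842658884, [0,3,-3,0,0,2,-2,0,0,0,0,0,0,-1,1,0]),
    (647953597, [1,0,0,0,0,0,0,3,-2,0,0,0,0,0,0,0]), (512412270, [-8,0,0,-1,0,-1,-1,-1,4,4,4,0,4,0,0,0]),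
    (533922000, [12,1,1,2,1,2,2,10,-6,0,0,1,0,1,1,-2])], Type_Cert 0 0 0 0 7915 0 [(1533232850,
    [0,0,0,-12,0,3,-3,-7,0,9,-1,-2,4,9,0,0]), (9890813719, [0,0,-4,0,0,0,-5,0,4,0,0,0,5,0,0,0])], Type_Cert 0
    0 0 0 0 0 [(113696009, [12,10,10,-1,10,-1,4,0,10,4,-1,0,-1,0,0,-5]), (318004077,
    [12,6,6,0,6,0,5,0,6,5,0,0,0,0,0,-4]), (386541172, [0,-11,0,1,0,1,0,-12,11,0,-1,0,-1,0,12,0]), (2349424023,
    [0,-1,-1,5,1,1,0,-1,1,0,-1,-1,-5,1,1,0]), (760753786, [12,5,5,-1,5,-1,1,6,5,1,-1,6,-1,6,6,-4]),
    (2219538372, [0,1,-1,0,-1,0,-8,-2,1,8,0,2,0,2,-2,0]), (3607384573, [3,1,1,1,1,1,1,0,1,1,1,0,1,0,0,-1]),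
    (9749055887, [0,0,0,0,0,1,0,3,0,0,-1,-5,0,5,-3,0]), (9733607481, [0,0,0,-1,0,1,0,0,0,0,1,0,-1,0,0,0])],
    Type_Cert 0 0 0 0 0 0 [(1129232003, [0,-1,-1,0,1,2,-7,8,1,-7,2,8,-1,-7,-7,0]), (840272955,
    [0,-3,3,0,2,0,1,0,-2,-1,0,0,0,0,0,0]), (1946402084, [4,3,3,0,3,5,0,0,3,0,5,0,8,0,0,-2]), (2406850072,
    [3,4,4,0,5,4,0,0,5,0,4,0,-4,1,1,-2]), (220525969976, [0,0,0,0,0,0,1,1,0,-1,0,-1,0,0,0,0]), (4154830203,
    [5,4,4,0,5,-1,-1,-1,5,-1,-1,-1,5,0,0,-2]), (547880467, [0,1,1,0,-2,8,0,2,-2,0,8,2,3,3,3,-1]), (1621721790,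
    [12,1,1,0,4,0,4,3,4,4,0,3,0,0,0,-4]), (15635477904, [0,1,-1,0,-3,0,0,0,3,0,0,0,0,0,0,0]), (5601532763,
    [0,1,-1,0,-1,-3,-3,-1,1,3,3,1,0,-2,2,0]), (22910097768, [0,0,0,0,0,0,0,-3,0,0,0,3,0,-2,2,0]), (234830122,
    [5,6,6,0,8,7,-1,0,8,-1,7,0,-6,1,1,-3]), (2704584591, [0,-1,1,0,1,0,-3,5,-1,3,0,-5,0,0,0,0]), (10075892849,
    [-1,-3,-3,0,0,-2,0,-2,0,0,-2,-2,-2,-1,-1,1]), (195600183, [12,1,1,0,3,-5,-1,6,3,-1,-5,6,6,7,7,-4]),
    (2068811411, [-1,1,1,0,-1,1,-3,12,-1,-3,1,12,3,-9,-9,0])], Type_Cert 4739406 132105 0 0 30447 0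
    [(3502008063, [0,0,4,-1,-4,1,0,0,0,0,8,-1,-8,1,0,0]), (383267154, [0,8,0,4,0,4,1,2,-3,1,0,-1,0,-1,-7,0]),
    (1710924848, [0,5,0,2,0,2,0,4,0,-1,0,-4,0,-4,-4,0]), (81016361937, [0,0,0,0,0,0,3,0,-1,0,-1,0,-1,0,0,0]),
    (1814530378, [0,4,0,2,0,2,-1,3,-1,1,0,-2,0,-2,-8,3]), (2586749444, [0,8,0,4,0,4,0,-2,0,6,1,3,1,3,4,-8]),
    (746969542, [0,8,0,3,0,3,0,0,1,5,0,-2,0,-2,4,-8]), (2136694234,
    [0,-4,0,-3,0,-3,-2,12,-2,-6,0,-3,0,-3,-7,8]), (1136024714, [0,0,0,-8,0,8,0,0,0,0,-1,-7,1,7,0,0]),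
    (571933414, [0,-12,0,-5,0,-5,0,-9,0,-8,0,-5,0,-5,-5,11]), (1207474970,
    [3,0,0,0,0,0,0,0,-1,0,0,0,0,0,0,0]), (75849668387, [0,0,-3,0,-3,0,-2,0,1,0,1,0,1,0,0,0]), (9398147748,
    [0,0,-5,0,-5,0,-3,0,2,0,1,0,1,0,0,0]), (827985836, [0,0,0,0,0,0,1,4,0,-1,0,-2,0,-2,12,-8]), (11689498113,
    [0,0,0,-6,0,6,0,0,0,0,0,-5,0,5,0,0]), (5930353200, [0,3,0,1,0,1,1,2,0,0,0,0,0,0,-1,-1]), (8246130322,
    [-2,0,0,0,0,0,0,0,5,0,-2,0,-2,0,0,0]), (368377903868, [0,0,1,0,-1,0,0,0,0,0,0,0,0,0,0,0])], Type_Cert 0 0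
    0 0 10645 0 [(624422593, [0,0,0,0,0,11,12,0,0,-12,-11,0,0,0,0,0]), (237596528,
    [0,-1,-1,-12,1,0,0,-5,1,0,0,-5,12,5,5,0])], Type_Cert 0 0 3366670 0 0 0 [(7609699892,
    [0,0,0,0,1,2,2,3,-1,-2,-2,-3,0,0,0,0]), (296503464291, [0,0,0,0,1,0,0,0,-1,0,0,0,0,0,0,0]), (12860827044,
    [0,2,-2,0,0,1,-1,0,0,1,-1,0,0,2,-2,0])], Type_Cert 1761819 0 0 0 0 0 []]"

definition edge_cert_G :: "(int \<times> int list) list" where
  "edge_cert_G =
    [(463283457, [-3,0,0,-2,0,3,2,0,0,0]), (47190352, [-5,-4,-12,24,4,-5,24,4,6,-3]), (961529145,
    [0,6,-5,3,3,0,3,3,0,-4]), (2721461474, [-1,6,-4,0,4,-1,0,4,-2,-3]), (97794671,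
    [3,0,0,14,16,-3,-14,-16,0,0]), (520157146, [0,-14,-8,24,-4,0,24,-4,9,3]), (1330789470,
    [3,0,0,4,2,-3,-4,-2,0,0]), (299783509, [5,0,0,22,24,-5,-22,-24,0,0])]"

text \<open>The last piece of \<open>tau_target\<close> lies on the same line
  \<open>3/2 e - 3/4\<close> as the first. The loss is 0.00534, on a range around
  [13/18, 53/72].\<close>

lemma check_G: "check_cert (-75534) 150000 7222220 7361200 cert_G edge_cert_G"
  by code_simp

definition cert_H :: "type_cert list" where
  "cert_H =
    [Type_Cert 0 0 0 0 112962 0 [(12463703, [0,-3,-37,-36,81,70,40,45,-41,-40,-70,-90,36,41,4,0]), (5318733,
    [0,-21,-48,-68,90,67,41,18,-21,-41,-67,-77,68,41,18,0]), (101979561,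
    [90,53,53,15,53,15,15,-14,53,15,15,-14,15,-14,-14,-32]), (677414,
    [90,53,53,17,53,17,17,-25,53,17,17,-25,17,-25,-25,-32])], Type_Cert 11622749 0 0 0 250378 0 [(13107214,
    [85,90,90,4,0,19,19,0,0,19,19,0,-80,-61,-61,-29]), (22620411, [0,0,0,0,-18,-11,-11,0,18,11,11,0,0,0,0,0]),
    (49228471, [0,-45,45,0,0,-40,40,0,0,-40,40,0,0,-38,38,0]), (521904522,
    [90,52,52,9,57,24,24,9,57,24,24,9,27,12,12,-32]), (6501243,
    [0,23,-23,0,0,11,-11,0,0,11,-11,0,0,-90,90,0]), (18628901, [0,-30,30,0,0,-19,19,0,0,-19,19,0,0,-8,8,0]),
    (304281796, [0,-7,7,0,0,-3,3,0,0,-3,3,0,0,-10,10,0]), (676900019, [0,0,0,0,-3,-2,-2,0,3,2,2,0,0,0,0,0])],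
    Type_Cert 0 15838566 0 9798225 0 0 [(35053530, [-38,-90,-2,0,-2,0,27,11,30,2,90,-5,90,-5,-1,11]),
    (120661232, [-12,16,-15,-1,-15,-1,-4,-4,4,30,5,0,5,0,-11,2]), (5489643,
    [-8,77,19,0,19,0,90,0,9,54,22,-1,22,-1,-1,-10]), (9739156,
    [-90,-11,-67,0,-67,0,25,0,-22,-1,47,0,47,0,10,26]), (13654629, [0,0,15,2,-15,-2,0,0,0,0,-90,0,90,0,0,0]),
    (7146668360, [30,20,18,3,18,3,6,-6,21,14,13,1,13,1,2,-11]), (187363258,
    [-1,-30,4,0,4,0,11,15,8,18,5,0,5,0,-9,1]), (14883931, [42,-69,55,0,55,0,90,-4,5,-28,8,14,8,14,49,-12]),
    (25489454, [-30,-26,-9,0,-9,0,-1,8,22,3,-5,0,-5,0,14,8]), (679732107938,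
    [0,0,0,0,0,0,0,0,0,0,0,1,0,-1,0,0])], Type_Cert 9828339 0 0 0 0 108138 [(1344271112,
    [10,2,2,-1,2,-1,-1,-8,10,5,5,5,5,5,5,-8]), (17459927989, [0,0,0,0,0,0,0,0,0,0,0,3,0,-10,7,0]), (79244998,
    [29,0,0,-15,0,-15,-15,-57,90,4,4,60,4,60,60,-25]), (221463488,
    [-22,0,0,0,0,0,0,-10,0,-24,-24,-30,-24,-30,-30,23]), (624201,
    [4,0,0,-30,0,-30,-30,0,90,73,73,-1,73,-1,-1,-45]), (50041107,
    [7,0,0,9,0,9,9,-7,30,15,15,18,15,18,18,-14]), (57052142,
    [22,0,0,28,0,28,28,-21,90,45,45,55,45,55,55,-41]), (9424306695, [10,0,0,0,0,0,0,-4,0,0,0,-1,0,-1,-1,0]),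
    (1171855150, [0,0,0,1,0,1,1,5,10,0,0,2,0,2,2,-5]), (7009391381, [10,0,0,0,0,0,0,0,-3,4,4,5,4,5,5,-1])],
    Type_Cert 0 0 0 4166863 0 0 [(11841265, [13,0,14,0,14,0,-90,0,14,0,-90,0,-90,0,0,0])], Type_Cert 7104030 0
    0 0 0 0 [(591453, [48,90,90,59,90,59,5,-5,90,5,59,-5,59,-5,-5,-34]), (670720,
    [-84,44,44,27,44,27,-90,-5,44,-90,27,-5,27,-5,-5,4]), (786889, [0,1,0,-29,0,-30,0,0,-1,0,30,0,29,0,0,0]),
    (189119590, [90,51,51,26,51,26,17,5,51,17,26,5,26,5,5,-31]), (1404901471,
    [0,5,-5,0,-5,0,1,-10,5,-1,0,10,0,10,-10,0]), (152213756, [0,4,1,-10,-1,-6,0,0,-4,0,6,0,10,0,0,0]),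
    (165471484, [0,-6,3,3,-3,8,0,-10,6,0,-8,5,-3,-5,10,0]), (19793635,
    [0,-5,-26,7,26,-5,0,-17,5,0,5,-90,-7,90,17,0])], Type_Cert 8329381 0 3848698 0 3253 0 [(54758256,
    [0,-30,30,0,7,5,4,0,-7,-4,-5,0,0,0,0,0]), (91690674,
    [90,52,52,37,59,58,-37,-35,59,-37,58,-35,81,19,19,-36]), (17111959,
    [3,61,61,41,-49,-5,66,23,-49,66,-5,23,-90,48,48,-2]), (42493417, [30,6,6,0,8,8,7,8,8,7,8,8,-2,10,10,-8]),
    (343662024, [30,-7,-7,5,7,-16,16,8,7,16,-16,8,4,3,3,-5]), (38430925,
    [30,-10,-10,1,22,-10,6,1,22,6,-10,1,-24,2,2,-5]), (40242892,
    [9,0,0,-14,11,7,-6,-77,11,-6,7,-77,29,90,90,-4]), (73479256,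
    [0,29,-29,0,-45,0,10,-14,45,-10,0,14,0,-3,3,0]), (1100252830,
    [30,17,17,12,20,19,-12,-12,20,-12,19,-12,27,6,6,-12]), (6201991,
    [0,-1,1,0,-1,0,-10,-87,1,10,0,87,0,90,-90,0]), (63861043790, [0,0,0,0,-2,-1,-5,0,2,5,1,0,0,0,0,0]),
    (4897422, [-1,-4,-4,0,2,17,-30,-16,2,-30,17,-16,5,-16,-16,0])], Type_Cert 14159621 505089 0 0 309994 0
    [(94145697, [0,0,1,6,1,6,1,90,5,-26,2,-19,2,-19,13,-6]), (325481354687,
    [0,0,0,-1,0,1,0,0,0,0,0,-1,0,1,0,0]), (336523219, [22,40,0,9,0,9,4,-47,80,40,43,9,43,9,90,-80]),
    (840655895, [0,0,8,-6,-8,6,0,0,0,0,15,-6,-15,6,0,0]), (18398902,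
    [0,0,46,-90,-46,90,0,0,0,0,-75,-87,75,87,0,0]), (90875981, [0,30,0,13,0,13,0,5,4,24,0,6,0,6,6,-22]),
    (41813667, [0,76,0,34,0,34,-8,8,-3,59,-4,19,-4,19,-90,10]), (49647676,
    [0,7,0,2,0,2,3,23,4,12,0,7,0,7,30,-24]), (10607557, [0,90,3,47,3,47,10,31,-28,39,0,-10,0,-10,-67,-10]),
    (37422340, [0,29,13,7,13,7,14,14,-5,14,30,-11,30,-11,13,-23]), (255934795,
    [5,90,12,49,12,49,-60,-6,-14,25,6,-12,6,-12,-64,-11]), (4528571,
    [0,90,0,40,0,40,1,16,11,72,-1,18,-1,18,17,-67])], Type_Cert 0 0 0 0 0 0 [(338183521,
    [0,7,-7,0,-16,-37,-90,-2,16,90,37,2,0,1,-1,0]), (57088, [0,0,0,-45,0,0,0,-17,0,0,0,-17,45,17,17,0]),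
    (11661616, [0,90,-90,0,-26,46,-82,0,26,82,-46,0,0,1,-1,0])], Type_Cert 0 0 7774310 0 0 0 [(8956363227,
    [0,0,0,0,0,3,3,5,0,-3,-3,-5,0,0,0,0]), (1401787146293, [0,0,0,0,1,0,0,0,-1,0,0,0,0,0,0,0]), (646858359,
    [0,0,0,0,-24,-23,-23,-30,24,23,23,30,0,0,0,0])], Type_Cert 7024128 0 0 0 0 0 [(714776,
    [59,90,90,57,90,57,57,-3,90,57,57,-3,57,-3,-3,-68])]]"

definition edge_cert_H :: "(int \<times> int list) list" where
  "edge_cert_H =
    [(886285, [-8,65,-69,80,42,-8,80,42,-1,-45]), (15470218, [83,0,0,-56,-180,-83,56,180,0,0]), (2038519,
    [-33,180,-36,-14,100,-33,-14,100,-86,-66]), (20088560, [-41,152,-88,112,92,-43,112,96,-20,-90]),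
    (232952290, [6,-86,-34,120,-40,7,120,-42,90,-1])]"

text \<open>Loss 0.00189, within 5 * 10^-8 of the bound to be shown. The upper end is exactly 3/4,
  as only the lower end needs room, whereas 7361111 is 10^7 times 53/72, rounded down.\<close>

lemma check_H: "check_cert (-75189) 150000 7361111 7500000 cert_H edge_cert_H"
  by code_simp

section \<open>Triangle-degrees\<close>

lemma real_choose_two: "real (n choose 2) = real n * (real n - 1) / 2"
proof (induction n)
  case (Suc n)
  have "Suc n choose 2 = n + (n choose 2)" by (simp add: numeral_2_eq_2)
  then show ?case using Suc by (simp add: field_simps)
qed simp

text \<open>Each two-element set is hit by its two orderings; the diagonal contributes nothing
  because \<open>{x, x}\<close> has one element.\<close>

lemma sum_pairs_eq_card:
  assumes fin: "finite V" and F: "F \<subseteq> [V]\<^bsup>2\<^esup>"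
  shows "(\<Sum>x\<in>V. \<Sum>y\<in>V. of_bool ({x, y} \<in> F)) = 2 * real (card F)"
proof -
  have finF: "finite F"
    using F fin by (meson finite_subset finite_imp_finite_nsets)
  have "(\<Sum>x\<in>V. \<Sum>y\<in>V. of_bool ({x, y} \<in> F) :: real)
      = (\<Sum>p\<in>V \<times> V. \<Sum>e\<in>F. of_bool ({fst p, snd p} = e))"
    unfolding sum_Times using finF by (intro sum.cong refl) (simp add: of_bool_def)
  also have "\<dots> = (\<Sum>e\<in>F. \<Sum>p\<in>V \<times> V. of_bool ({fst p, snd p} = e))"
    by (rule sum.swap)
  also have "\<dots> = (\<Sum>e\<in>F. 2)"
  proof (rule sum.cong[OF refl])
    fix e assume "e \<in> F"
    then have "e \<subseteq> V" "card e = 2" using F by (auto simp: nsets_def)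
    then obtain x y where e: "e = {x, y}" "x \<noteq> y" "x \<in> V" "y \<in> V"
      by (auto simp: card_2_iff)
    have "(\<Sum>p\<in>V \<times> V. of_bool ({fst p, snd p} = e)) = (\<Sum>p\<in>{(x, y), (y, x)}. 1 :: real)"
      using fin e by (intro sum.mono_neutral_cong_right) (auto simp: doubleton_eq_iff)
    then show "(\<Sum>p\<in>V \<times> V. of_bool ({fst p, snd p} = e)) = (2 :: real)"
      using e by simp
  qed
  finally show ?thesis by simp
qed

text \<open>A triangle through \<open>v\<close> corresponds to its edge opposite \<open>v\<close>,
  by removing and inserting \<open>v\<close>.\<close>

lemma card_link_edges:
  assumes G: "simple_graph G" and v: "v \<in> verts G"
  shows "card {e \<in> edges G. \<forall>x\<in>e. {v, x} \<in> edges G} = triangle_degree G v"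
proof -
  let ?L = "{e \<in> edges G. \<forall>x\<in>e. {v, x} \<in> edges G}"
  let ?T = "{T \<in> triangles G. v \<in> T}"
  have edge: "e \<subseteq> verts G \<and> finite e \<and> card e = 2" if "e \<in> edges G" for e
    using that G by (auto simp: simple_graph_def nsets_def)
  \<comment> \<open>If \<open>v\<close> were on \<open>e\<close>, the singleton
    \<open>{v, v}\<close> would be an edge.\<close>
  have v_notin: "v \<notin> e" if "e \<in> ?L" for e
    using that edge[of "{v, v}"] by auto
  have "bij_betw (insert v) ?L ?T"
  proof (rule bij_betw_byWitness[where f' = "\<lambda>T. T - {v}"])
    show "\<forall>e\<in>?L. insert v e - {v} = e" using v_notin by auto
    show "\<forall>T\<in>?T. insert v (T - {v}) = T" by auto
    show "insert v ` ?L \<subseteq> ?T"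
    proof safe
      fix e assume e: "e \<in> edges G" "\<forall>x\<in>e. {v, x} \<in> edges G"
      then have "v \<notin> e" using v_notin by blast
      have "insert v e \<in> [verts G]\<^bsup>3\<^esup>"
        using edge[OF e(1)] v \<open>v \<notin> e\<close> by (auto simp: nsets_def)
      moreover have "f \<in> edges G" if f: "f \<subseteq> insert v e" "card f = 2" "finite f" for f
      proof (cases "v \<in> f")
        case True
        then have "card (f - {v}) = 1" using f by simp
        then obtain x where "f - {v} = {x}" by (auto simp: card_1_singleton_iff)
        then have "f = {v, x}" "x \<in> e" using True f(1) by auto
        then show ?thesis using e(2) by simp
      next
        case False
        then have "f = e" using f edge[OF e(1)] by (intro card_subset_eq) auto
        then show ?thesis using e(1) by simp
      qed
      ultimately show "insert v e \<in> triangles G"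
        by (auto simp: triangles_def nsets_def)
    qed
    show "(\<lambda>T. T - {v}) ` ?T \<subseteq> ?L"
    proof (rule image_subsetI)
      fix T assume T: "T \<in> ?T"
      then have sub: "[T]\<^bsup>2\<^esup> \<subseteq> edges G" and card: "finite T" "card T = 3" "v \<in> T"
        by (auto simp: triangles_def nsets_def)
      have "T - {v} \<in> edges G"
        using card by (intro subsetD[OF sub]) (auto simp: nsets_def)
      moreover have "{v, x} \<in> edges G" if "x \<in> T - {v}" for x
        using card that by (intro subsetD[OF sub]) (auto simp: nsets_def card_2_iff)
      ultimately show "T - {v} \<in> ?L" by blast
    qed
  qed
  then show ?thesis by (simp add: bij_betw_same_card triangle_degree_def)
qed

lemma tri_sum_eq_triangle_degree:
  assumes G: "simple_graph G" and v: "v \<in> verts G"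
  shows "tri_sum (verts G) (\<lambda>x y. {x, y} \<in> edges G) v = 2 * real (triangle_degree G v)"
proof -
  let ?L = "{e \<in> edges G. \<forall>x\<in>e. {v, x} \<in> edges G}"
  have "tri_sum (verts G) (\<lambda>x y. {x, y} \<in> edges G) v
      = (\<Sum>x\<in>verts G. \<Sum>y\<in>verts G. of_bool ({x, y} \<in> ?L))"
    unfolding tri_sum_def by (intro sum.cong refl arg_cong[of _ _ of_bool]) auto
  also have "\<dots> = 2 * real (card ?L)"
    using G by (intro sum_pairs_eq_card) (auto simp: simple_graph_def)
  finally show ?thesis using card_link_edges[OF G v] by simp
qed

text \<open>The graph may have far more edges than the certificate tolerates. The certificate is
  therefore applied to a subgraph with just enough edges for density \<open>rho\<close>, whose
  triangle-degrees bound those of \<open>G\<close> from below.\<close>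

lemma t_max_lower_bound:
  fixes G :: "nat graph"
  assumes cert: "check_cert tc ec lo hi cs q" and ec: "ec \<ge> 0"
    and G: "simple_graph G" "card (verts G) = n" "edge_density G \<ge> \<rho>"
    and \<rho>: "\<rho> > 0" "of_int lo * real n \<le> 10000000 * \<rho> * (real n - 1)" "10000000 * \<rho> \<le> of_int hi"
    and n: "n \<ge> 3" "\<rho> * real n \<ge> 2"
  shows "(of_int tc + of_int ec * \<rho> * (1 - 1 / real n)) / 100000
    \<le> real (t_max G) / real ((n - 1) choose 2)"
proof -
  let ?V = "verts G"
  \<comment> \<open>The least number of edges whose density is at least \<open>rho\<close>.\<close>
  define m where "m = nat \<lceil>\<rho> * real (n choose 2)\<rceil>"
  have fin: "finite ?V" and ne: "?V \<noteq> {}"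
    using G n by (auto simp: simple_graph_def)
  have n2: "real (n choose 2) = real n * (real n - 1) / 2"
    by (rule real_choose_two)
  have "real (n choose 2) > 0" using n by (simp add: n2)
  then have "\<rho> * real (n choose 2) \<le> real (card (edges G))"
    using G(2,3) by (simp add: edge_density_def pos_le_divide_eq)
  then have "m \<le> card (edges G)" unfolding m_def by linarith
  then obtain F where F: "F \<subseteq> edges G" "card F = m"
    by (meson obtain_subset_with_card_n)
  \<comment> \<open>Rounding up costs at most 2 in \<open>2 * m\<close>. Passing from
    \<open>n * (n - 1)\<close> to \<open>n^2\<close> gains \<open>rho * n\<close>, which is at least
    2 by assumption, so the upper density bound holds without error term.\<close>
  have m: "2 * real m \<ge> \<rho> * real n * (real n - 1)" "2 * real m \<le> \<rho> * (real n)\<^sup>2"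
  proof -
    have pos: "\<rho> * real (n choose 2) \<ge> 0" using \<rho>(1) by simp
    then have "real m \<ge> \<rho> * real (n choose 2)" "real m \<le> \<rho> * real (n choose 2) + 1"
      unfolding m_def by linarith+
    moreover have "2 * (\<rho> * real (n choose 2)) = \<rho> * real n * (real n - 1)"
      by (simp add: n2)
    moreover have "\<rho> * real n * (real n - 1) = \<rho> * (real n)\<^sup>2 - \<rho> * real n"
      by (simp add: power2_eq_square algebra_simps)
    ultimately show "2 * real m \<ge> \<rho> * real n * (real n - 1)" "2 * real m \<le> \<rho> * (real n)\<^sup>2"
      using n(2) by linarith+
  qed
  let ?a = "\<lambda>x y. {x, y} \<in> F"
  have F2: "F \<subseteq> [?V]\<^bsup>2\<^esup>" using F(1) G(1) by (auto simp: simple_graph_def)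
  have E: "edge_sum ?V ?a = 2 * real m"
    unfolding edge_sum_def sum_pairs_eq_card[OF fin F2] F(2) ..
  have lo: "of_int lo * (real (card ?V))\<^sup>2 \<le> 10000000 * edge_sum ?V ?a"
  proof -
    have "of_int lo * real n * real n \<le> 10000000 * \<rho> * (real n - 1) * real n"
      using \<rho>(2) by (intro mult_right_mono) auto
    then show ?thesis using m(1) by (simp add: E G(2) power2_eq_square algebra_simps)
  qed
  have hi: "10000000 * edge_sum ?V ?a \<le> of_int hi * (real (card ?V))\<^sup>2"
  proof -
    have "10000000 * \<rho> * (real n)\<^sup>2 \<le> of_int hi * (real n)\<^sup>2"
      using \<rho>(3) by (intro mult_right_mono) auto
    then show ?thesis using m(2) by (simp add: E G(2))
  qed
  have "\<exists>v\<in>?V. 100000 * tri_sum ?V ?a v > of_int tc * (real (card ?V))\<^sup>2 + of_int ec * edge_sum ?V ?a"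
  proof (rule tri_sum_lower_bound)
    show "{x, y} \<in> F \<longleftrightarrow> {y, x} \<in> F" for x y by (simp add: insert_commute)
    show "{x, x} \<notin> F" for x using F2 by (auto simp: nsets_def)
    show "cert_nonneg cs" "sos_nonneg q" using cert by simp_all
    show "trie_nonpos (edge_step (sos_rows q) fours edge_words
        (types_step tc ec lo hi type_tables cs
          (insert_trie (bits (Pat False False False False False False False False False False
            False False False False False)) 1 Empty)))"
      using cert unfolding check_cert.simps by blast
  qed (use fin ne lo hi in auto)
  then obtain v where v: "v \<in> ?V"
    "100000 * tri_sum ?V ?a v > of_int tc * (real n)\<^sup>2 + of_int ec * (2 * real m)"
    unfolding E G(2) by blast
  \<comment> \<open>The vertex was found in the subgraph; putting the deleted edges back can only
    create triangles at it.\<close>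
  have "tri_sum ?V ?a v \<le> tri_sum ?V (\<lambda>x y. {x, y} \<in> edges G) v"
    unfolding tri_sum_def using F(1) by (intro sum_mono) auto
  also have "\<dots> = 2 * real (triangle_degree G v)"
    by (rule tri_sum_eq_triangle_degree[OF G(1) v(1)])
  also have "triangle_degree G v \<le> t_max G"
    using v(1) fin by (simp add: t_max_def)
  finally have t: "tri_sum ?V ?a v \<le> 2 * real (t_max G)" by simp
  have "of_int ec * (\<rho> * real n * (real n - 1)) \<le> of_int ec * (2 * real m)"
    using ec m(1) by (intro mult_left_mono) auto
  then have "(of_int tc * (real n)\<^sup>2 + of_int ec * (\<rho> * real n * (real n - 1))) / 100000
      \<le> 2 * real (t_max G)"
    using v(2) t by simp
  then have "(of_int tc * (real n)\<^sup>2 + of_int ec * (\<rho> * real n * (real n - 1))) / 100000 / (real n)\<^sup>2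
      \<le> 2 * real (t_max G) / (real n)\<^sup>2"
    by (rule divide_right_mono) simp
  also have "(of_int tc * (real n)\<^sup>2 + of_int ec * (\<rho> * real n * (real n - 1))) / 100000 / (real n)\<^sup>2
      = (of_int tc + of_int ec * \<rho> * (1 - 1 / real n)) / 100000"
    using n by (simp add: field_simps power2_eq_square)
  \<comment> \<open>The normalisation by \<open>n^2 / 2\<close> that comes from counting with
    repetition is larger than \<open>(n - 1) choose 2\<close>, so replacing it goes in the
    favourable direction.\<close>
  also have "2 * real (t_max G) / (real n)\<^sup>2 \<le> real (t_max G) / real ((n - 1) choose 2)"
  proof -
    have c: "real ((n - 1) choose 2) = (real n - 1) * (real n - 2) / 2"
      using n by (simp add: real_choose_two of_nat_diff)
    have "(real n - 1) * (real n - 2) \<le> real n * real n"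
      using n by (intro mult_mono) auto
    moreover have "(real n - 1) * (real n - 2) > 0" using n by simp
    ultimately have "2 * real (t_max G) / (real n)\<^sup>2 \<le> 2 * real (t_max G) / ((real n - 1) * (real n - 2))"
      by (intro divide_left_mono) (auto simp: power2_eq_square)
    then show ?thesis unfolding c by (simp add: mult.commute)
  qed
  finally show ?thesis .
qed

text \<open>The bound for fixed \<open>n\<close> tends to the affine value. The inequality for
  \<open>lo\<close> is strict because the trimmed graph is only guaranteed density
  \<open>rho * (1 - 1/n)\<close> when pairs are counted with repetition, and this must reach the
  range of the certificate for all large \<open>n\<close>.\<close>

lemma tau_lower_bound:
  assumes cert: "check_cert tc ec lo hi cs q" and ec: "ec \<ge> 0"
    and \<rho>: "0 < \<rho>" "\<rho> \<le> 1" "of_int lo < 10000000 * \<rho>" "10000000 * \<rho> \<le> of_int hi"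
    and x: "x \<le> (of_int tc + of_int ec * \<rho>) / 100000"
  shows "tau \<rho> \<ge> ereal x"
proof -
  let ?b = "\<lambda>n. ereal ((of_int tc + of_int ec * \<rho> * (1 - 1 / real n)) / 100000)"
  have "(\<lambda>n. (of_int tc + of_int ec * \<rho> * (1 - 1 / real n)) / 100000)
      \<longlonglongrightarrow> (of_int tc + of_int ec * \<rho> * (1 - 0)) / 100000"
    by (intro tendsto_intros lim_1_over_n) simp
  then have lim: "?b \<longlonglongrightarrow> ereal ((of_int tc + of_int ec * \<rho>) / 100000)"
    by simp
  have "eventually (\<lambda>n. ?b n \<le> ereal (Min (t_max_values \<rho> n))) sequentially"
  proof -
    have 1: "eventually (\<lambda>n. of_int lo * real n \<le> 10000000 * \<rho> * (real n - 1)) sequentially"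
      using \<rho>(3) by real_asymp
    have 2: "eventually (\<lambda>n. \<rho> * real n \<ge> 2) sequentially"
      using \<rho>(1) by real_asymp
    show ?thesis
      using 1 2 eventually_ge_at_top[of 3]
    proof eventually_elim
      case (elim n)
      \<comment> \<open>Finiteness and, by \<open>rho <= 1\<close>, nonemptiness ensure that the
        minimum is attained by an actual graph.\<close>
      then have "Min (t_max_values \<rho> n) \<in> t_max_values \<rho> n"
        using \<rho>(2) by (intro Min_in finite_t_max_values t_max_values_nonempty) auto
      then obtain G :: "nat graph" where "simple_graph G" "card (verts G) = n" "edge_density G \<ge> \<rho>"
        "Min (t_max_values \<rho> n) = real (t_max G) / real ((n - 1) choose 2)"
        by (auto simp: t_max_values_def)
      then show ?case
        using t_max_lower_bound[OF cert ec, of G n \<rho>] elim \<rho> by simp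
    qed
  qed
  then have "liminf ?b \<le> tau \<rho>"
    unfolding tau_def by (rule Liminf_mono)
  then have "ereal ((of_int tc + of_int ec * \<rho>) / 100000) \<le> tau \<rho>"
    using lim_imp_Liminf[OF _ lim] by simp
  with x show ?thesis by (meson ereal_less_eq(3) order_trans)
qed

theorem theorem3p8:
  fixes \<rho> :: real
  shows "(\<rho> \<in> {1/2..29/54} \<longrightarrow> tau \<rho> \<ge> ereal (tau_target \<rho> - 0.0010705)) \<and>
    (\<rho> \<in> {29/54..31/54} \<longrightarrow> tau \<rho> \<ge> ereal (tau_target \<rho> - 0.0044863)) \<and>
    (\<rho> \<in> {31/54..11/18} \<longrightarrow> tau \<rho> \<ge> ereal (tau_target \<rho> - 0.0106917)) \<and>
    (\<rho> \<in> {11/18..17/27} \<longrightarrow> tau \<rho> \<ge> ereal (tau_target \<rho> - 0.0106917)) \<and>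
    (\<rho> \<in> {17/27..35/54} \<longrightarrow> tau \<rho> \<ge> ereal (tau_target \<rho> - 0.0058198)) \<and>
    (\<rho> \<in> {35/54..2/3} \<longrightarrow> tau \<rho> \<ge> ereal (tau_target \<rho> - 0.0002057)) \<and>
    (\<rho> \<in> {2/3..25/36} \<longrightarrow> tau \<rho> \<ge> ereal (tau_target \<rho> - 0.00123143)) \<and>
    (\<rho> \<in> {25/36..13/18} \<longrightarrow> tau \<rho> \<ge> ereal (tau_target \<rho> - 0.00534603)) \<and>
    (\<rho> \<in> {13/18..53/72} \<longrightarrow> tau \<rho> \<ge> ereal (tau_target \<rho> - 0.00534583)) \<and>
    (\<rho> \<in> {53/72..3/4} \<longrightarrow> tau \<rho> \<ge> ereal (tau_target \<rho> - 0.00189005))"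
proof (intro conjI impI)
  assume r: "\<rho> \<in> {1/2..29/54}"
  then have "tau_target \<rho> = 3/2 * (\<rho> - 1/2)"
    by (intro tau_target_piecewise) auto
  then show "tau \<rho> \<ge> ereal (tau_target \<rho> - 0.0010705)"
    using r by (intro tau_lower_bound[OF check_A]) simp_all
next
  assume r: "\<rho> \<in> {29/54..31/54}"
  then have "tau_target \<rho> = 3/2 * (\<rho> - 1/2)"
    by (intro tau_target_piecewise) auto
  \<comment> \<open>The range of certificate A extends to 31/54, and its loss 0.00107 is smaller
    than the one allowed here.\<close>
  then show "tau \<rho> \<ge> ereal (tau_target \<rho> - 0.0044863)"
    using r by (intro tau_lower_bound[OF check_A]) simp_all
next
  assume r: "\<rho> \<in> {31/54..11/18}"
  then have "tau_target \<rho> = 3/2 * (\<rho> - 1/2)"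
    by (intro tau_target_piecewise) auto
  then show "tau \<rho> \<ge> ereal (tau_target \<rho> - 0.0106917)"
    using r by (intro tau_lower_bound[OF check_B]) simp_all
next
  assume r: "\<rho> \<in> {11/18..17/27}"
  then have "tau_target \<rho> = \<rho> - 4/9"
    by (intro tau_target_piecewise) auto
  then show "tau \<rho> \<ge> ereal (tau_target \<rho> - 0.0106917)"
    using r by (intro tau_lower_bound[OF check_C]) simp_all
next
  assume r: "\<rho> \<in> {17/27..35/54}"
  then have "tau_target \<rho> = \<rho> - 4/9"
    by (intro tau_target_piecewise) auto
  \<comment> \<open>Certificate C covers this interval too; its loss of about 0.00406 is below both
    allowances.\<close>
  then show "tau \<rho> \<ge> ereal (tau_target \<rho> - 0.0058198)"
    using r by (intro tau_lower_bound[OF check_C]) simp_all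
next
  assume r: "\<rho> \<in> {35/54..2/3}"
  then have "tau_target \<rho> = \<rho> - 4/9"
    by (intro tau_target_piecewise) auto
  then show "tau \<rho> \<ge> ereal (tau_target \<rho> - 0.0002057)"
    using r by (intro tau_lower_bound[OF check_D]) simp_all
next
  assume r: "\<rho> \<in> {2/3..25/36}"
  then have "tau_target \<rho> = 2/9 + 2 * (\<rho> - 2/3)"
    by (intro tau_target_piecewise) auto
  then show "tau \<rho> \<ge> ereal (tau_target \<rho> - 0.00123143)"
    using r by (intro tau_lower_bound[OF check_E]) simp_all
next
  assume r: "\<rho> \<in> {25/36..13/18}"
  then have "tau_target \<rho> = 2/9 + 2 * (\<rho> - 2/3)"
    by (intro tau_target_piecewise) auto
  then show "tau \<rho> \<ge> ereal (tau_target \<rho> - 0.00534603)"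
    using r by (intro tau_lower_bound[OF check_F]) simp_all
next
  assume r: "\<rho> \<in> {13/18..53/72}"
  \<comment> \<open>Expanding the last piece, 3/8 - 9/8 = -3/4, brings it into the form in which it
    is compared with \<open>tc\<close> and \<open>ec\<close>.\<close>
  then have "tau_target \<rho> = 3/2 * \<rho> - 3/4"
    by (subst tau_target_piecewise(4)) (auto simp: field_simps)
  then show "tau \<rho> \<ge> ereal (tau_target \<rho> - 0.00534583)"
    using r by (intro tau_lower_bound[OF check_G]) simp_all
next
  assume r: "\<rho> \<in> {53/72..3/4}"
  then have "tau_target \<rho> = 3/2 * \<rho> - 3/4"
    by (subst tau_target_piecewise(4)) (auto simp: field_simps)
  then show "tau \<rho> \<ge> ereal (tau_target \<rho> - 0.00189005)"
    using r by (intro tau_lower_bound[OF check_H]) simp_all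
qed

end
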